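(* Let $k\ge 1$ be an integer and let $P_{2k}$ be a homogeneous polynomial of degree $2k>0$ on $\mathbb{R}^d$ such that there exist $C>0$, $D>0$ and $\alpha\ge 0$ with $$\langle P_{2k}f_m,f_m\rangle_{L^2(\mathbb{S}^{d-1})}\ \ge\ \frac{1}{C(m+D)^{\alpha}}\,\langle f_m,f_m\rangle_{L^2(\mathbb{S}^{d-1})}$$ for all $m\in\mathbb{N}_0$ and all homogeneous polynomials $f_m$ of degree $m$. Let $\beta$ be an integer with $0\le \beta<2k$, and for $j=0,\dots,\beta$ let $P_j$ be a homogeneous polynomial of degree $j$. Then for every entire function $f$ of order $\rho<(2k-\beta)/\alpha$ there exist entire functions $q$ and $r$ of order $\le\rho$ such that $$f=(P_{2k}-P_\beta-\cdots-P_0)\,q+r\quad\text{and}\quad \Delta^k r=0.$$ If $\alpha=0$, then $(2k-\beta)/\alpha$ is interpreted as $\infty$.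
   Context: $d$ is a positive integer. Polynomials in $x=(x_1,\dots,x_d)\in\mathbb{R}^d$ have complex coefficients; the zero polynomial counts as homogeneous of every degree. $\mathbb{S}^{d-1}=\{\theta\in\mathbb{R}^d:|\theta|=1\}$ is the unit sphere with surface measure $d\theta$, and $\langle f,g\rangle_{L^2(\mathbb{S}^{d-1})}=\int_{\mathbb{S}^{d-1}}f(\theta)\overline{g(\theta)}\,d\theta$. An inequality involving such an inner product includes the assertion that it is real. $\Delta=\partial^2/\partial x_1^2+\cdots+\partial^2/\partial x_d^2$ and $\Delta^k$ is its $k$-th iterate. An entire function is a holomorphic function $f:\mathbb{C}^d\to\mathbb{C}$; it is identified with its restriction to $\mathbb{R}^d$. Order: for $r>0$ put $M(f,r)=\sup\{|f(\zeta\theta)|:\zeta\in\mathbb{C},|\zeta|=r,\theta\in\mathbb{S}^{d-1}\}$. The order of a non-constant entire function $f$ is $\rho(f)=\limsup_{r\to\infty}\frac{\log\log M(f,r)}{\log r}\in[0,\infty]$; constant functions are regarded as having order $0$. (The same order results if $M(f,r)$ is replaced by $\sup\{|f(z)|:z\in\mathbb{C}^d,|z|=r\}$.) *)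

theory Defs
  imports "HOL-Analysis.Analysis"
begin

text \<open>
  The dimension \<open>d \<ge> 1\<close> is \<open>CARD('n)\<close>. Polynomials and entire functions are functions
  on \<open>complex ^ 'n\<close>; \<open>cvec\<close> embeds \<open>real ^ 'n\<close>, and restriction to real vectors is
  composition with \<open>cvec\<close>.
\<close>

definition cvec :: "real ^ 'n \<Rightarrow> complex ^ 'n" where
  "cvec x = (\<chi> i. complex_of_real (x $ i))"


text \<open>
  The zero polynomial is homogeneous of every degree. The index set of the sum is finite
  because \<open>'n\<close> is.
\<close>

definition hom_poly :: "nat \<Rightarrow> (complex ^ 'n::finite \<Rightarrow> complex) \<Rightarrow> bool" where
  "hom_poly m p \<longleftrightarrow>
     (\<exists>c :: ('n \<Rightarrow> nat) \<Rightarrow> complex.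
        \<forall>z. p z = (\<Sum>a | sum a UNIV = m. c a * (\<Prod>i\<in>UNIV. z $ i ^ a i)))"

lemma finite_multi_index: "finite {a :: 'n::finite \<Rightarrow> nat. sum a UNIV = m}"
proof (rule finite_subset)
  show "{a :: 'n \<Rightarrow> nat. sum a UNIV = m} \<subseteq> PiE UNIV (\<lambda>_. {..m})"
    by (auto intro: member_le_sum)
qed (simp add: finite_PiE)


text \<open>
  Surface measure as \<open>d\<close> times the image of Lebesgue measure on the punctured closed unit ball
  under radial projection: \<open>\<sigma>(A) = d \<cdot> \<lambda>{t\<theta> | 0 < t \<le> 1, \<theta> \<in> A}\<close>.
\<close>

definition sphere_measure :: "(real ^ 'n::finite) measure" where
  "sphere_measure =
     scale_measure (of_nat CARD('n))
       (distr (restrict_space lborel (cball 0 1 - {0})) (restrict_space borel (sphere 0 1))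
          (\<lambda>x. x /\<^sub>R norm x))"

definition sphere_inner ::
    "(complex ^ 'n::finite \<Rightarrow> complex) \<Rightarrow> (complex ^ 'n \<Rightarrow> complex) \<Rightarrow> complex" where
  "sphere_inner f g = (LINT \<theta>|sphere_measure. f (cvec \<theta>) * cnj (g (cvec \<theta>)))"


definition partial_deriv :: "'n::finite \<Rightarrow> (real ^ 'n \<Rightarrow> complex) \<Rightarrow> real ^ 'n \<Rightarrow> complex" where
  "partial_deriv i f x = vector_derivative (\<lambda>t. f (x + t *\<^sub>R axis i 1)) (at 0)"

definition laplacian :: "(real ^ 'n::finite \<Rightarrow> complex) \<Rightarrow> real ^ 'n \<Rightarrow> complex" where
  "laplacian f x = (\<Sum>i\<in>UNIV. partial_deriv i (partial_deriv i f) x)"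


text \<open>
  Holomorphic on the whole space: the real Frechet derivative exists and is complex-linear
  at every point.
\<close>

definition entire :: "(complex ^ 'n::finite \<Rightarrow> complex) \<Rightarrow> bool" where
  "entire f \<longleftrightarrow>
     (\<forall>z. \<exists>f'. (f has_derivative f') (at z) \<and> Vector_Spaces.linear (*s) (*) f')"

definition max_modulus :: "(complex ^ 'n::finite \<Rightarrow> complex) \<Rightarrow> real \<Rightarrow> real" where
  "max_modulus f r = Sup {cmod (f (\<zeta> *s cvec \<theta>)) |\<zeta> \<theta>. cmod \<zeta> = r \<and> norm \<theta> = 1}"

definition growth_order :: "(complex ^ 'n::finite \<Rightarrow> complex) \<Rightarrow> ereal" where
  "growth_order f =
     (if \<exists>c. \<forall>z. f z = c then 0
      else Limsup at_top (\<lambda>r. ereal (ln (ln (max_modulus f r)) / ln r)))"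

end

(*
  For homogeneous f of degree m, the equation f = P q + r with Delta^k r = 0 decouples on the sphere:
  r is orthogonal in L^2 of the sphere to all homogeneous polynomials g of degree m - 2k if and only
  if Delta^k r = 0. So q is found by solving <P q - f, g> = 0 for all such g, which is possible by
  coercivity, and testing with g = q gives |q| <= C (m + D)^alpha |f|. Iterating over the
  lower-order terms drops the degree by at least 2k - beta at the cost of one factor of size
  m^alpha, so a component of degree m contributes at most
  m^(alpha (m - n) / (2k - beta)) m^(-m/rho) in degree n. This sums to an entire function of order
  at most rho exactly because alpha / (2k - beta) < 1 / rho.

  Only the implication from orthogonality to Delta^k r = 0 is needed. It holds because |x|^2 Delta
  is symmetric on homogeneous polynomials of a fixed degree (Green's identity, obtained by comparing
  the surface measure with the Gaussian measure) and |x|^(2k) Delta^k is a polynomial in |x|^2 Delta.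
*)
theory Submission
  imports Defs "HOL-Complex_Analysis.Complex_Analysis" "HOL-Probability.Probability"
    "HOL-Real_Asymp.Real_Asymp" "HOL-Library.Function_Algebras"
begin

subsection \<open>Homogeneous polynomials\<close>

text \<open>Coercivity controls q only in L^2 of the real sphere, while an entire series has to be
  summed over complex arguments. The bridge loses a geometric factor: a homogeneous polynomial of
  degree n is bounded at every complex z by K B^n |z|^n times its L^2 norm. Such factors do not
  change the order, since the components of f decay faster than any geometric sequence. The
  coercivity constant varies with the degree. To keep the iteration geometric, the component of
  degree m is treated throughout with the constant of degree m, which dominates all those that
  occur. Only the quotients are estimated: r is f minus a product, so its convergence and its growth
  are inherited. The function q is one fixed series; every exponent above the order of f yields a
  bound for it, and a strict gap between exponents absorbs all constants.\<close>

definition mon :: "('n::finite \<Rightarrow> nat) \<Rightarrow> complex ^ 'n \<Rightarrow> complex" where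
  "mon a z = (\<Prod>i\<in>UNIV. z $ i ^ a i)"

lemma hom_poly_iff:
  "hom_poly m p \<longleftrightarrow> (\<exists>c. p = (\<lambda>z. \<Sum>a | sum a UNIV = m. c a * mon a z))"
  by (simp add: hom_poly_def mon_def fun_eq_iff)

lemma hom_poly_zero [simp]: "hom_poly m (\<lambda>z. 0)"
  unfolding hom_poly_iff by (rule exI[of _ "\<lambda>_. 0"]) simp

lemma hom_poly_add [intro]:
  assumes "hom_poly m p" "hom_poly m q"
  shows "hom_poly m (\<lambda>z. p z + q z)"
proof -
  obtain c d where "p = (\<lambda>z. \<Sum>a | sum a UNIV = m. c a * mon a z)"
    "q = (\<lambda>z. \<Sum>a | sum a UNIV = m. d a * mon a z)"
    using assms unfolding hom_poly_iff by blast
  then show ?thesis unfolding hom_poly_iff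
    by (intro exI[of _ "\<lambda>a. c a + d a"]) (simp add: sum.distrib distrib_right)
qed

lemma hom_poly_cmult [intro]:
  assumes "hom_poly m p"
  shows "hom_poly m (\<lambda>z. c * p z)"
proof -
  obtain d where "p = (\<lambda>z. \<Sum>a | sum a UNIV = m. d a * mon a z)"
    using assms unfolding hom_poly_iff by blast
  then show ?thesis unfolding hom_poly_iff
    by (intro exI[of _ "\<lambda>a. c * d a"]) (simp add: sum_distrib_left mult.assoc)
qed

lemma hom_poly_diff [intro]:
  assumes "hom_poly m p" "hom_poly m q"
  shows "hom_poly m (\<lambda>z. p z - q z)"
  using hom_poly_add[OF assms(1) hom_poly_cmult[OF assms(2), of "-1"]] by simp

lemma hom_poly_sum [intro]:
  assumes "\<And>i. i \<in> A \<Longrightarrow> hom_poly m (p i)"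
  shows "hom_poly m (\<lambda>z. \<Sum>i\<in>A. p i z)"
  using assms by (induction A rule: infinite_finite_induct) auto

lemma hom_poly_mon [intro]:
  assumes "sum a UNIV = m"
  shows "hom_poly m (mon a)"
  unfolding hom_poly_iff
proof (intro exI ext)
  fix z
  show "mon a z = (\<Sum>b | sum b UNIV = m. (if b = a then 1 else 0) * mon b z)"
    using assms by (simp add: if_distrib if_distribR sum.delta finite_multi_index cong: if_cong)
qed

text \<open>Linear properties need to be checked on monomials only; the case \<open>zero\<close>
  starts the induction over partial sums.\<close>

lemma hom_poly_induct [consumes 1, case_names mon add cmult zero]:
  assumes "hom_poly m p"
    and mon: "\<And>a. sum a UNIV = m \<Longrightarrow> Q (mon a)"
    and add: "\<And>p q. hom_poly m p \<Longrightarrow> hom_poly m q \<Longrightarrow> Q p \<Longrightarrow> Q q \<Longrightarrow> Q (\<lambda>z. p z + q z)"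
    and cmult: "\<And>c p. hom_poly m p \<Longrightarrow> Q p \<Longrightarrow> Q (\<lambda>z. c * p z)"
    and zero: "Q (\<lambda>z. 0)"
  shows "Q p"
proof -
  obtain c where c: "p = (\<lambda>z. \<Sum>a | sum a UNIV = m. c a * mon a z)"
    using assms(1) unfolding hom_poly_iff by blast
  have "finite A \<Longrightarrow> A \<subseteq> {a. sum a UNIV = m} \<Longrightarrow> Q (\<lambda>z. \<Sum>a\<in>A. c a * mon a z)" for A
  proof (induction A rule: finite_induct)
    case (insert a A)
    then have "Q (\<lambda>z. c a * mon a z + (\<Sum>a\<in>A. c a * mon a z))"
      by (intro add cmult mon hom_poly_cmult hom_poly_mon hom_poly_sum) auto
    then show ?case using insert by simp
  qed (simp add: zero)
  then show ?thesis using c finite_multi_index by blast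
qed

lemma mon_mult: "mon a z * mon b z = mon (\<lambda>i. a i + b i) z"
  by (simp add: mon_def power_add prod.distrib)

lemma hom_poly_mult [intro]:
  assumes "hom_poly m p" "hom_poly n q"
  shows "hom_poly (m + n) (\<lambda>z. p z * q z)"
  using assms(1)
proof (induction rule: hom_poly_induct)
  case (mon a)
  show ?case using assms(2)
  proof (induction rule: hom_poly_induct)
    case (mon b)
    then show ?case using \<open>sum a UNIV = m\<close> by (auto simp: mon_mult sum.distrib)
  next
    case (add p q)
    then show ?case using hom_poly_add[OF add(3,4)] by (simp add: distrib_left)
  next
    case (cmult c p)
    then show ?case using hom_poly_cmult[OF cmult(2), of c] by (simp add: mult.left_commute)
  qed simp
next
  case (add p q)
  then show ?case using hom_poly_add[OF add(3,4)] by (simp add: distrib_right)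
next
  case (cmult c p)
  then show ?case using hom_poly_cmult[OF cmult(2), of c] by (simp add: mult.assoc)
qed simp

lemma hom_poly_scale:
  assumes "hom_poly m p"
  shows "p (t *s z) = t ^ m * p z"
  using assms
proof (induction rule: hom_poly_induct)
  case (mon a)
  then show ?case
    by (simp add: mon_def power_mult_distrib prod.distrib power_sum[symmetric])
qed (auto simp: algebra_simps)

lemma mon_0 [simp]: "mon (\<lambda>_. 0) z = 1"
  by (simp add: mon_def)

lemma hom_poly_const [simp]: "hom_poly 0 (\<lambda>z. c)"
  using hom_poly_cmult[OF hom_poly_mon[of "\<lambda>_. 0" 0], of c] by simp

lemma hom_poly_0_const:
  assumes "hom_poly 0 p"
  shows "p z = p 0"
  using hom_poly_scale[OF assms, of 0 z] by simp

lemma hom_poly_coord [simp]: "hom_poly 1 (\<lambda>z. z $ i)"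
proof -
  have "mon (\<lambda>j. if j = i then 1 else 0) = (\<lambda>z :: complex ^ 'a. z $ i)"
    by (simp add: mon_def fun_eq_iff if_distrib prod.delta cong: if_cong)
  then show ?thesis
    using hom_poly_mon[of "\<lambda>j. if j = i then 1 else 0" 1] by simp
qed

lemma hom_poly_power:
  assumes "hom_poly m p"
  shows "hom_poly (k * m) (\<lambda>z. p z ^ k)"
  by (induction k) (auto intro: hom_poly_mult[OF assms])

text \<open>Conjugating both the argument and the value conjugates the coefficients, so
  \<open>\<lambda>z. cnj (p (vcnj z))\<close> is a polynomial that agrees with the conjugate of
  \<open>p\<close> at real vectors. This turns the inner product into the integral of a
  polynomial.\<close>

definition vcnj :: "complex ^ 'n \<Rightarrow> complex ^ 'n" where
  "vcnj z = (\<chi> i. cnj (z $ i))"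

lemma vcnj_cvec [simp]: "vcnj (cvec x) = cvec x"
  by (simp add: vcnj_def cvec_def)

lemma hom_poly_cnj:
  assumes "hom_poly m p"
  shows "hom_poly m (\<lambda>z. cnj (p (vcnj z)))"
  using assms
proof (induction rule: hom_poly_induct)
  case (mon a)
  have "(\<lambda>z. cnj (mon a (vcnj z))) = mon a"
    by (simp add: mon_def vcnj_def fun_eq_iff)
  then show ?case using hom_poly_mon[OF mon] by simp
qed auto


subsection \<open>Complex partial derivatives\<close>

text \<open>A one-variable derivative along a coordinate line makes this a total operator. For
  entire functions it gives the coefficients of the complex-linear derivative.\<close>

definition cderiv :: "'n::finite \<Rightarrow> (complex ^ 'n \<Rightarrow> complex) \<Rightarrow> complex ^ 'n \<Rightarrow> complex" where
  "cderiv i F z = deriv (\<lambda>t. F (z + t *s axis i 1)) 0"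

lemma bounded_linear_vec_scale: "bounded_linear (\<lambda>t::complex. t *s (w :: complex ^ 'n::finite))"
  unfolding linear_conv_bounded_linear[symmetric]
  by (rule linearI) (simp_all add: vec_eq_iff algebra_simps)

lemma norm_vec_scale [simp]: "norm (t *s w) = cmod t * norm (w :: complex ^ 'n::finite)"
proof -
  have "norm (t *s w) = sqrt ((cmod t)\<^sup>2 * (\<Sum>i\<in>UNIV. (cmod (w $ i))\<^sup>2))"
    by (simp add: norm_vec_def L2_set_def norm_mult power_mult_distrib sum_distrib_left)
  also have "\<dots> = cmod t * norm w"
    by (simp add: real_sqrt_mult norm_vec_def L2_set_def)
  finally show ?thesis .
qed

lemma has_derivative_line:
  "((\<lambda>t::complex. z + t *s (w :: complex ^ 'n::finite)) has_derivative (\<lambda>t. t *s w)) (at t)"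
  by (auto intro!: derivative_eq_intros bounded_linear.has_derivative[OF bounded_linear_vec_scale])

lemma entire_line_deriv:
  fixes F :: "complex ^ 'n::finite \<Rightarrow> complex"
  assumes "(F has_derivative F') (at (z + t *s w))" "Vector_Spaces.linear (*s) (*) F'"
  shows "((\<lambda>t. F (z + t *s w)) has_field_derivative F' w) (at t)"
proof -
  have "((\<lambda>t. F (z + t *s w)) has_derivative (\<lambda>s. F' (s *s w))) (at t)"
    by (rule has_derivative_compose[OF has_derivative_line, where g = F]) (fact assms(1))
  moreover have "F' (s *s w) = F' w * s" for s
    using Vector_Spaces.linear.axioms(3)[OF assms(2)]
    by (simp add: Modules.module_hom_axioms_def module_hom_def)
  ultimately show ?thesis
    by (simp add: has_field_derivative_def)
qed

lemma entire_line_holomorphic: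
  assumes "entire F"
  shows "(\<lambda>t. F (z + t *s w)) holomorphic_on A"
proof (rule holomorphic_on_subset)
  show "(\<lambda>t. F (z + t *s w)) holomorphic_on UNIV"
    unfolding holomorphic_on_open[OF open_UNIV]
    using assms entire_line_deriv unfolding entire_def by metis
qed simp

lemma entire_ray_holomorphic:
  assumes "entire F"
  shows "(\<lambda>t. F (t *s w)) holomorphic_on A"
  using entire_line_holomorphic[OF assms, of 0 w A] by simp

lemma linear_functional_expand:
  assumes "Vector_Spaces.linear (*s) (*) (F' :: complex ^ 'n::finite \<Rightarrow> complex)"
  shows "F' h = (\<Sum>i\<in>UNIV. h $ i * F' (axis i 1))"
proof -
  interpret F: Vector_Spaces.linear "(*s)" "(*)" F' by fact
  have "h = (\<Sum>i\<in>UNIV. h $ i *s axis i 1)"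
    by (simp add: basis_expansion)
  then have "F' h = F' (\<Sum>i\<in>UNIV. h $ i *s axis i 1)" by simp
  also have "\<dots> = (\<Sum>i\<in>UNIV. h $ i * F' (axis i 1))"
    by (simp add: F.sum F.scale)
  finally show ?thesis .
qed

lemma entire_has_derivative:
  assumes "entire F"
  shows "(F has_derivative (\<lambda>h. \<Sum>i\<in>UNIV. h $ i * cderiv i F z)) (at z)"
proof -
  obtain F' where F': "(F has_derivative F') (at z)" "Vector_Spaces.linear (*s) (*) F'"
    using assms unfolding entire_def by blast
  have "cderiv i F z = F' (axis i 1)" for i
    unfolding cderiv_def using entire_line_deriv[of F F' z 0 "axis i 1"] F'
    by (simp add: DERIV_imp_deriv)
  then show ?thesis using F' linear_functional_expand[OF F'(2)]
    by (metis (no_types, lifting) ext sum.cong)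
qed

lemma linear_combination_functional:
  "Vector_Spaces.linear (*s) (*) (\<lambda>h :: complex ^ 'n::finite. \<Sum>i\<in>UNIV. h $ i * c i)"
  by unfold_locales
     (simp_all add: sum.distrib distrib_right distrib_left sum_distrib_left mult.assoc)

lemma entireI:
  assumes "\<And>z. (F has_derivative (\<lambda>h. \<Sum>i\<in>UNIV. h $ i * c z i)) (at z)"
  shows "entire F"
  unfolding entire_def using assms linear_combination_functional by blast

lemma has_derivative_combination:
  assumes "(F has_derivative (\<lambda>h. \<Sum>i\<in>UNIV. h $ i * c i)) (at z)"
  shows "((\<lambda>t. F (z + t *s axis i 1)) has_field_derivative c i) (at 0)"
    and "cderiv i F z = c i"
proof -
  show *: "((\<lambda>t. F (z + t *s axis i 1)) has_field_derivative c i) (at 0)"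
    using entire_line_deriv[OF _ linear_combination_functional, of F c z 0 "axis i 1"] assms
    by (simp add: axis_def if_distrib if_distribR cong: if_cong)
  show "cderiv i F z = c i"
    unfolding cderiv_def by (rule DERIV_imp_deriv[OF *])
qed

lemma entire_line_has_deriv:
  assumes "entire F"
  shows "((\<lambda>t. F (z + t *s axis i 1)) has_field_derivative cderiv i F z) (at 0)"
  using has_derivative_combination(1)[OF entire_has_derivative[OF assms]] .

lemma entire_const [simp]: "entire (\<lambda>z. c)"
  by (rule entireI[where c = "\<lambda>_ _. 0"]) simp

lemma entire_coord [simp]: "entire (\<lambda>z. z $ i)"
proof (rule entireI[where c = "\<lambda>_ j. if j = i then 1 else 0"])
  fix z :: "complex ^ 'a"
  show "((\<lambda>z. z $ i) has_derivative (\<lambda>h. \<Sum>j\<in>UNIV. h $ j * (if j = i then 1 else 0))) (at z)"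
    by (auto intro!: derivative_eq_intros bounded_linear.has_derivative[OF bounded_linear_vec_nth]
        simp: if_distrib cong: if_cong)
qed

lemma has_derivative_mult_combination:
  assumes "entire F" "entire G"
  shows "((\<lambda>z. F z * G z) has_derivative
           (\<lambda>h. \<Sum>i\<in>UNIV. h $ i * (cderiv i F z * G z + F z * cderiv i G z))) (at z)"
  using has_derivative_mult[OF entire_has_derivative[OF assms(1)] entire_has_derivative[OF assms(2)], of z]
  by (simp add: sum_distrib_left sum_distrib_right sum.distrib[symmetric] algebra_simps)

lemma has_derivative_add_combination:
  assumes "entire F" "entire G"
  shows "((\<lambda>z. F z + G z) has_derivative
           (\<lambda>h. \<Sum>i\<in>UNIV. h $ i * (cderiv i F z + cderiv i G z))) (at z)"
  using has_derivative_add[OF entire_has_derivative[OF assms(1)] entire_has_derivative[OF assms(2)], of z]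
  by (simp add: sum.distrib[symmetric] algebra_simps)

lemma entire_add [intro]: "entire F \<Longrightarrow> entire G \<Longrightarrow> entire (\<lambda>z. F z + G z)"
  by (rule entireI, rule has_derivative_add_combination)

lemma entire_mult [intro]: "entire F \<Longrightarrow> entire G \<Longrightarrow> entire (\<lambda>z. F z * G z)"
  by (rule entireI, rule has_derivative_mult_combination)

lemma entire_diff [intro]: "entire F \<Longrightarrow> entire G \<Longrightarrow> entire (\<lambda>z. F z - G z)"
  using entire_add[of F "\<lambda>z. - 1 * G z"] entire_mult[of "\<lambda>_. - 1" G] by simp

lemma entire_sum [intro]: "(\<And>i. i \<in> A \<Longrightarrow> entire (F i)) \<Longrightarrow> entire (\<lambda>z. \<Sum>i\<in>A. F i z)"
  by (induction A rule: infinite_finite_induct) auto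

lemma entire_prod [intro]: "(\<And>i. i \<in> A \<Longrightarrow> entire (F i)) \<Longrightarrow> entire (\<lambda>z. \<Prod>i\<in>A. F i z)"
  by (induction A rule: infinite_finite_induct) auto

lemma entire_power [intro]: "entire F \<Longrightarrow> entire (\<lambda>z. F z ^ k)"
  by (induction k) auto

lemma hom_poly_entire [intro]:
  assumes "hom_poly m p"
  shows "entire p"
proof -
  obtain c where "p = (\<lambda>z. \<Sum>a | sum a UNIV = m. c a * (\<Prod>i\<in>UNIV. z $ i ^ a i))"
    using assms unfolding hom_poly_def by (auto simp: fun_eq_iff)
  then show ?thesis by (auto intro!: entire_sum entire_mult entire_prod entire_power)
qed

lemma entire_continuous:
  assumes "entire F"
  shows "continuous_on A F"
  by (meson assms continuous_at_imp_continuous_on entire_def has_derivative_continuous)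

lemma cderiv_add:
  "entire F \<Longrightarrow> entire G \<Longrightarrow> cderiv i (\<lambda>z. F z + G z) z = cderiv i F z + cderiv i G z"
  using has_derivative_combination(2)[OF has_derivative_add_combination] .

lemma cderiv_mult:
  "entire F \<Longrightarrow> entire G \<Longrightarrow> cderiv i (\<lambda>z. F z * G z) z = cderiv i F z * G z + F z * cderiv i G z"
  using has_derivative_combination(2)[OF has_derivative_mult_combination] .

lemma cderiv_const [simp]: "cderiv i (\<lambda>z. c) z = 0"
  by (simp add: cderiv_def)

lemma cderiv_cmult: "entire F \<Longrightarrow> cderiv i (\<lambda>z. c * F z) z = c * cderiv i F z"
  by (simp add: cderiv_mult)

lemma cderiv_coord: "cderiv i (\<lambda>z. z $ j) z = (if i = j then 1 else 0)"
proof -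
  have "((\<lambda>t. (z + t *s axis i 1) $ j) has_field_derivative (if i = j then 1 else 0)) (at 0)"
    by (auto simp: axis_def intro!: derivative_eq_intros)
  then show ?thesis unfolding cderiv_def by (rule DERIV_imp_deriv)
qed

text \<open>The truncated exponent \<open>a i - 1\<close> does no harm: for \<open>a i = 0\<close>
  the factor in front vanishes.\<close>

lemma cderiv_mon: "cderiv i (mon a) z = of_nat (a i) * mon (a(i := a i - 1)) z"
proof -
  let ?R = "\<Prod>j\<in>UNIV - {i}. z $ j ^ a j"
  have eq: "mon a (z + t *s axis i 1) = (z $ i + t) ^ a i * ?R" for t
    unfolding mon_def
    by (subst prod.remove[of UNIV i]) (auto simp: axis_def intro!: prod.cong)
  have "((\<lambda>t. (z $ i + t) ^ a i * ?R) has_field_derivative (of_nat (a i) * z $ i ^ (a i - 1)) * ?R) (at 0)"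
    by (auto intro!: derivative_eq_intros)
  then have "cderiv i (mon a) z = (of_nat (a i) * z $ i ^ (a i - 1)) * ?R"
    unfolding cderiv_def eq by (rule DERIV_imp_deriv)
  also have "\<dots> = of_nat (a i) * mon (a(i := a i - 1)) z"
    unfolding mon_def
    by (subst prod.remove[of UNIV i]) (auto intro!: prod.cong)
  finally show ?thesis .
qed

text \<open>For \<open>m = 0\<close> the truncated degree is 0, which fits because the derivative is
  then zero.\<close>

lemma hom_poly_cderiv [intro]:
  assumes "hom_poly m p"
  shows "hom_poly (m - 1) (cderiv i p)"
  using assms
proof (induction rule: hom_poly_induct)
  case (mon a)
  show ?case
  proof (cases "a i = 0")
    case True
    then show ?thesis by (simp add: cderiv_mon[abs_def])
  next
    case False
    have "sum (a(i := a i - 1)) UNIV = a i - 1 + sum a (UNIV - {i})"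
      by (subst sum.remove[of UNIV i]) (auto intro!: sum.cong)
    also have "\<dots> = m - 1"
      using mon False sum.remove[of UNIV i a] by simp
    finally show ?thesis unfolding cderiv_mon[abs_def] by (intro hom_poly_cmult hom_poly_mon)
  qed
next
  case (add p q)
  then show ?case using hom_poly_add[OF add(3,4)]
    by (metis (no_types, lifting) cderiv_add ext hom_poly_entire)
next
  case (cmult c p)
  then show ?case using hom_poly_cmult[OF cmult(2), of c]
    by (metis (no_types, lifting) cderiv_cmult ext hom_poly_entire)
qed (simp add: cderiv_def)

lemma euler_hom_poly:
  assumes "hom_poly m p"
  shows "(\<Sum>i\<in>UNIV. z $ i * cderiv i p z) = of_nat m * p z"
  using assms
proof (induction rule: hom_poly_induct)
  case (mon a)
  have "z $ i * cderiv i (mon a) z = of_nat (a i) * mon a z" for i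
  proof (cases "a i")
    case (Suc n)
    have "z $ i * mon (a(i := a i - 1)) z = mon a z"
      unfolding mon_def
      by (subst (1 2) prod.remove[of UNIV i]) (auto simp: Suc intro!: prod.cong)
    then show ?thesis by (simp add: cderiv_mon)
  qed (simp add: cderiv_mon)
  then show ?case using mon by (simp add: sum_distrib_right[symmetric] of_nat_sum[symmetric])
next
  case (add p q)
  then show ?case by (simp add: cderiv_add hom_poly_entire distrib_left sum.distrib)
next
  case (cmult c p)
  then show ?case by (simp add: cderiv_cmult hom_poly_entire mult.left_commute sum_distrib_left[symmetric])
qed simp

subsection \<open>Bounds for homogeneous polynomials from real points\<close>

text \<open>Both sides have degree at most N and agree at the N + 1 nodes 0, ..., N. The formula is
  used twice: to bound a polynomial off the real axis, and to show that a separately polynomial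
  function is a polynomial.\<close>

lemma lagrange_interpolation:
  fixes p :: "complex poly"
  assumes "degree p \<le> N"
  shows "poly p x = (\<Sum>j\<le>N. poly p (of_nat j) *
           (\<Prod>l\<in>{..N} - {j}. (x - of_nat l) / (of_nat j - of_nat l)))"
proof -
  define w where "w = (\<lambda>j. \<Prod>l\<in>{..N} - {j}. [:- of_nat l / (of_nat j - of_nat l), 1 / (of_nat j - of_nat l) :: complex:])"
  define L where "L = (\<Sum>j\<le>N. smult (poly p (of_nat j)) (w j))"
  have w: "poly (w j) x = (\<Prod>l\<in>{..N} - {j}. (x - of_nat l) / (of_nat j - of_nat l))" for j x
    unfolding w_def poly_prod by (intro prod.cong) (auto simp: diff_divide_distrib)
  have deg_w: "degree (w j) \<le> N" if "j \<le> N" for j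
  proof -
    have "degree (w j) \<le> (\<Sum>l\<in>{..N} - {j}. 1)"
      unfolding w_def by (intro order_trans[OF degree_prod_sum_le] sum_mono) auto
    then show ?thesis using that by simp
  qed
  have "p = L"
  proof (rule poly_eqI_degree[where A = "of_nat ` {..N}"])
    fix x :: complex assume "x \<in> of_nat ` {..N}"
    then obtain i where i: "i \<le> N" "x = of_nat i" by auto
    have "poly (w j) x = (if j = i then 1 else 0)" if "j \<le> N" for j
    proof (cases "j = i")
      case True
      then show ?thesis unfolding w i by (auto intro!: prod.neutral)
    next
      case False
      then show ?thesis unfolding w i using i that by (auto intro!: prod_zero)
    qed
    then have "poly L x = (\<Sum>j\<le>N. if j = i then poly p x else 0)"
      unfolding L_def poly_sum using i by (intro sum.cong) auto
    then show "poly p x = poly L x" using i by simp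
  next
    have c: "card (of_nat ` {..N} :: complex set) = N + 1"
      by (subst card_image) (auto simp: inj_on_def)
    show "card (of_nat ` {..N} :: complex set) > degree p" using assms c by simp
    have "degree L \<le> N" unfolding L_def
      using deg_w by (intro degree_sum_le) (auto intro: order_trans[OF degree_smult_le])
    then show "card (of_nat ` {..N} :: complex set) > degree L" using c by simp
  qed
  then have "poly p x = poly L x" by simp
  then show ?thesis by (simp add: L_def poly_sum w)
qed

lemma hom_poly_line:
  assumes "hom_poly m q"
  shows "\<exists>p. degree p \<le> m \<and> (\<forall>t. q (z + t *s w) = poly p t)"
  using assms
proof (induction rule: hom_poly_induct)
  case (mon a)
  let ?p = "\<Prod>i\<in>UNIV. [:z $ i, w $ i:] ^ a i"
  have "degree ?p \<le> (\<Sum>i\<in>UNIV. degree ([:z $ i, w $ i:] ^ a i))"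
    using degree_prod_sum_le[of UNIV "\<lambda>i. [:z $ i, w $ i:] ^ a i"] by (simp add: o_def)
  also have "\<dots> \<le> (\<Sum>i\<in>UNIV. a i)"
  proof (rule sum_mono)
    fix i
    have "degree ([:z $ i, w $ i:] ^ a i) \<le> degree [:z $ i, w $ i:] * a i"
      by (rule degree_power_le)
    also have "\<dots> \<le> 1 * a i" by (intro mult_right_mono) auto
    finally show "degree ([:z $ i, w $ i:] ^ a i) \<le> a i" by simp
  qed
  finally have "degree ?p \<le> m" using mon by simp
  moreover have "mon a (z + t *s w) = poly ?p t" for t
    by (simp add: mon_def poly_prod)
  ultimately show ?case by blast
next
  case (add p q)
  then obtain a b where "degree a \<le> m" "degree b \<le> m"
    "\<And>t. p (z + t *s w) = poly a t" "\<And>t. q (z + t *s w) = poly b t" by blast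
  then show ?case by (intro exI[of _ "a + b"]) (auto intro: degree_add_le)
next
  case (cmult c p)
  then obtain a where "degree a \<le> m" "\<And>t. p (z + t *s w) = poly a t" by blast
  then show ?case
    by (intro exI[of _ "smult c a"]) (auto intro: order_trans[OF degree_smult_le])
next
  case zero
  then show ?case by (intro exI[of _ 0]) simp
qed

lemma norm_cvec [simp]: "norm (cvec x) = norm x"
  by (simp add: norm_vec_def cvec_def L2_set_def)

lemma cvec_scaleR: "cvec (c *\<^sub>R x) = complex_of_real c *s cvec x"
  by (simp add: cvec_def vec_eq_iff)

lemma cvec_add: "cvec (x + y) = cvec x + cvec y"
  by (simp add: cvec_def vec_eq_iff)

lemma power_le_exp_fact: "real n ^ n \<le> exp (real n) * fact n"
proof -
  have "(\<lambda>k. real n ^ k /\<^sub>R fact k) sums exp (real n)"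
    by (rule exp_converges)
  then have "(\<Sum>k\<in>{n}. real n ^ k /\<^sub>R fact k) \<le> exp (real n)"
    by (subst sums_unique, assumption, intro sum_le_suminf) (auto simp: sums_iff)
  then show ?thesis by (simp add: field_simps)
qed

text \<open>The denominators of the Lagrange weights. The nodes below j contribute the first
  factorial, those above j the second.\<close>

lemma prod_node_distances:
  assumes "j \<le> n"
  shows "(\<Prod>l\<in>{..n} - {j}. \<bar>real j - real l\<bar>) = fact j * fact (n - j)"
proof -
  have "{..n} - {j} = {..<j} \<union> {j<..n}" using assms by auto
  then have "(\<Prod>l\<in>{..n} - {j}. \<bar>real j - real l\<bar>) =
     (\<Prod>l\<in>{..<j}. \<bar>real j - real l\<bar>) * (\<Prod>l\<in>{j<..n}. \<bar>real j - real l\<bar>)"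
    using prod.union_disjoint[of "{..<j}" "{j<..n}" "\<lambda>l. \<bar>real j - real l\<bar>"]
    by (simp add: Int_def)
  also have "(\<Prod>l\<in>{..<j}. \<bar>real j - real l\<bar>) = (\<Prod>i\<in>{1..j}. real i)"
    by (rule prod.reindex_bij_witness[of _ "\<lambda>i. j - i" "\<lambda>i. j - i"]) (auto simp: of_nat_diff)
  also have "\<dots> = fact j" by (simp add: fact_prod)
  also have "(\<Prod>l\<in>{j<..n}. \<bar>real j - real l\<bar>) = (\<Prod>i\<in>{1..n - j}. real i)"
    by (rule prod.reindex_bij_witness[of _ "\<lambda>i. j + i" "\<lambda>i. i - j"]) (auto simp: of_nat_diff)
  also have "\<dots> = fact (n - j)" by (simp add: fact_prod)
  finally show ?thesis .
qed

lemma hom_poly_real_bound: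
  assumes q: "hom_poly n q" and A: "\<And>x. norm x \<le> 1 \<Longrightarrow> cmod (q (cvec x)) \<le> A"
  shows "cmod (q (cvec x)) \<le> A * norm x ^ n"
proof -
  have "A \<ge> 0" using order_trans[OF norm_ge_zero A[of 0]] by simp
  define u where "u = x /\<^sub>R norm x"
  have x: "x = norm x *\<^sub>R u" by (cases "x = 0") (auto simp: u_def)
  have "norm u \<le> 1" by (cases "x = 0") (auto simp: u_def)
  have "cmod (q (cvec x)) = norm x ^ n * cmod (q (cvec u))"
    by (subst x, subst cvec_scaleR, subst hom_poly_scale[OF q]) (simp add: norm_mult norm_power)
  also have "\<dots> \<le> norm x ^ n * A"
    using A[OF \<open>norm u \<le> 1\<close>] by (intro mult_left_mono) auto
  finally show ?thesis by (simp add: mult.commute)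
qed

text \<open>With z = x + i y, the polynomial t \<mapsto> q(n x + t y) has degree at most n, takes
  values at real vectors for the nodes t = 0, ..., n, and equals n^n q(z) at t = i n. Scaling by n
  lets integer nodes serve. The constant is 24 = 2 * 2 * 2 * 3: the real vectors have norm at most 2
  n |z|, the numerators |i n - l| are at most 2 n, the binomial coefficients sum to 2^n, and n^n /
  n! \<le> e^n \<le> 3^n.\<close>

lemma hom_poly_complex_bound:
  assumes q: "hom_poly n q" and A: "\<And>x. norm x \<le> 1 \<Longrightarrow> cmod (q (cvec x)) \<le> A"
  shows "cmod (q z) \<le> A * (24 * norm z) ^ n"
proof -
  have "A \<ge> 0" using order_trans[OF norm_ge_zero A[of 0]] by simp
  define x where "x = (\<chi> i. Re (z $ i))"
  define y where "y = (\<chi> i. Im (z $ i))"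
  have z: "z = cvec x + \<i> *s cvec y"
    by (simp add: vec_eq_iff x_def y_def cvec_def complex_eq)
  have nx: "norm x \<le> norm z" "norm y \<le> norm z"
    unfolding norm_vec_def by (auto intro!: L2_set_mono simp: x_def y_def abs_Re_le_cmod abs_Im_le_cmod)
  let ?w = "\<lambda>j :: nat. \<Prod>l\<in>{..n} - {j}. (\<i> * of_nat n - of_nat l) / (of_nat j - of_nat l)"
  obtain p where p: "degree p \<le> n" "\<And>t. q (of_nat n *s cvec x + t *s cvec y) = poly p t"
    using hom_poly_line[OF q] by blast
  have pb: "cmod (poly p (of_nat j)) \<le> A * (2 * real n * norm z) ^ n" if "j \<le> n" for j
  proof -
    have "of_nat n *s cvec x + of_nat j *s cvec y = cvec (real n *\<^sub>R x + real j *\<^sub>R y)"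
      by (simp add: cvec_add cvec_scaleR)
    then have "cmod (poly p (of_nat j)) \<le> A * norm (real n *\<^sub>R x + real j *\<^sub>R y) ^ n"
      using hom_poly_real_bound[OF q A] p(2)[of "of_nat j"] by metis
    also have "\<dots> \<le> A * (2 * real n * norm z) ^ n"
    proof -
    have "norm (real n *\<^sub>R x + real j *\<^sub>R y) \<le> real n * norm x + real j * norm y"
      by (rule order_trans[OF norm_triangle_ineq]) simp
    also have "\<dots> \<le> real n * norm z + real n * norm z"
      using nx that by (intro add_mono mult_mono) auto
    finally have "norm (real n *\<^sub>R x + real j *\<^sub>R y) \<le> 2 * real n * norm z" by simp
    then show ?thesis
      using \<open>A \<ge> 0\<close> by (intro mult_left_mono power_mono) auto
    qed
    finally show ?thesis .
  qed
  have wb: "(\<Prod>l\<in>{..n} - {j}. cmod ((\<i> * of_nat n - of_nat l) / (of_nat j - of_nat l)))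
     \<le> (2 * real n) ^ n * (real (n choose j) / fact n)" if "j \<le> n" for j
  proof -
    have "(\<Prod>l\<in>{..n} - {j}. cmod ((\<i> * of_nat n - of_nat l) / (of_nat j - of_nat l)))
       \<le> (\<Prod>l\<in>{..n} - {j}. (2 * real n) / \<bar>real j - real l\<bar>)"
    proof (intro prod_mono conjI)
      fix l assume l: "l \<in> {..n} - {j}"
      have "cmod (\<i> * of_nat n - of_nat l) \<le> 2 * real n"
        using l by (intro order_trans[OF norm_triangle_ineq4]) (simp add: norm_mult)
      moreover have "cmod (of_nat j - of_nat l) = \<bar>real j - real l\<bar>"
        by (metis norm_of_real of_real_diff of_real_of_nat_eq)
      ultimately show "cmod ((\<i> * of_nat n - of_nat l) / (of_nat j - of_nat l)) \<le> 2 * real n / \<bar>real j - real l\<bar>"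
        by (simp add: norm_divide divide_right_mono)
    qed simp
    also have "\<dots> = (2 * real n) ^ n / (fact j * fact (n - j))"
      using that by (simp add: prod_dividef prod_node_distances)
    also have "\<dots> = (2 * real n) ^ n * (real (n choose j) / fact n)"
      using that by (simp add: binomial_fact field_simps)
    finally show ?thesis .
  qed
  have "of_nat n ^ n * q z = q (of_nat n *s z)"
    by (simp add: hom_poly_scale[OF q])
  also have "of_nat n *s z = of_nat n *s cvec x + (\<i> * of_nat n) *s cvec y"
    by (subst z) (simp add: vec_eq_iff algebra_simps)
  also have "q \<dots> = poly p (\<i> * of_nat n)" by (rule p(2))
  also have "\<dots> = (\<Sum>j\<le>n. poly p (of_nat j) * ?w j)"
    by (rule lagrange_interpolation[OF p(1)])
  finally have eq: "of_nat n ^ n * q z = (\<Sum>j\<le>n. poly p (of_nat j) * ?w j)" .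
  have "real n ^ n * cmod (q z) = cmod (of_nat n ^ n * q z)"
    by (simp add: norm_mult norm_power)
  also have "\<dots> \<le> (\<Sum>j\<le>n. cmod (poly p (of_nat j)) *
       (\<Prod>l\<in>{..n} - {j}. cmod ((\<i> * of_nat n - of_nat l) / (of_nat j - of_nat l))))"
    unfolding eq prod_norm norm_mult[symmetric] by (rule norm_sum)
  also have "\<dots> \<le> (\<Sum>j\<le>n. (A * (2 * real n * norm z) ^ n) * ((2 * real n) ^ n * (real (n choose j) / fact n)))"
    using \<open>A \<ge> 0\<close> by (intro sum_mono mult_mono pb wb) (auto intro!: prod_nonneg)
  also have "\<dots> = (A * (2 * real n * norm z) ^ n) * ((2 * real n) ^ n * (real (\<Sum>j\<le>n. n choose j) / fact n))"
    by (simp add: sum_distrib_left sum_divide_distrib)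
  also have "\<dots> = real n ^ n * (A * (8 * norm z) ^ n * (real n ^ n / fact n))"
  proof -
    have "(8::real) ^ n = 2 ^ n * 2 ^ n * 2 ^ n" by (simp flip: power_mult_distrib)
    then show ?thesis unfolding choose_row_sum power_mult_distrib by simp
  qed
  finally have "real n ^ n * cmod (q z) \<le> real n ^ n * (A * (8 * norm z) ^ n * (real n ^ n / fact n))" .
  \<comment> \<open>Cancelling n^n is legitimate for n = 0 as well, where it equals 1.\<close>
  then have "cmod (q z) \<le> A * (8 * norm z) ^ n * (real n ^ n / fact n)"
    by (cases "n = 0") (auto simp del: times_divide_eq_right power_mult_distrib)
  also have "\<dots> \<le> A * (8 * norm z) ^ n * 3 ^ n"
  proof (intro mult_left_mono)
    have "real n ^ n / fact n \<le> exp (real n)" using power_le_exp_fact[of n] by (simp add: field_simps)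
    also have "\<dots> = exp 1 ^ n" by (simp add: exp_of_nat_mult[symmetric])
    also have "\<dots> \<le> 3 ^ n" by (intro power_mono) (auto simp: exp_le)
    finally show "real n ^ n / fact n \<le> 3 ^ n" .
  qed (use \<open>A \<ge> 0\<close> in auto)
  also have "\<dots> = A * (24 * norm z) ^ n"
  proof -
    have "(24::real) ^ n = 8 ^ n * 3 ^ n" by (simp flip: power_mult_distrib)
    then show ?thesis unfolding power_mult_distrib by simp
  qed
  finally show ?thesis .
qed

subsection \<open>The surface measure\<close>

abbreviation unit_dir :: "real ^ 'n::finite \<Rightarrow> real ^ 'n" where
  "unit_dir x \<equiv> x /\<^sub>R norm x"

lemma scale_measure_conv_density: "scale_measure r M = density M (\<lambda>_. r)"
  by (rule measure_eqI) (simp_all add: emeasure_density nn_integral_cmult_indicator)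

lemma measurable_unit_dir [measurable]: "unit_dir \<in> borel_measurable borel"
  by measurable

lemma unit_dir_measurable:
  "unit_dir \<in> measurable (restrict_space lborel (cball 0 1 - {0})) (restrict_space borel (sphere 0 1))"
  by (rule measurable_restrict_space2)
     (auto intro!: measurable_restrict_space1 simp: space_restrict_space)

lemma space_sphere_measure [simp]: "space sphere_measure = sphere 0 1"
  by (simp add: sphere_measure_def space_scale_measure space_restrict_space)

lemma sets_sphere_measure [simp, measurable_cong]:
  "sets sphere_measure = sets (restrict_space borel (sphere 0 1))"
  by (simp add: sphere_measure_def)

lemma borel_measurable_sphere:
  fixes h :: "real ^ 'n::finite \<Rightarrow> 'b::topological_space"
  assumes "continuous_on (sphere 0 1) h"
  shows "h \<in> borel_measurable sphere_measure"
  using borel_measurable_continuous_on_restrict[OF assms]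
  by (simp cong: measurable_cong_sets)

lemma integral_sphere_measure:
  fixes h :: "real ^ 'n::finite \<Rightarrow> 'b::{banach, second_countable_topology}"
  assumes h: "continuous_on (sphere 0 1) h"
  shows "integral\<^sup>L sphere_measure h =
     real CARD('n) *\<^sub>R integral\<^sup>L (restrict_space lborel (cball 0 1 - {0})) (\<lambda>x. h (unit_dir x))"
proof -
  let ?M = "distr (restrict_space lborel (cball 0 1 - {0 :: real ^ 'n})) (restrict_space borel (sphere 0 1)) unit_dir"
  have h': "h \<in> borel_measurable (restrict_space borel (sphere 0 1))"
    by (rule borel_measurable_continuous_on_restrict[OF h])
  then have h'': "h \<in> borel_measurable ?M" by (simp cong: measurable_cong_sets)
  have "integral\<^sup>L sphere_measure h = integral\<^sup>L (density ?M (\<lambda>_. ennreal (real CARD('n)))) h"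
    unfolding sphere_measure_def scale_measure_conv_density by (simp add: ennreal_of_nat_eq_real_of_nat)
  also have "\<dots> = integral\<^sup>L ?M (\<lambda>x. real CARD('n) *\<^sub>R h x)"
    by (rule integral_density) (use h'' in auto)
  also have "\<dots> = real CARD('n) *\<^sub>R integral\<^sup>L ?M h"
    by simp
  also have "integral\<^sup>L ?M h = integral\<^sup>L (restrict_space lborel (cball 0 1 - {0})) (\<lambda>x. h (unit_dir x))"
    by (rule integral_distr[OF unit_dir_measurable h'])
  finally show ?thesis .
qed

text \<open>The cone over A without its apex. Polar coordinates are tested on such cones, because
  the surface measure is defined through their part in the unit ball.\<close>

definition sphere_cone :: "(real ^ 'n::finite) set \<Rightarrow> (real ^ 'n) set" where
  "sphere_cone A = {x. x \<noteq> 0 \<and> unit_dir x \<in> A}"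

lemma sets_sphereD:
  fixes A :: "(real ^ 'n::finite) set"
  assumes "A \<in> sets (restrict_space borel (sphere 0 1))"
  shows "A \<in> sets borel \<and> A \<subseteq> sphere 0 1"
proof -
  obtain X where X: "X \<in> sets borel" "A = sphere 0 1 \<inter> X"
    using assms by (auto simp: sets_restrict_space)
  have "sphere 0 1 \<in> sets (borel :: (real ^ 'n) measure)" by (rule borel_closed) simp
  then show ?thesis using X by (auto intro: sets.Int)
qed

lemma sphere_cone_measurable [measurable]:
  assumes "A \<in> sets borel"
  shows "sphere_cone A \<in> sets borel"
proof -
  have "sphere_cone A = (unit_dir -` A \<inter> space borel) \<inter> (- {0})" by (auto simp: sphere_cone_def)
  also have "\<dots> \<in> sets borel"
    by (intro sets.Int measurable_sets[OF measurable_unit_dir assms]) auto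
  finally show ?thesis .
qed

lemma emeasure_sphere_measure:
  fixes A :: "(real ^ 'n::finite) set"
  assumes "A \<in> sets (restrict_space borel (sphere 0 1))"
  shows "emeasure sphere_measure A = of_nat CARD('n) * emeasure lborel (sphere_cone A \<inter> cball 0 1)"
proof -
  have "unit_dir -` A \<inter> space (restrict_space lborel (cball 0 1 - {0})) = sphere_cone A \<inter> cball 0 1"
    by (auto simp: sphere_cone_def space_restrict_space)
  moreover have "sphere_cone A \<inter> cball 0 1 \<subseteq> cball 0 1 - {0}" by (auto simp: sphere_cone_def)
  ultimately show ?thesis unfolding sphere_measure_def
    using assms by (simp add: emeasure_distr[OF unit_dir_measurable] emeasure_restrict_space)
qed

lemma finite_measure_sphere: "finite_measure (sphere_measure :: (real ^ 'n::finite) measure)"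
proof
  let ?S = "sphere 0 1 :: (real ^ 'n) set"
  have "?S \<in> sets (restrict_space borel ?S)"
    by (metis sets.top space_restrict_space space_borel inf_top.right_neutral)
  then have "emeasure sphere_measure ?S = of_nat CARD('n) * emeasure lborel (sphere_cone ?S \<inter> cball 0 1)"
    by (rule emeasure_sphere_measure)
  moreover have "emeasure lborel (sphere_cone ?S \<inter> cball 0 1) < \<infinity>"
    by (rule le_less_trans[OF emeasure_mono emeasure_lborel_cball_finite[of 0 1]]) auto
  ultimately show "emeasure (sphere_measure :: (real ^ 'n) measure) (space sphere_measure) \<noteq> \<infinity>"
    by (simp add: ennreal_mult_eq_top_iff)
qed

lemma integrable_sphere:
  fixes h :: "real ^ 'n::finite \<Rightarrow> 'b::{banach, second_countable_topology}"
  assumes "continuous_on (sphere 0 1) h"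
  shows "integrable sphere_measure h"
proof -
  interpret finite_measure "sphere_measure :: (real ^ 'n) measure" by (rule finite_measure_sphere)
  have "bounded (h ` sphere 0 1)"
    using assms by (intro compact_imp_bounded compact_continuous_image) auto
  then obtain B where "\<And>x. x \<in> sphere 0 1 \<Longrightarrow> norm (h x) \<le> B"
    unfolding bounded_iff by blast
  then show ?thesis
    by (intro integrable_const_bound[where B = B] borel_measurable_sphere assms AE_I2) simp
qed

text \<open>The push-forward of \<open>sphere_cone A\<close> under the norm has distribution function proportional to
  \<open>s\<^sup>d\<close>, hence is determined by \<open>A\<close> up to a factor.\<close>

lemma emeasure_sphere_cone_cball:
  fixes A :: "(real ^ 'n::finite) set"
  assumes "A \<in> sets borel" "s > 0"
  shows "emeasure lborel (sphere_cone A \<inter> cball 0 s) = ennreal s ^ CARD('n) * emeasure lborel (sphere_cone A \<inter> cball 0 1)"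
proof -
  have "emeasure lborel (sphere_cone A \<inter> cball 0 s) =
    emeasure (density (distr lborel borel (\<lambda>x. 0 + s *\<^sub>R x)) (\<lambda>_. \<bar>s\<bar> ^ DIM(real ^ 'n))) (sphere_cone A \<inter> cball 0 s)"
    using lborel_affine[of s "0 :: real ^ 'n"] assms by simp
  also have "\<dots> = ennreal (s ^ CARD('n)) * emeasure (distr lborel borel (\<lambda>x :: real ^ 'n. s *\<^sub>R x)) (sphere_cone A \<inter> cball 0 s)"
    using assms by (subst emeasure_density_const) auto
  also have "emeasure (distr lborel borel (\<lambda>x :: real ^ 'n. s *\<^sub>R x)) (sphere_cone A \<inter> cball 0 s) =
    emeasure lborel ((\<lambda>x. s *\<^sub>R x) -` (sphere_cone A \<inter> cball 0 s) \<inter> space lborel)"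
    using assms by (intro emeasure_distr) auto
  also have "(\<lambda>x. s *\<^sub>R x) -` (sphere_cone A \<inter> cball 0 s) \<inter> space lborel = sphere_cone A \<inter> cball 0 1"
    using assms by (auto simp: sphere_cone_def divide_simps)
  finally show ?thesis using assms by (simp add: ennreal_power)
qed

text \<open>A product identity needs neither the value nor the finiteness of the radial integral.
  The first factor is the total mass of the sphere.\<close>

lemma polar_emeasure:
  fixes A :: "(real ^ 'n::finite) set" and w :: "real \<Rightarrow> ennreal"
  assumes A: "A \<in> sets (restrict_space borel (sphere 0 1))" and w [measurable]: "w \<in> borel_measurable borel"
  shows "(of_nat CARD('n) * emeasure lborel (cball 0 1 :: (real ^ 'n) set)) * (\<integral>\<^sup>+x. w (norm x) * indicator (sphere_cone A) x \<partial>lborel)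
     = (\<integral>\<^sup>+x. w (norm (x :: real ^ 'n)) \<partial>lborel) * emeasure sphere_measure A"
proof -
  let ?I = "\<lambda>B :: (real ^ 'n) set. \<integral>\<^sup>+x. w (norm x) * indicator (sphere_cone B) x \<partial>lborel"
  define S where "S = (sphere 0 1 :: (real ^ 'n) set)"
  define \<nu> where "\<nu> = (\<lambda>A. distr (density lborel (indicator (sphere_cone A))) borel (norm :: real ^ 'n \<Rightarrow> real))"
  have A' [measurable]: "A \<in> sets borel" using sets_sphereD[OF A] by auto
  have S [measurable]: "S \<in> sets borel" unfolding S_def by auto
  have nu: "emeasure (\<nu> B) {..s} = (if s > 0 then ennreal s ^ CARD('n) else 0) * emeasure lborel (sphere_cone B \<inter> cball 0 1)"
    if [measurable]: "B \<in> sets borel" for B s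
  proof -
    have "emeasure (\<nu> B) {..s} = emeasure (density lborel (indicator (sphere_cone B))) (cball 0 s)"
      unfolding \<nu>_def by (subst emeasure_distr) (auto intro!: arg_cong[where f = "emeasure _"] simp: cball_def)
    also have "\<dots> = emeasure lborel (sphere_cone B \<inter> cball 0 s)"
      by (subst emeasure_density) (auto simp: indicator_inter_arith[symmetric])
    finally have *: "emeasure (\<nu> B) {..s} = emeasure lborel (sphere_cone B \<inter> cball 0 s)" .
    show ?thesis
    proof (cases "s > 0")
      case False
      then have "sphere_cone B \<inter> cball 0 s = {}" by (auto simp: sphere_cone_def) (metis norm_le_zero_iff order_trans not_less)
      then show ?thesis using False * by simp
    next
      case True
      then show ?thesis using emeasure_sphere_cone_cball[OF that True] * by simp
    qed
  qed
  define a where "a = emeasure lborel (sphere_cone A \<inter> cball 0 1)"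
  define b where "b = emeasure lborel (sphere_cone S \<inter> cball 0 1)"
  have fin: "a < \<infinity>" "b < \<infinity>"
    unfolding a_def b_def
    by (intro le_less_trans[OF emeasure_mono emeasure_lborel_cball_finite[of 0 1]]; auto)+
  \<comment> \<open>Both measures give \<open>{..s}\<close> the mass a b s^d for s > 0 and 0
    otherwise. These half-lines generate the Borel sets, and the finite masses make the extension
    unique.\<close>
  have eq: "scale_measure b (\<nu> A) = scale_measure a (\<nu> S)"
  proof (rule measure_eqI_generator_eq[where E = "range atMost" and \<Omega> = UNIV and A = "\<lambda>n. {..real n}"])
    show "Int_stable (range atMost :: real set set)"
      by (auto simp: Int_stable_def)
    show "sets (scale_measure b (\<nu> A)) = sigma_sets UNIV (range atMost)"
      "sets (scale_measure a (\<nu> S)) = sigma_sets UNIV (range atMost)"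
      by (simp_all add: \<nu>_def borel_eq_atMost)
    show "(\<Union>i. {..real i}) = UNIV" by (auto intro: real_arch_simple)
    fix X :: "real set" assume "X \<in> range atMost"
    then show "emeasure (scale_measure b (\<nu> A)) X = emeasure (scale_measure a (\<nu> S)) X"
      by (auto simp: nu a_def b_def mult_ac)
  next
    fix i :: nat
    show "emeasure (scale_measure b (\<nu> A)) {..real i} \<noteq> \<infinity>"
      using fin by (auto simp: nu a_def[symmetric] ennreal_mult_eq_top_iff ennreal_power)
  next
    show "range (atMost :: real \<Rightarrow> real set) \<subseteq> Pow UNIV" by simp
    show "range (\<lambda>n. {..real n}) \<subseteq> range (atMost :: real \<Rightarrow> real set)" by blast
  qed
  have int: "(\<integral>\<^sup>+s. w s \<partial>\<nu> B) = ?I B"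
    if [measurable]: "B \<in> sets borel" for B
    unfolding \<nu>_def by (subst nn_integral_distr, measurable, subst nn_integral_density) (auto simp: mult.commute)
  have "b * ?I A = a * ?I S"
    unfolding int[OF A', symmetric] int[OF S, symmetric]
    using arg_cong[OF eq, of "\<lambda>M. \<integral>\<^sup>+s. w s \<partial>M"]
    by (simp add: nn_integral_scale_measure \<nu>_def)
  moreover have coneS: "x \<in> sphere_cone S \<longleftrightarrow> x \<noteq> 0" for x by (auto simp: sphere_cone_def S_def)
  have "AE x in lborel. x \<noteq> (0 :: real ^ 'n)" by (rule AE_lborel_singleton)
  then have "?I S = (\<integral>\<^sup>+x. w (norm (x :: real ^ 'n)) \<partial>lborel)"
    by (intro nn_integral_cong_AE, elim AE_mp) (auto simp: coneS indicator_def)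
  moreover have "b = emeasure lborel (cball 0 1 :: (real ^ 'n) set)"
  proof -
    have "sphere_cone S \<inter> cball 0 1 = cball 0 1 - {0}" by (auto simp: coneS)
    then show ?thesis unfolding b_def
      by (simp add: emeasure_Diff)
  qed
  ultimately show ?thesis
    using emeasure_sphere_measure[OF A] by (simp add: a_def mult_ac)
qed


text \<open>The weighted Lebesgue measure, projected radially, is proportional to the surface
  measure by \<open>polar_emeasure\<close>; integrating \<open>h\<close> against both gives the
  claim. The origin is cut out because \<open>unit_dir\<close> sends it to 0, which lies off the
  sphere, where nothing is known about \<open>h\<close>.\<close>

lemma polar_integral:
  fixes h :: "real ^ 'n::finite \<Rightarrow> complex" and w :: "real \<Rightarrow> real"
  assumes h: "continuous_on (sphere 0 1) h" and w [measurable]: "w \<in> borel_measurable borel"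
    and w0: "\<And>s. w s \<ge> 0" and int: "integrable lborel (\<lambda>x :: real ^ 'n. w (norm x))"
  shows "(CARD('n) * measure lborel (cball 0 1 :: (real ^ 'n) set)) *\<^sub>R (LINT x|lborel. w (norm x) *\<^sub>R (if x = 0 then 0 else h (unit_dir x)))
     = (LINT x|lborel. w (norm (x :: real ^ 'n))) *\<^sub>R (LINT \<theta>|sphere_measure. h \<theta>)"
proof -
  define S where "S = (sphere 0 1 :: (real ^ 'n) set)"
  define N where "N = restrict_space borel S"
  define K where "K = restrict_space lborel (- {0 :: real ^ 'n})"
  define V where "V = CARD('n) * measure lborel (cball 0 1 :: (real ^ 'n) set)"
  define W where "W = (LINT x|lborel. w (norm (x :: real ^ 'n)))"
  let ?KW = "density K (\<lambda>x. ennreal (w (norm x)))"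
  define M where "M = distr ?KW N unit_dir"
  have V: "of_nat CARD('n) * emeasure lborel (cball 0 1 :: (real ^ 'n) set) = ennreal V"
    unfolding V_def using emeasure_lborel_cball_finite[of "0 :: real ^ 'n" 1]
    by (simp add: emeasure_eq_ennreal_measure ennreal_mult ennreal_of_nat_eq_real_of_nat less_top)
  have W: "(\<integral>\<^sup>+x. ennreal (w (norm (x :: real ^ 'n))) \<partial>lborel) = ennreal W"
    unfolding W_def by (rule nn_integral_eq_integral[OF int]) (simp add: w0)
  have [measurable]: "unit_dir \<in> measurable K N"
    unfolding K_def N_def
    by (rule measurable_restrict_space2)
       (auto intro!: measurable_restrict_space1 simp: space_restrict_space S_def)
  have wK [measurable]: "(\<lambda>x. w (norm x)) \<in> borel_measurable K"
    unfolding K_def by (rule measurable_restrict_space1) measurable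
  have u': "unit_dir \<in> measurable ?KW N"
    by simp
  have hN: "h \<in> borel_measurable N"
    unfolding N_def S_def by (rule borel_measurable_continuous_on_restrict[OF h])
  have MA: "emeasure M A = (\<integral>\<^sup>+x. ennreal (w (norm x)) * indicator (sphere_cone A) x \<partial>lborel)"
    if A: "A \<in> sets N" for A
  proof -
    have [measurable]: "A \<in> sets borel" using A sets_sphereD unfolding N_def S_def by blast
    have "emeasure M A = emeasure ?KW (unit_dir -` A \<inter> space K)"
      unfolding M_def by (subst emeasure_distr[OF u' A]) simp
    also have "unit_dir -` A \<inter> space K = sphere_cone A"
      by (auto simp: K_def space_restrict_space sphere_cone_def)
    also have "emeasure ?KW (sphere_cone A) = (\<integral>\<^sup>+x. ennreal (w (norm x)) * indicator (sphere_cone A) x \<partial>K)"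
    proof (rule emeasure_density)
      show "sphere_cone A \<in> sets K" unfolding K_def
        by (auto simp: sets_restrict_space sphere_cone_def intro!: image_eqI[where x = "sphere_cone A"])
    qed measurable
    also have "\<dots> = (\<integral>\<^sup>+x. (ennreal (w (norm x)) * indicator (sphere_cone A) x) * indicator (- {0}) x \<partial>lborel)"
      unfolding K_def by (rule nn_integral_restrict_space) simp
    also have "\<dots> = (\<integral>\<^sup>+x. ennreal (w (norm x)) * indicator (sphere_cone A) x \<partial>lborel)"
      by (intro nn_integral_cong) (auto simp: indicator_def sphere_cone_def)
    finally show ?thesis .
  qed
  have "scale_measure (ennreal V) M = scale_measure (ennreal W) (sphere_measure :: (real ^ 'n) measure)"
  proof (rule measure_eqI)
    fix A assume "A \<in> sets (scale_measure (ennreal V) M)"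
    then have A: "A \<in> sets N" by (simp add: M_def)
    then show "emeasure (scale_measure (ennreal V) M) A = emeasure (scale_measure (ennreal W) sphere_measure) A"
      using polar_emeasure[of A "\<lambda>s. ennreal (w s)"] by (simp add: MA V W N_def S_def)
  qed (simp add: M_def N_def S_def)
  then have eq: "density M (\<lambda>_. ennreal V) = density sphere_measure (\<lambda>_. ennreal W)"
    by (simp add: scale_measure_conv_density)
  have nonneg: "V \<ge> 0" "W \<ge> 0" unfolding V_def W_def by (auto intro!: integral_nonneg_AE simp: w0)
  have hM: "h \<in> borel_measurable M" using hN by (simp add: M_def)
  have hS: "h \<in> borel_measurable sphere_measure" by (rule borel_measurable_sphere[OF h])
  have "V *\<^sub>R integral\<^sup>L M h = integral\<^sup>L (density M (\<lambda>_. ennreal V)) h"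
    by (subst integral_density) (use hM nonneg in auto)
  also have "\<dots> = integral\<^sup>L (density sphere_measure (\<lambda>_. ennreal W)) h" by (simp add: eq)
  also have "\<dots> = W *\<^sub>R integral\<^sup>L sphere_measure h"
    by (subst integral_density) (use hS nonneg in auto)
  finally have *: "V *\<^sub>R integral\<^sup>L M h = W *\<^sub>R integral\<^sup>L sphere_measure h" .
  have "integral\<^sup>L M h = integral\<^sup>L ?KW (\<lambda>x. h (unit_dir x))"
    unfolding M_def by (rule integral_distr[OF u' hN])
  also have "\<dots> = integral\<^sup>L K (\<lambda>x. w (norm x) *\<^sub>R h (unit_dir x))"
    by (rule integral_density) (use hN w0 in auto)
  also have "\<dots> = (LINT x|lborel. indicator (- {0}) x *\<^sub>R (w (norm x) *\<^sub>R h (unit_dir x)))"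
    unfolding K_def by (rule integral_restrict_space) simp
  also have "\<dots> = (LINT x|lborel. w (norm x) *\<^sub>R (if x = 0 then 0 else h (unit_dir x)))"
    by (intro Bochner_Integration.integral_cong) (auto simp: indicator_def)
  finally show ?thesis using * by (simp add: V_def W_def)
qed


section \<open>The L^2 norm on the real sphere and the sup bound it gives\<close>

lemma continuous_on_cvec [continuous_intros]: "continuous_on A cvec"
  unfolding cvec_def by (intro continuous_intros)

lemma continuous_on_entire_cvec:
  assumes "entire F"
  shows "continuous_on A (\<lambda>x. F (cvec x))"
  using continuous_on_compose2[OF entire_continuous[OF assms, of UNIV] continuous_on_cvec] by simp

definition snorm2 :: "(complex ^ 'n::finite \<Rightarrow> complex) \<Rightarrow> real" where
  "snorm2 q = (LINT \<theta>|sphere_measure. (cmod (q (cvec \<theta>)))\<^sup>2)"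

definition snorm :: "(complex ^ 'n::finite \<Rightarrow> complex) \<Rightarrow> real" where
  "snorm q = sqrt (snorm2 q)"

lemma snorm2_nonneg: "snorm2 q \<ge> 0"
  unfolding snorm2_def by (intro integral_nonneg_AE) simp

lemma snorm_nonneg [simp]: "snorm q \<ge> 0"
  by (simp add: snorm_def snorm2_nonneg)

lemma snorm_sq: "(snorm q)\<^sup>2 = snorm2 q"
  by (simp add: snorm_def snorm2_nonneg)

lemma sphere_inner_self: "sphere_inner q q = complex_of_real (snorm2 q)"
proof -
  have "sphere_inner q q = (LINT \<theta>|sphere_measure. complex_of_real ((cmod (q (cvec \<theta>)))\<^sup>2))"
    unfolding sphere_inner_def by (simp only: complex_norm_square)
  then show ?thesis by (simp only: snorm2_def integral_complex_of_real)
qed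

lemma snorm2_mono:
  assumes "entire F" "entire G" "\<And>\<theta>. norm \<theta> = 1 \<Longrightarrow> cmod (F (cvec \<theta>)) \<le> A * cmod (G (cvec \<theta>))" "A \<ge> 0"
  shows "snorm F \<le> A * snorm G"
proof -
  have "snorm2 F \<le> (LINT \<theta>|sphere_measure. A\<^sup>2 * (cmod (G (cvec \<theta>)))\<^sup>2)"
    unfolding snorm2_def
  proof (rule integral_mono)
    show "integrable sphere_measure (\<lambda>\<theta>. (cmod (F (cvec \<theta>)))\<^sup>2)"
      "integrable sphere_measure (\<lambda>\<theta>. A\<^sup>2 * (cmod (G (cvec \<theta>)))\<^sup>2)"
      by (intro integrable_sphere continuous_intros continuous_on_entire_cvec assms)+
    fix \<theta> :: "real ^ 'a" assume "\<theta> \<in> space sphere_measure"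
    then show "(cmod (F (cvec \<theta>)))\<^sup>2 \<le> A\<^sup>2 * (cmod (G (cvec \<theta>)))\<^sup>2"
      using power_mono[OF assms(3), of \<theta> 2] by (simp add: power_mult_distrib)
  qed
  also have "\<dots> = A\<^sup>2 * snorm2 G" by (simp add: snorm2_def)
  finally show ?thesis unfolding snorm_def using assms(4)
    by (metis real_sqrt_le_iff real_sqrt_mult real_sqrt_abs abs_of_nonneg)
qed

lemma snorm_le_sup:
  assumes "entire (F :: complex ^ 'n::finite \<Rightarrow> complex)" "\<And>\<theta>. norm \<theta> = 1 \<Longrightarrow> cmod (F (cvec \<theta>)) \<le> A" "A \<ge> 0"
  shows "snorm F \<le> A * snorm (\<lambda>_ :: complex ^ 'n. 1)"
  using assms by (intro snorm2_mono) auto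

text \<open>A weighted form of Cauchy-Schwarz, integrated from the pointwise inequality 2 u v \<le>
  u^2 / c + c v^2. The free weight is later set to the coercivity constant.\<close>

lemma sphere_inner_le:
  assumes "entire F" "entire G" "c > 0"
  shows "Re (sphere_inner F G) \<le> snorm2 F / (2 * c) + c * snorm2 G / 2"
proof -
  have ptw: "Re (a * cnj b) \<le> (cmod a)\<^sup>2 / (2 * c) + c * (cmod b)\<^sup>2 / 2" for a b
  proof -
    have "Re (a * cnj b) \<le> cmod a * cmod b"
      by (metis complex_Re_le_cmod norm_mult complex_mod_cnj)
    also have "\<dots> \<le> (cmod a)\<^sup>2 / (2 * c) + c * (cmod b)\<^sup>2 / 2"
      using assms(3) zero_le_power2[of "cmod a - c * cmod b"]
      by (simp add: field_simps power2_eq_square)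
    finally show ?thesis .
  qed
  have int: "integrable sphere_measure (\<lambda>\<theta>. F (cvec \<theta>) * cnj (G (cvec \<theta>)))"
    "integrable sphere_measure (\<lambda>\<theta>. (cmod (F (cvec \<theta>)))\<^sup>2 / (2 * c))"
    "integrable sphere_measure (\<lambda>\<theta>. c * (cmod (G (cvec \<theta>)))\<^sup>2 / 2)"
    using assms(3) by (intro integrable_sphere continuous_intros continuous_on_entire_cvec assms; simp)+
  have "Re (sphere_inner F G) = (LINT \<theta>|sphere_measure. Re (F (cvec \<theta>) * cnj (G (cvec \<theta>))))"
    unfolding sphere_inner_def using integral_Re[OF int(1)] by simp
  also have "\<dots> \<le> (LINT \<theta>|sphere_measure. (cmod (F (cvec \<theta>)))\<^sup>2 / (2 * c) + c * (cmod (G (cvec \<theta>)))\<^sup>2 / 2)"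
    using int by (intro integral_mono ptw integrable_Re Bochner_Integration.integrable_add)
  also have "\<dots> = snorm2 F / (2 * c) + c * snorm2 G / 2"
    using int by (simp add: snorm2_def)
  finally show ?thesis .
qed

text \<open>Cauchy's inequality on circles of radius 1 bounds the derivative on the unit disc by the
  bound for the disc of radius 2.\<close>

lemma entire_line_lipschitz:
  assumes F: "entire F" and B: "\<And>t. cmod t \<le> 2 \<Longrightarrow> cmod (F (z + t *s w)) \<le> B" and s: "cmod s \<le> 1"
  shows "cmod (F (z + s *s w) - F z) \<le> B * cmod s"
proof -
  let ?f = "\<lambda>t. F (z + t *s w)"
  have hol: "?f holomorphic_on A" for A by (rule entire_line_holomorphic[OF F])
  have "cmod (?f s - ?f 0) \<le> B * cmod (s - 0)"
  proof (rule field_differentiable_bound[where S = "cball 0 1" and f' = "deriv ?f"])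
    fix t :: complex assume t: "t \<in> cball 0 1"
    show "(?f has_field_derivative deriv ?f t) (at t within cball 0 1)"
      using holomorphic_derivI[OF hol[of UNIV]] by (simp add: has_field_derivative_at_within)
    have "cmod ((deriv ^^ 1) ?f t) \<le> fact 1 * B / 1 ^ 1"
    proof (rule Cauchy_inequality[where r = 1])
      fix x assume x: "cmod (t - x) = 1"
      have "cmod x \<le> cmod t + cmod (t - x)" by (metis norm_minus_commute norm_triangle_sub)
      then show "cmod (?f x) \<le> B" using B[of x] t x by simp
    qed (auto intro: hol holomorphic_on_imp_continuous_on)
    then show "cmod (deriv ?f t) \<le> B" by simp
  qed (use s in auto)
  then show ?thesis by simp
qed

text \<open>The maximum A of |q| over the real unit ball cannot be a narrow peak: |q| stays above A
  / 2 on a ball whose radius is a geometric sequence in n. The volume of that ball gives a lower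
  bound for the L^2 norm, hence an upper bound for A, and \<open>hom_poly_complex_bound\<close>
  carries it to complex arguments.\<close>

lemma hom_poly_snorm_bound:
  shows "\<exists>K B. K \<ge> 1 \<and> B \<ge> 1 \<and> (\<forall>n q z. hom_poly n q \<longrightarrow>
     cmod (q (z :: complex ^ 'n::finite)) \<le> K * B ^ n * norm z ^ n * snorm q)"
proof -
  define d where "d = CARD('n)"
  define v where "v = unit_ball_vol (real d)"
  have d: "d > 0" "real d > 0" by (auto simp: d_def)
  have v: "v > 0" by (simp add: v_def)
  define K where "K = max 1 (sqrt (4 * 4 ^ d / (real d * v)))"
  define B where "B = (24 * sqrt (72 ^ d) :: real)"
  have K: "K \<ge> 1" "K\<^sup>2 \<ge> 4 * 4 ^ d / (real d * v)"
  proof -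
    show "K \<ge> 1" by (simp add: K_def)
    have "sqrt (4 * 4 ^ d / (real d * v)) \<le> K" by (simp add: K_def)
    then have "(sqrt (4 * 4 ^ d / (real d * v)))\<^sup>2 \<le> K\<^sup>2"
      using d v by (intro power_mono) auto
    then show "K\<^sup>2 \<ge> 4 * 4 ^ d / (real d * v)" using d v by simp
  qed
  have B: "B \<ge> 1" unfolding B_def
  proof -
    have "sqrt (72 ^ d) \<ge> (1 :: real)" by simp
    then show "24 * sqrt (72 ^ d) \<ge> (1 :: real)" by linarith
  qed
  have "cmod (q z) \<le> K * B ^ n * norm z ^ n * snorm q" if q: "hom_poly n q" for n q and z :: "complex ^ 'n"
  proof -
    have ent: "entire q" using q by auto
    have "\<exists>x\<in>cball 0 1. \<forall>y\<in>cball 0 1. cmod (q (cvec y)) \<le> cmod (q (cvec (x :: real ^ 'n)))"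
      by (rule continuous_attains_sup) (auto intro!: continuous_intros continuous_on_entire_cvec ent)
    then obtain x0 where x0: "norm x0 \<le> 1" and max: "\<And>y. norm y \<le> 1 \<Longrightarrow> cmod (q (cvec y)) \<le> cmod (q (cvec x0))"
      by auto
    define A where "A = cmod (q (cvec x0))"
    \<comment> \<open>Segments of complex length 2 from \<open>x0\<close> stay in the ball of radius
      3, where |q| is at most A (24 * 3)^n. This Lipschitz constant times \<eta> is A / 2.\<close>
    define \<eta> where "\<eta> = (1 / (2 * 72 ^ n) :: real)"
    have \<eta>: "\<eta> > 0" "\<eta> \<le> 1" 
    proof -
      have "(72 :: real) ^ n \<ge> 1" by simp
      then have "2 * (72 :: real) ^ n \<ge> 1" by linarith
      then show "\<eta> > 0" "\<eta> \<le> 1" by (simp_all add: \<eta>_def)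
    qed
    have "A \<ge> 0" by (simp add: A_def)
    have cb: "cmod (q u) \<le> A * (24 * norm u) ^ n" for u
      using hom_poly_complex_bound[OF q, of A u] max unfolding A_def by blast
    have near: "cmod (q (cvec x)) \<ge> A / 2" if x: "norm (x - x0) \<le> \<eta>" for x
    proof (cases "x = x0")
      case True
      then show ?thesis by (simp add: A_def)
    next
      case False
      define s where "s = complex_of_real (norm (x - x0))"
      define h where "h = cvec ((x - x0) /\<^sub>R norm (x - x0))"
      have s: "cmod s = norm (x - x0)" by (simp add: s_def)
      have h: "norm h = 1" using False by (simp add: h_def)
      have "s *s h = cvec (x - x0)" unfolding s_def h_def cvec_scaleR[symmetric] using False by simp
      then have xh: "cvec x = cvec x0 + s *s h" by (metis cvec_add add_diff_cancel_left' diff_add_cancel add.commute)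
      have "cmod (q (cvec x0 + s *s h) - q (cvec x0)) \<le> (A * 72 ^ n) * cmod s"
      proof (rule entire_line_lipschitz[OF ent])
        fix t :: complex assume t: "cmod t \<le> 2"
        have "norm (cvec x0 + t *s h) \<le> norm x0 + cmod t"
          by (rule order_trans[OF norm_triangle_ineq]) (simp add: h)
        then have "norm (cvec x0 + t *s h) \<le> 3" using t x0 by linarith
        then have "A * (24 * norm (cvec x0 + t *s h)) ^ n \<le> A * 72 ^ n"
          using \<open>A \<ge> 0\<close> by (intro mult_left_mono power_mono) auto
        then show "cmod (q (cvec x0 + t *s h)) \<le> A * 72 ^ n" using cb order_trans by blast
      qed (use s x \<eta> in auto)
      also have "\<dots> \<le> (A * 72 ^ n) * \<eta>"
        using x s \<open>A \<ge> 0\<close> by (intro mult_left_mono) auto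
      also have "\<dots> = A / 2" by (simp add: \<eta>_def)
      finally have "cmod (q (cvec x) - q (cvec x0)) \<le> A / 2" by (simp add: xh)
      then show ?thesis using norm_triangle_ineq3[of "q (cvec x)" "q (cvec x0)"]
        unfolding A_def by linarith
    qed
    \<comment> \<open>\<open>x0\<close> may lie on the boundary. Moving the centre inwards by at
      most \<eta> / 2 keeps the ball of radius \<eta> / 2 inside the unit ball and within \<eta> of
      \<open>x0\<close>.\<close>
    define c where "c = (1 - \<eta> / 2) *\<^sub>R x0"
    define U where "U = ball c (\<eta> / 2)"
    have U1: "norm x \<le> 1" if "x \<in> U" for x
    proof -
      have "norm x \<le> norm c + dist c x" by (metis add.commute dist_commute dist_norm norm_triangle_sub)
      also have "norm c \<le> 1 - \<eta> / 2"
        using x0 \<eta> by (simp add: c_def mult_left_le)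
      finally show ?thesis using that by (simp add: U_def)
    qed
    have U2: "norm (x - x0) \<le> \<eta>" if "x \<in> U" for x
    proof -
      have "norm (x - x0) \<le> norm (x - c) + norm (c - x0)" by (rule norm_diff_triangle_ineq[of x c c x0, simplified])
      also have "c - x0 = - (\<eta> / 2) *\<^sub>R x0" by (simp add: c_def algebra_simps)
      also have "norm \<dots> \<le> \<eta> / 2" using x0 \<eta> by (simp add: mult_left_le)
      finally show ?thesis using that by (simp add: U_def dist_norm norm_minus_commute)
    qed
    \<comment> \<open>By homogeneity, projecting a point of the unit ball to the sphere can only
      increase |q|.\<close>
    have bound: "indicator (U - {0}) x * (A / 2)\<^sup>2 \<le> (cmod (q (cvec (unit_dir x))))\<^sup>2"
      if "x \<in> space (restrict_space lborel (cball 0 1 - {0}))" for x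
    proof (cases "x \<in> U - {0}")
      case True
      have "A / 2 \<le> cmod (q (cvec x))" using near U2 True by blast
      also have "cvec x = complex_of_real (norm x) *s cvec (unit_dir x)"
        using True by (simp add: cvec_scaleR[symmetric])
      also have "cmod (q \<dots>) = norm x ^ n * cmod (q (cvec (unit_dir x)))"
        by (simp add: hom_poly_scale[OF q] norm_mult norm_power)
      also have "\<dots> \<le> 1 * cmod (q (cvec (unit_dir x)))"
        using U1 True by (intro mult_right_mono power_le_one) auto
      finally show ?thesis using True \<open>A \<ge> 0\<close> by (simp add: power_mono)
    qed simp
    let ?R = "restrict_space lborel (cball 0 1 - {0 :: real ^ 'n})"
    let ?D = "distr ?R (restrict_space borel (sphere 0 1)) unit_dir"
    have intS: "integrable ?R (\<lambda>x. (cmod (q (cvec (unit_dir x))))\<^sup>2)"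
    proof -
      have "integrable sphere_measure (\<lambda>x. (cmod (q (cvec x)))\<^sup>2)"
        by (intro integrable_sphere continuous_intros continuous_on_entire_cvec ent)
      then have "integrable (density ?D (\<lambda>_. ennreal (real CARD('n)))) (\<lambda>x. (cmod (q (cvec x)))\<^sup>2)"
        unfolding sphere_measure_def scale_measure_conv_density by (simp add: ennreal_of_nat_eq_real_of_nat)
      moreover have m: "(\<lambda>x. (cmod (q (cvec x)))\<^sup>2) \<in> borel_measurable (restrict_space borel (sphere 0 1))"
        by (intro borel_measurable_continuous_on_restrict continuous_intros continuous_on_entire_cvec ent)
      ultimately have "integrable ?D (\<lambda>x. real CARD('n) *\<^sub>R (cmod (q (cvec x)))\<^sup>2)"
        by (subst (asm) integrable_density) auto
      then have "integrable ?D (\<lambda>x. (cmod (q (cvec x)))\<^sup>2)"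
        by simp
      then show ?thesis using integrable_distr_eq[OF unit_dir_measurable m] by simp
    qed
    have Um: "U - {0} \<in> sets lborel" by (simp add: U_def)
    have Usub: "U - {0} \<subseteq> cball 0 1 - {0}" using U1 by auto
    have fU: "emeasure lborel (U - {0}) < \<infinity>"
      unfolding U_def by (rule le_less_trans[OF emeasure_mono emeasure_lborel_ball_finite[of c "\<eta> / 2"]]) auto
    have intU: "integrable ?R (\<lambda>x. indicator (U - {0}) x * (A / 2)\<^sup>2)"
      using Um Usub fU by (intro integrable_mult_left integrable_real_indicator)
        (auto simp: sets_restrict_space emeasure_restrict_space intro!: image_eqI[where x = "U - {0}"])
    have "measure lborel (U - {0}) = measure lborel U"
      unfolding measure_def U_def by (subst emeasure_Diff_null_set) (auto simp: null_sets_def)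
    also have "\<dots> = v * (\<eta> / 2) ^ d"
      unfolding U_def v_def d_def using \<eta> by (simp add: content_ball)
    finally have volU: "measure lborel (U - {0}) = v * (\<eta> / 2) ^ d" .
    have "v * (\<eta> / 2) ^ d * (A / 2)\<^sup>2 = (LINT x|?R. indicator (U - {0}) x * (A / 2)\<^sup>2)"
      using Usub volU Um by (simp add: measure_restrict_space Int_absorb2 space_restrict_space)
    also have "\<dots> \<le> (LINT x|?R. (cmod (q (cvec (unit_dir x))))\<^sup>2)"
      by (rule integral_mono[OF intU intS bound])
    finally have "real d * (v * (\<eta> / 2) ^ d * (A / 2)\<^sup>2) \<le> snorm2 q"
      unfolding snorm2_def d_def
      by (subst integral_sphere_measure) (auto intro!: continuous_intros continuous_on_entire_cvec ent)
    then have "A\<^sup>2 * (real d * v) \<le> snorm2 q * 4 / (\<eta> / 2) ^ d"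
      using \<eta> by (simp add: field_simps)
    \<comment> \<open>Here 2 / \<eta> = 4 * 72^n; its d-th power is again geometric in n, and its
      square root enters \<open>B\<close>.\<close>
    also have "1 / (\<eta> / 2) ^ d = 4 ^ d * (72 ^ d) ^ n"
      by (simp add: \<eta>_def power_divide power_mult_distrib mult.commute flip: power_mult)
    then have "snorm2 q * 4 / (\<eta> / 2) ^ d = snorm2 q * 4 * (4 ^ d * (72 ^ d) ^ n)"
      by (metis (no_types) times_divide_eq_right mult.right_neutral)
    finally have "A\<^sup>2 \<le> (4 * 4 ^ d / (real d * v)) * (72 ^ d) ^ n * snorm2 q"
      using d v by (simp add: field_simps)
    also have "\<dots> \<le> K\<^sup>2 * (72 ^ d) ^ n * snorm2 q"
      using K snorm2_nonneg by (intro mult_right_mono) auto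
    also have "\<dots> = (K * sqrt (72 ^ d) ^ n * snorm q)\<^sup>2"
    proof -
      have "(sqrt (72 ^ d) ^ n)\<^sup>2 = ((sqrt (72 ^ d))\<^sup>2 :: real) ^ n"
        by (metis power_mult mult.commute)
      then show ?thesis by (simp add: power_mult_distrib snorm_sq)
    qed
    finally have "A \<le> K * sqrt (72 ^ d) ^ n * snorm q"
      using K by (elim power2_le_imp_le) auto
    then have "A * (24 * norm z) ^ n \<le> (K * sqrt (72 ^ d) ^ n * snorm q) * (24 * norm z) ^ n"
      by (intro mult_right_mono) auto
    also have "\<dots> = K * B ^ n * norm z ^ n * snorm q"
      by (simp add: B_def power_mult_distrib)
    finally show ?thesis using cb[of z] by linarith
  qed
  then show ?thesis using K B by blast
qed

subsection \<open>Gaussian integrals\<close>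

text \<open>Lebesgue measure is the image of the product measure over \<open>Basis\<close>, so this
  is Fubini for products after re-indexing the standard basis by \<open>'n\<close>.\<close>

lemma lborel_integral_prod_vec:
  fixes h :: "'n::finite \<Rightarrow> real \<Rightarrow> complex"
  assumes h: "\<And>i. integrable lborel (h i)"
  shows "integrable lborel (\<lambda>x :: real ^ 'n. \<Prod>i\<in>UNIV. h i (x $ i))"
    and "(LINT x|lborel. (\<Prod>i\<in>UNIV. h i ((x :: real ^ 'n) $ i))) = (\<Prod>i\<in>UNIV. LINT t|lborel. h i t)"
proof -
  interpret product_sigma_finite "\<lambda>_ :: real ^ 'n. lborel :: real measure"
    by standard
  define ax where "ax = (\<lambda>i. axis i 1 :: real ^ 'n)"
  define idx where "idx = inv ax"
  have inj: "inj ax" by (auto simp: inj_def ax_def axis_eq_axis)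
  have B: "Basis = range ax" by (auto simp: Basis_vec_def ax_def)
  have idx: "idx (ax i) = i" for i unfolding idx_def by (rule inv_f_f[OF inj])
  have prodB: "(\<Prod>b\<in>Basis. g b) = (\<Prod>i\<in>UNIV. g (ax i))" for g :: "real ^ 'n \<Rightarrow> complex"
    unfolding B by (rule prod.reindex[OF inj, unfolded o_def])
  have comp: "(\<Sum>b\<in>Basis. f b *\<^sub>R b) $ i = f (ax i)" for f and i
  proof -
    have "(\<Sum>b\<in>Basis. f b *\<^sub>R b) = (\<Sum>j\<in>UNIV. f (ax j) *\<^sub>R ax j)"
      unfolding B by (rule sum.reindex[OF inj, unfolded o_def])
    then show ?thesis by (simp add: ax_def axis_def if_distrib cong: if_cong)
  qed
  let ?g = "\<lambda>f :: real ^ 'n \<Rightarrow> real. \<Sum>b\<in>Basis. f b *\<^sub>R b"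
  let ?H = "\<lambda>x :: real ^ 'n. \<Prod>i\<in>UNIV. h i (x $ i)"
  have [measurable]: "h i \<in> borel_measurable borel" for i
    using borel_measurable_integrable[OF h[of i]] by simp
  have Hm: "?H \<in> borel_measurable borel" by measurable
  have gm: "?g \<in> measurable (\<Pi>\<^sub>M b\<in>Basis. lborel) borel" by measurable
  have eq: "?H (?g f) = (\<Prod>b\<in>Basis. h (idx b) (f b))" for f
    unfolding prodB comp idx ..
  have int: "integrable (\<Pi>\<^sub>M b\<in>Basis. lborel) (\<lambda>f. \<Prod>b\<in>Basis. h (idx b) (f b))"
    by (rule product_integrable_prod) (auto intro: h)
  show "integrable lborel ?H"
    unfolding lborel_eq[where 'a = "real ^ 'n"] integrable_distr_eq[OF gm Hm] eq by (rule int)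
  have "integral\<^sup>L lborel ?H = (LINT f|(\<Pi>\<^sub>M b\<in>Basis. lborel). (\<Prod>b\<in>Basis. h (idx b) (f b)))"
    unfolding lborel_eq[where 'a = "real ^ 'n"] integral_distr[OF gm Hm] eq ..
  also have "\<dots> = (\<Prod>b\<in>Basis. LINT t|lborel. h (idx b) t)"
    by (rule product_integral_prod) (auto intro: h)
  also have "\<dots> = (\<Prod>i\<in>UNIV. LINT t|lborel. h i t)"
    unfolding prodB idx ..
  finally show "integral\<^sup>L lborel ?H = (\<Prod>i\<in>UNIV. LINT t|lborel. h i t)" .
qed

definition gmom :: "nat \<Rightarrow> complex" where
  "gmom k = (LINT t|lborel. complex_of_real (exp (- t\<^sup>2 / 2) * t ^ k))"

lemma gauss_eq: "exp (- t\<^sup>2 / 2) * t ^ k = sqrt (2 * pi) * (std_normal_density t * t ^ k)"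
  by (simp add: std_normal_density_def)

lemma gmom_integrable: "integrable lborel (\<lambda>t. complex_of_real (exp (- t\<^sup>2 / 2) * t ^ k))"
  unfolding gauss_eq
  by (intro integrable_of_real integrable_mult_right integrable_std_normal_moment)

text \<open>This is integration by parts against exp(-t^2 / 2), read off from the closed formulas
  for the normal moments. For \<open>k = 0\<close> it says that the first moment vanishes.\<close>

lemma gmom_Suc: "gmom (Suc k) = of_nat k * gmom (k - 1)"
proof -
  have e: "gmom (2 * j) = of_real (sqrt (2 * pi) * (fact (2 * j) / (2 ^ j * fact j)))" for j
    unfolding gmom_def gauss_eq integral_complex_of_real
    by (simp only: integral_mult_right_zero integral_std_normal_moment_even)
  have o: "gmom (2 * j + 1) = 0" for j
    unfolding gmom_def gauss_eq integral_complex_of_real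
    by (simp only: integral_mult_right_zero integral_std_normal_moment_odd) simp
  show ?thesis
  proof (cases "even k")
    case True
    then obtain j where k: "k = 2 * j" by blast
    have "of_nat k * gmom (k - 1) = 0"
    proof (cases j)
      case (Suc i)
      then have "k - 1 = 2 * i + 1" by (simp add: k)
      then show ?thesis using o[of i] by simp
    qed (simp add: k)
    then show ?thesis using o[of j] k by simp
  next
    case False
    then obtain j where k: "k = 2 * j + 1" using oddE by blast
    have "(fact (2 * Suc j) :: real) = real (2 * j + 2) * real (2 * j + 1) * fact (2 * j)"
      by (simp add: algebra_simps)
    then have "(fact (2 * Suc j) :: real) / (2 ^ Suc j * fact (Suc j)) = real (2 * j + 1) * (fact (2 * j) / (2 ^ j * fact j))"
      by (simp add: field_simps del: fact_Suc) (simp add: algebra_simps)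
    then have "gmom (2 * Suc j) = of_real (real (2 * j + 1)) * gmom (2 * j)"
      unfolding e by (simp only: of_real_mult mult_ac)
    then show ?thesis using k by simp
  qed
qed

abbreviation gauss :: "real ^ 'n::finite \<Rightarrow> real" where
  "gauss x \<equiv> exp (- (norm x)\<^sup>2 / 2)"

lemma gauss_mon_eq:
  "gauss x *\<^sub>R mon a (cvec x) = (\<Prod>i\<in>UNIV. complex_of_real (exp (- (x $ i)\<^sup>2 / 2) * (x $ i) ^ a i))"
proof -
  have "(norm x)\<^sup>2 = (\<Sum>i\<in>UNIV. (x $ i)\<^sup>2)"
    by (simp add: norm_vec_def L2_set_def sum_nonneg)
  then have "gauss x = (\<Prod>i\<in>UNIV. exp (- (x $ i)\<^sup>2 / 2))"
    by (simp add: exp_sum[symmetric] sum_negf sum_divide_distrib)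
  then show ?thesis
    by (simp add: mon_def cvec_def scaleR_conv_of_real prod.distrib)
qed

definition gint :: "(complex ^ 'n::finite \<Rightarrow> complex) \<Rightarrow> complex" where
  "gint p = (LINT x|lborel. gauss x *\<^sub>R p (cvec x))"

lemma gint_mon: "integrable lborel (\<lambda>x. gauss x *\<^sub>R mon a (cvec x))" "gint (mon a) = (\<Prod>i\<in>UNIV. gmom (a i))"
  unfolding gint_def gauss_mon_eq gmom_def
  using lborel_integral_prod_vec[of "\<lambda>i t. complex_of_real (exp (- t\<^sup>2 / 2) * t ^ a i)", OF gmom_integrable]
  by auto

lemma gint_integrable:
  assumes "hom_poly m p"
  shows "integrable lborel (\<lambda>x. gauss x *\<^sub>R p (cvec x))"
  using assms
proof (induction rule: hom_poly_induct)
  case (mon a)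
  show ?case by (rule gint_mon)
next
  case (add p q)
  then show ?case by (simp add: scaleR_right_distrib)
next
  case (cmult c p)
  then show ?case unfolding mult_scaleR_right[symmetric] by (intro integrable_mult_right)
qed simp

lemma gint_add: "hom_poly m p \<Longrightarrow> hom_poly n q \<Longrightarrow> gint (\<lambda>z. p z + q z) = gint p + gint q"
  unfolding gint_def scaleR_right_distrib
  by (rule Bochner_Integration.integral_add[OF gint_integrable gint_integrable])

lemma gint_cmult: "gint (\<lambda>z. c * p z) = c * gint p"
  unfolding gint_def mult_scaleR_right[symmetric] by (rule integral_mult_right_zero)

lemma gint_sum:
  assumes "\<And>i. i \<in> A \<Longrightarrow> hom_poly m (p i)"
  shows "gint (\<lambda>z. \<Sum>i\<in>A. p i z) = (\<Sum>i\<in>A. gint (p i))"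
  unfolding gint_def scaleR_sum_right
  by (rule Bochner_Integration.integral_sum) (use assms gint_integrable in auto)

text \<open>Gaussian integration by parts: the i-th derivative of the weight is -x_i times the
  weight. On monomials it reduces to the recursion for the one-dimensional moments.\<close>

lemma gint_cderiv:
  assumes "hom_poly m p"
  shows "gint (cderiv i p) = gint (\<lambda>z. z $ i * p z)"
  using assms
proof (induction rule: hom_poly_induct)
  case (mon a)
  have "(\<lambda>z. z $ i * mon a z) = mon (a(i := Suc (a i)))"
  proof
    fix z show "z $ i * mon a z = mon (a(i := Suc (a i))) z"
      unfolding mon_def by (subst (1 2) prod.remove[of UNIV i]) (auto intro!: prod.cong)
  qed
  then have "gint (\<lambda>z. z $ i * mon a z) = (\<Prod>j\<in>UNIV. gmom ((a(i := Suc (a i))) j))"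
    by (simp add: gint_mon)
  also have "\<dots> = of_nat (a i) * (\<Prod>j\<in>UNIV. gmom ((a(i := a i - 1)) j))"
    by (subst (1 2) prod.remove[of UNIV i]) (auto simp: gmom_Suc intro!: prod.cong)
  also have "\<dots> = gint (cderiv i (mon a))"
    by (simp add: cderiv_mon[abs_def] gint_cmult gint_mon)
  finally show ?case by simp
next
  case (add p q)
  have "cderiv i (\<lambda>z. p z + q z) = (\<lambda>z. cderiv i p z + cderiv i q z)"
    using add by (auto simp: cderiv_add hom_poly_entire)
  moreover have "gint (\<lambda>z. cderiv i p z + cderiv i q z) = gint (cderiv i p) + gint (cderiv i q)"
    by (rule gint_add[OF hom_poly_cderiv[OF add(1)] hom_poly_cderiv[OF add(2)]])
  moreover have "gint (\<lambda>z. z $ i * p z + z $ i * q z) = gint (\<lambda>z. z $ i * p z) + gint (\<lambda>z. z $ i * q z)"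
    by (rule gint_add[OF hom_poly_mult[OF hom_poly_coord add(1)] hom_poly_mult[OF hom_poly_coord add(2)]])
  ultimately show ?case using add by (simp add: distrib_left)
next
  case (cmult c p)
  have "cderiv i (\<lambda>z. c * p z) = (\<lambda>z. c * cderiv i p z)"
    using cmult by (auto simp: cderiv_cmult hom_poly_entire)
  then show ?case using cmult by (simp add: gint_cmult mult.left_commute)
next
  case zero
  then show ?case by (simp add: cderiv_def)
qed

section \<open>From Gaussian integrals to the sphere: Green's identity\<close>

definition sint :: "(complex ^ 'n::finite \<Rightarrow> complex) \<Rightarrow> complex" where
  "sint p = (LINT \<theta>|sphere_measure. p (cvec \<theta>))"

definition ssq :: "complex ^ 'n::finite \<Rightarrow> complex" where
  "ssq z = (\<Sum>i\<in>UNIV. z $ i * z $ i)"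

lemma hom_poly_ssq: "hom_poly 2 ssq"
  unfolding ssq_def[abs_def]
  using hom_poly_mult[OF hom_poly_coord hom_poly_coord]
  by (intro hom_poly_sum) (simp add: numeral_2_eq_2)

lemma ssq_cvec: "ssq (cvec x) = complex_of_real ((norm x)\<^sup>2)"
  by (simp add: ssq_def cvec_def norm_vec_def L2_set_def sum_nonneg power2_eq_square)

text \<open>In polar coordinates the Gaussian integral of a homogeneous polynomial is a positive
  radial constant times its integral over the sphere. The even degree makes the weight nonnegative
  for all real s, as \<open>polar_integral\<close> demands.\<close>

lemma sint_eq_0:
  fixes p :: "complex ^ 'n::finite \<Rightarrow> complex"
  assumes p: "hom_poly (2 * l) p" and 0: "gint p = 0"
  shows "sint p = 0"
proof -
  define w where "w = (\<lambda>s :: real. exp (- s\<^sup>2 / 2) * s ^ (2 * l))"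
  have w0: "w s \<ge> 0" for s by (simp add: w_def)
  \<comment> \<open>The radial weight is integrable because |x|^(2l) is the polynomial
    \<open>ssq z ^ l\<close> at real vectors.\<close>
  have "hom_poly (l * 2) (\<lambda>z :: complex ^ 'n. ssq z ^ l)" by (rule hom_poly_power[OF hom_poly_ssq])
  from gint_integrable[OF this]
  have "integrable lborel (\<lambda>x :: real ^ 'n. Re (gauss x *\<^sub>R ssq (cvec x) ^ l))" by (rule integrable_Re)
  moreover have "Re (gauss x *\<^sub>R ssq (cvec x) ^ l) = w (norm x)" for x :: "real ^ 'n"
    unfolding ssq_cvec w_def of_real_power[symmetric] by (simp add: power_mult)
  ultimately have int: "integrable lborel (\<lambda>x :: real ^ 'n. w (norm x))" by simp
  let ?W = "LINT x|lborel. w (norm (x :: real ^ 'n))"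
  have nz: "AE x in lborel. x \<noteq> (0 :: real ^ 'n)" by (rule AE_lborel_singleton)
  \<comment> \<open>The weight is positive off the origin, so a zero integral would make Lebesgue
    measure trivial.\<close>
  have "?W \<noteq> 0"
  proof
    assume "?W = 0"
    then have "AE x in lborel. w (norm (x :: real ^ 'n)) = 0"
      using integral_nonneg_eq_0_iff_AE[OF int] w0 by simp
    with nz have "AE x in (lborel :: (real ^ 'n) measure). False"
      by eventually_elim (simp add: w_def)
    then show False
      using ae_filter_eq_bot_iff[of "lborel :: (real ^ 'n) measure"] by (simp add: eventually_False)
  qed
  have "(LINT x|lborel. w (norm x) *\<^sub>R (if x = 0 then 0 else p (cvec (unit_dir x)))) = gint p"
    unfolding gint_def
  proof (rule integral_cong_AE)
    show "AE x in lborel. w (norm x) *\<^sub>R (if x = 0 then 0 else p (cvec (unit_dir x))) = gauss x *\<^sub>R p (cvec x)"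
      using nz
    proof eventually_elim
      case (elim x)
      have "cvec x = complex_of_real (norm x) *s cvec (unit_dir x)"
        using elim by (simp add: cvec_scaleR[symmetric])
      then have "p (cvec x) = complex_of_real (norm x) ^ (2 * l) * p (cvec (unit_dir x))"
        by (metis hom_poly_scale[OF p])
      then show ?case using elim by (simp add: w_def scaleR_conv_of_real mult.assoc)
    qed
    show "(\<lambda>x. gauss x *\<^sub>R p (cvec x)) \<in> borel_measurable lborel"
      using gint_integrable[OF p] by auto
    have [measurable]: "(\<lambda>x. p (cvec x)) \<in> borel_measurable borel"
      by (intro borel_measurable_continuous_onI continuous_on_entire_cvec hom_poly_entire[OF p])
    show "(\<lambda>x. w (norm x) *\<^sub>R (if x = 0 then 0 else p (cvec (unit_dir x)))) \<in> borel_measurable lborel"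
      unfolding w_def by measurable
  qed
  then have "?W *\<^sub>R sint p = 0"
    using polar_integral[OF continuous_on_entire_cvec[OF hom_poly_entire[OF p]] _ w0 int] 0
    by (simp add: sint_def w_def)
  then show ?thesis using \<open>?W \<noteq> 0\<close> by simp
qed

definition claplacian :: "(complex ^ 'n::finite \<Rightarrow> complex) \<Rightarrow> complex ^ 'n \<Rightarrow> complex" where
  "claplacian F z = (\<Sum>i\<in>UNIV. cderiv i (cderiv i F) z)"

lemma hom_poly_claplacian [intro]: "hom_poly m p \<Longrightarrow> hom_poly (m - 2) (claplacian p)"
  unfolding claplacian_def[abs_def] by (intro hom_poly_sum) (metis diff_diff_left hom_poly_cderiv one_add_one)

lemma hom_poly_claplacian_pow: "hom_poly m p \<Longrightarrow> hom_poly (m - 2 * k) ((claplacian ^^ k) p)"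
proof (induction k)
  case (Suc k)
  then show ?case using hom_poly_claplacian[of "m - 2 * k" "(claplacian ^^ k) p"] by simp
qed simp

text \<open>Covers the degrees in which the truncated \<open>m - 2\<close> carries no information:
  the first derivatives are constant.\<close>

lemma claplacian_low:
  assumes "hom_poly m p" "m < 2"
  shows "claplacian p = (\<lambda>z. 0)"
proof -
  have "hom_poly 0 (cderiv i p)" for i using hom_poly_cderiv[OF assms(1), of i] assms(2)
    by simp
  then have "cderiv i p = (\<lambda>z. cderiv i p 0)" for i
    using hom_poly_0_const by blast
  then have "cderiv i (cderiv i p) z = 0" for i z by (metis cderiv_const)
  then show ?thesis unfolding claplacian_def by simp
qed

lemma cderiv_diff:
  assumes "entire F" "entire G"
  shows "cderiv i (\<lambda>z. F z - G z) z = cderiv i F z - cderiv i G z"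
  using cderiv_add[OF assms(1), of "\<lambda>z. -1 * G z" i z] cderiv_cmult[OF assms(2), of i "-1" z]
    entire_mult[OF entire_const assms(2), of "-1"] by simp

text \<open>Green's identity: the Gaussian mean of a divergence \<open>div V\<close> is that of \<open>x \<bullet> V\<close>, and for
  \<open>V = g \<nabla>f - f \<nabla>g\<close> the latter vanishes by Euler's identity.\<close>

lemma sint_green:
  assumes f: "hom_poly m f" and g: "hom_poly m g"
  shows "sint (\<lambda>z. claplacian f z * g z) = sint (\<lambda>z. f z * claplacian g z)"
proof (cases "m < 2")
  case True
  then show ?thesis using claplacian_low[OF f] claplacian_low[OF g] by simp
next
  case False
  define V where "V = (\<lambda>i z. cderiv i f z * g z - f z * cderiv i g z)"
  have ent: "entire f" "entire g" "\<And>i. entire (cderiv i f)" "\<And>i. entire (cderiv i g)"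
    using f g by auto
  have V: "hom_poly (m - 1 + m) (V i)" for i
    unfolding V_def using hom_poly_mult[OF f hom_poly_cderiv[OF g]]
      hom_poly_mult[OF hom_poly_cderiv[OF f] g] by (intro hom_poly_diff) (simp_all add: add.commute)
  have dV: "cderiv i (V i) z = cderiv i (cderiv i f) z * g z - f z * cderiv i (cderiv i g) z" for i z
    unfolding V_def using ent by (simp add: cderiv_diff cderiv_mult entire_mult)
  let ?p = "\<lambda>z. claplacian f z * g z - f z * claplacian g z"
  have p_eq: "?p = (\<lambda>z. \<Sum>i\<in>UNIV. cderiv i (V i) z)"
    by (simp add: dV claplacian_def sum_subtractf sum_distrib_left sum_distrib_right)
  have "gint ?p = (\<Sum>i\<in>UNIV. gint (cderiv i (V i)))"
    unfolding p_eq by (rule gint_sum[OF hom_poly_cderiv[OF V]])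
  also have "\<dots> = (\<Sum>i\<in>UNIV. gint (\<lambda>z. z $ i * V i z))"
    using gint_cderiv[OF V] by simp
  also have "\<dots> = gint (\<lambda>z. \<Sum>i\<in>UNIV. z $ i * V i z)"
    by (rule gint_sum[OF hom_poly_mult[OF hom_poly_coord V], symmetric])
  also have "(\<lambda>z. \<Sum>i\<in>UNIV. z $ i * V i z) = (\<lambda>z. 0)"
  proof
    fix z
    have "(\<Sum>i\<in>UNIV. z $ i * V i z) = (\<Sum>i\<in>UNIV. z $ i * cderiv i f z) * g z - f z * (\<Sum>i\<in>UNIV. z $ i * cderiv i g z)"
      unfolding V_def by (simp add: right_diff_distrib sum_subtractf sum_distrib_left sum_distrib_right mult_ac)
    then show "(\<Sum>i\<in>UNIV. z $ i * V i z) = 0"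
      by (simp add: euler_hom_poly[OF f] euler_hom_poly[OF g])
  qed
  finally have "gint ?p = 0" by (simp add: gint_def)
  \<comment> \<open>Two factors of degree m and two derivatives: the degree is even, as
    \<open>sint_eq_0\<close> requires.\<close>
  moreover have "hom_poly (2 * (m - 1)) ?p"
    unfolding p_eq
    using hom_poly_sum[of UNIV "m - 1 + m - 1" "\<lambda>i. cderiv i (V i)", OF hom_poly_cderiv[OF V]] False
    by (simp add: mult_2)
  ultimately have "sint ?p = 0" by (intro sint_eq_0)
  moreover have "sint ?p = sint (\<lambda>z. claplacian f z * g z) - sint (\<lambda>z. f z * claplacian g z)"
    unfolding sint_def
    by (intro Bochner_Integration.integral_diff integrable_sphere continuous_on_entire_cvec
        hom_poly_entire[OF hom_poly_mult[OF hom_poly_claplacian[OF f] g]]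
        hom_poly_entire[OF hom_poly_mult[OF f hom_poly_claplacian[OF g]]])
  ultimately show ?thesis by simp
qed

subsection \<open>Orthogonality and polyharmonicity\<close>

lemma claplacian_lincomb:
  assumes "hom_poly m u" "hom_poly n v"
  shows "claplacian (\<lambda>z. u z - c * v z) z = claplacian u z - c * claplacian v z"
proof -
  have ent: "entire u" "entire v" "\<And>i. entire (cderiv i u)" "\<And>i. entire (cderiv i v)"
    using assms by auto
  have "cderiv i (\<lambda>z. u z - c * v z) = (\<lambda>z. cderiv i u z - c * cderiv i v z)" for i
    using ent by (intro ext) (simp add: cderiv_diff cderiv_cmult entire_mult)
  then show ?thesis unfolding claplacian_def
    using ent by (simp add: cderiv_diff cderiv_cmult entire_mult sum_subtractf sum_distrib_left)
qed

lemma cderiv_sum: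
  "(\<And>j. j \<in> A \<Longrightarrow> entire (F j)) \<Longrightarrow> cderiv i (\<lambda>z. \<Sum>j\<in>A. F j z) z = (\<Sum>j\<in>A. cderiv i (F j) z)"
  by (induction A rule: infinite_finite_induct) (simp_all add: cderiv_add entire_sum)

text \<open>Product rule: the mixed term is 4 times x \<bullet> \<nabla>s, which Euler's identity
  turns into 4 n s, and the Laplacian of |x|^2 is 2 d.\<close>

lemma claplacian_ssq_mult:
  assumes s: "hom_poly n (s :: complex ^ 'n::finite \<Rightarrow> complex)"
  shows "claplacian (\<lambda>z. ssq z * s z) z = ssq z * claplacian s z + of_nat (4 * n + 2 * CARD('n)) * s z"
proof -
  have ent: "entire s" "\<And>i. entire (cderiv i s)" "entire (ssq :: complex ^ 'n \<Rightarrow> complex)"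
    using s hom_poly_ssq by auto
  have dssq: "cderiv i ssq z = 2 * z $ i" for i and z :: "complex ^ 'n"
    unfolding ssq_def[abs_def]
    by (simp add: cderiv_sum entire_mult cderiv_mult cderiv_coord if_distrib sum.distrib cong: if_cong)
  have d1: "cderiv i (\<lambda>z. ssq z * s z) = (\<lambda>z. 2 * (z $ i * s z) + ssq z * cderiv i s z)" for i
    using ent by (intro ext) (simp add: cderiv_mult dssq)
  have e: "entire (\<lambda>z. 2 * (z $ i * s z))" "entire (\<lambda>z. ssq z * cderiv i s z)" "entire (\<lambda>z. z $ i * s z)" for i
    using ent by (auto intro!: entire_mult)
  have d2: "cderiv i (cderiv i (\<lambda>z. ssq z * s z)) z = 2 * s z + 4 * (z $ i * cderiv i s z) + ssq z * cderiv i (cderiv i s) z" for i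
    unfolding d1 using ent e
    by (simp add: cderiv_add cderiv_cmult cderiv_mult cderiv_coord dssq)
  have "claplacian (\<lambda>z. ssq z * s z) z = of_nat CARD('n) * (2 * s z) + 4 * (\<Sum>i\<in>UNIV. z $ i * cderiv i s z)
     + ssq z * claplacian s z"
    unfolding claplacian_def d2 by (simp add: sum.distrib sum_distrib_left)
  then show ?thesis by (simp add: euler_hom_poly[OF s] algebra_simps)
qed

text \<open>The order of the quantifiers matters: the constant depends on k, n and the dimension
  only, so that one recurrence holds for all polynomials of a given degree.\<close>

lemma claplacian_ssq_power:
  "\<exists>c0. \<forall>(s :: complex ^ 'n::finite \<Rightarrow> complex) z. hom_poly n s \<longrightarrow>
     ssq z * claplacian (\<lambda>z. ssq z ^ k * s z) z = ssq z ^ Suc k * claplacian s z + c0 * (ssq z ^ k * s z)"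
proof (induction k)
  case 0
  show ?case by (rule exI[of _ 0]) simp
next
  case (Suc k)
  then obtain c0 where "\<forall>s (z :: complex ^ 'n). hom_poly n s \<longrightarrow>
     ssq z * claplacian (\<lambda>z. ssq z ^ k * s z) z = ssq z ^ Suc k * claplacian s z + c0 * (ssq z ^ k * s z)"
    by (rule exE)
  note c0 = this[rule_format]
  show ?case
  proof (intro exI allI impI)
    fix s :: "complex ^ 'n \<Rightarrow> complex" and z assume s: "hom_poly n s"
    have u: "hom_poly (k * 2 + n) (\<lambda>z. ssq z ^ k * s z)"
      by (intro hom_poly_mult hom_poly_power hom_poly_ssq s)
    let ?c = "of_nat (4 * (k * 2 + n) + 2 * CARD('n)) :: complex"
    have "ssq z * claplacian (\<lambda>z. ssq z ^ Suc k * s z) z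
       = ssq z * (ssq z * claplacian (\<lambda>z. ssq z ^ k * s z) z + ?c * (ssq z ^ k * s z))"
      using claplacian_ssq_mult[OF u, of z] by (simp add: mult.assoc)
    also have "\<dots> = ssq z * (ssq z ^ Suc k * claplacian s z + c0 * (ssq z ^ k * s z) + ?c * (ssq z ^ k * s z))"
      unfolding c0[OF s] ..
    also have "\<dots> = ssq z ^ Suc (Suc k) * claplacian s z + (c0 + ?c) * (ssq z ^ Suc k * s z)"
      by (simp add: algebra_simps)
    finally show "ssq z * claplacian (\<lambda>z. ssq z ^ Suc k * s z) z
       = ssq z ^ Suc (Suc k) * claplacian s z + (c0 + ?c) * (ssq z ^ Suc k * s z)" .
  qed
qed

lemma claplacian_pow_low:
  assumes "hom_poly m p" "m < 2 * k"
  shows "(claplacian ^^ k) p = (\<lambda>z. 0)"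
  using assms(2)
proof (induction k)
  case (Suc k)
  show ?case
  proof (cases "m < 2 * k")
    case True
    then show ?thesis using Suc claplacian_low[of 0 "\<lambda>z. 0"] by simp
  next
    case False
    then show ?thesis
      using claplacian_low[OF hom_poly_claplacian_pow[OF assms(1), of k]] Suc by simp
  qed
qed simp

text \<open>The factor \<open>ssq\<close> restores the degree lost by the Laplacian and equals 1 on
  the unit sphere. The operator therefore acts on homogeneous polynomials of a fixed degree and has
  there the same spherical integrals as the Laplacian.\<close>

definition ssq_lap :: "(complex ^ 'n::finite \<Rightarrow> complex) \<Rightarrow> complex ^ 'n \<Rightarrow> complex" where
  "ssq_lap f = (\<lambda>z. ssq z * claplacian f z)"

definition ssq_lap_pow :: "nat \<Rightarrow> (complex ^ 'n::finite \<Rightarrow> complex) \<Rightarrow> complex ^ 'n \<Rightarrow> complex" where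
  "ssq_lap_pow k f = (\<lambda>z. ssq z ^ k * (claplacian ^^ k) f z)"

lemma hom_poly_ssq_lap_pow [intro]:
  assumes "hom_poly m f"
  shows "hom_poly m (ssq_lap_pow k f)"
proof (cases "m < 2 * k")
  case True
  then show ?thesis by (simp add: ssq_lap_pow_def claplacian_pow_low[OF assms])
next
  case False
  then have "m = k * 2 + (m - 2 * k)" by simp
  then show ?thesis unfolding ssq_lap_pow_def
    by (metis hom_poly_mult hom_poly_power hom_poly_ssq hom_poly_claplacian_pow assms)
qed

lemma ssq_lap_pow_1: "ssq_lap_pow 1 f = ssq_lap f"
  by (simp add: ssq_lap_pow_def ssq_lap_def)

lemma hom_poly_ssq_lap [intro]: "hom_poly m f \<Longrightarrow> hom_poly m (ssq_lap f)"
  by (metis ssq_lap_pow_1 hom_poly_ssq_lap_pow)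

text \<open>On homogeneous polynomials of fixed degree, \<open>ssq\<^sup>k \<Delta>\<^sup>k\<close> is a polynomial in \<open>ssq \<Delta>\<close>.\<close>

lemma ssq_lap_pow_Suc:
  "\<exists>c0. \<forall>f :: complex ^ 'n::finite \<Rightarrow> complex. hom_poly m f \<longrightarrow>
     ssq_lap_pow (Suc k) f = (\<lambda>z. ssq_lap (ssq_lap_pow k f) z - c0 * ssq_lap_pow k f z)"
proof -
  obtain c0 where "\<forall>s (z :: complex ^ 'n). hom_poly (m - 2 * k) s \<longrightarrow>
     ssq z * claplacian (\<lambda>z. ssq z ^ k * s z) z = ssq z ^ Suc k * claplacian s z + c0 * (ssq z ^ k * s z)"
    by (rule exE[OF claplacian_ssq_power])
  note c0 = this[rule_format]
  show ?thesis
    by (intro exI[of _ c0] allI impI ext)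
       (simp add: ssq_lap_pow_def ssq_lap_def c0[OF hom_poly_claplacian_pow])
qed

lemma ssq_lap_lincomb:
  assumes "hom_poly m u" "hom_poly m v"
  shows "ssq_lap (\<lambda>z. u z - c * v z) = (\<lambda>z. ssq_lap u z - c * ssq_lap v z)"
  unfolding ssq_lap_def by (simp add: claplacian_lincomb[OF assms] algebra_simps)

text \<open>Polynomials in one operator commute with it; the induction applies the same recurrence,
  with the same \<open>c0\<close>, to \<open>g\<close> and to \<open>ssq_lap g\<close>.\<close>

lemma ssq_lap_pow_commute:
  fixes g :: "complex ^ 'n::finite \<Rightarrow> complex"
  assumes "hom_poly m g"
  shows "ssq_lap_pow k (ssq_lap g) = ssq_lap (ssq_lap_pow k g)"
proof (induction k)
  case 0
  show ?case by (simp add: ssq_lap_pow_def)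
next
  case (Suc k)
  obtain c0 where "\<forall>f :: complex ^ 'n \<Rightarrow> complex. hom_poly m f \<longrightarrow>
     ssq_lap_pow (Suc k) f = (\<lambda>z. ssq_lap (ssq_lap_pow k f) z - c0 * ssq_lap_pow k f z)"
    by (rule exE[OF ssq_lap_pow_Suc])
  note c0 = this[rule_format]
  have "ssq_lap (ssq_lap_pow (Suc k) g) = (\<lambda>z. ssq_lap (ssq_lap (ssq_lap_pow k g)) z - c0 * ssq_lap (ssq_lap_pow k g) z)"
    unfolding c0[OF assms] by (rule ssq_lap_lincomb) (use assms in auto)
  then show ?case unfolding c0[OF hom_poly_ssq_lap[OF assms]] Suc by simp
qed

lemma sint_cong: "(\<And>\<theta>. norm \<theta> = 1 \<Longrightarrow> p (cvec \<theta>) = q (cvec \<theta>)) \<Longrightarrow> sint p = sint q"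
  unfolding sint_def by (intro Bochner_Integration.integral_cong) auto

lemma sint_lincomb:
  assumes "hom_poly m u" "hom_poly n v"
  shows "sint (\<lambda>z. u z - c * v z) = sint u - c * sint v"
  unfolding sint_def
  using assms by (subst Bochner_Integration.integral_diff)
    (auto intro!: integrable_sphere continuous_on_entire_cvec hom_poly_entire continuous_intros)

lemma sint_ssq_lap:
  assumes "hom_poly m f" "hom_poly m g"
  shows "sint (\<lambda>z. ssq_lap f z * g z) = sint (\<lambda>z. f z * ssq_lap g z)"
proof -
  have "sint (\<lambda>z. ssq_lap f z * g z) = sint (\<lambda>z. claplacian f z * g z)"
    by (rule sint_cong) (simp add: ssq_lap_def ssq_cvec)
  also have "\<dots> = sint (\<lambda>z. f z * claplacian g z)" by (rule sint_green[OF assms])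
  also have "\<dots> = sint (\<lambda>z. f z * ssq_lap g z)"
    by (rule sint_cong) (simp add: ssq_lap_def ssq_cvec)
  finally show ?thesis .
qed

text \<open>A polynomial in a symmetric operator is symmetric. The induction leaves \<open>g\<close>
  arbitrary because its hypothesis is also applied to \<open>ssq_lap g\<close>.\<close>

lemma sint_ssq_lap_pow:
  fixes f g :: "complex ^ 'n::finite \<Rightarrow> complex"
  assumes "hom_poly m f" "hom_poly m g"
  shows "sint (\<lambda>z. ssq_lap_pow k f z * g z) = sint (\<lambda>z. f z * ssq_lap_pow k g z)"
  using assms(2)
proof (induction k arbitrary: g)
  case 0
  show ?case by (simp add: ssq_lap_pow_def)
next
  case (Suc k)
  note f = assms(1) and g = Suc.prems
  obtain c0 where "\<forall>f :: complex ^ 'n \<Rightarrow> complex. hom_poly m f \<longrightarrow>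
     ssq_lap_pow (Suc k) f = (\<lambda>z. ssq_lap (ssq_lap_pow k f) z - c0 * ssq_lap_pow k f z)"
    by (rule exE[OF ssq_lap_pow_Suc])
  note c0 = this[rule_format]
  have "sint (\<lambda>z. ssq_lap_pow (Suc k) f z * g z)
     = sint (\<lambda>z. ssq_lap (ssq_lap_pow k f) z * g z - c0 * (ssq_lap_pow k f z * g z))"
    unfolding c0[OF f] by (simp add: left_diff_distrib mult.assoc)
  also have "\<dots> = sint (\<lambda>z. ssq_lap (ssq_lap_pow k f) z * g z) - c0 * sint (\<lambda>z. ssq_lap_pow k f z * g z)"
    by (rule sint_lincomb[OF hom_poly_mult hom_poly_mult]) (use f g in auto)
  also have "sint (\<lambda>z. ssq_lap (ssq_lap_pow k f) z * g z) = sint (\<lambda>z. ssq_lap_pow k f z * ssq_lap g z)"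
    by (rule sint_ssq_lap) (use f g in auto)
  also have "\<dots> = sint (\<lambda>z. f z * ssq_lap (ssq_lap_pow k g) z)"
    using Suc.IH[OF hom_poly_ssq_lap[OF g]] by (simp add: ssq_lap_pow_commute[OF g])
  also have "sint (\<lambda>z. ssq_lap_pow k f z * g z) = sint (\<lambda>z. f z * ssq_lap_pow k g z)"
    by (rule Suc.IH[OF g])
  also have "sint (\<lambda>z. f z * ssq_lap (ssq_lap_pow k g) z) - c0 * sint (\<lambda>z. f z * ssq_lap_pow k g z)
     = sint (\<lambda>z. f z * ssq_lap (ssq_lap_pow k g) z - c0 * (f z * ssq_lap_pow k g z))"
    by (rule sint_lincomb[OF hom_poly_mult hom_poly_mult, symmetric]) (use f g in auto)
  also have "\<dots> = sint (\<lambda>z. f z * ssq_lap_pow (Suc k) g z)"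
    unfolding c0[OF g] by (simp add: right_diff_distrib mult_ac)
  finally show ?case .
qed

lemma sphere_inner_sint: "sphere_inner f g = sint (\<lambda>z. f z * cnj (g (vcnj z)))"
  by (simp add: sphere_inner_def sint_def)

lemma snorm_eq_0_imp_zero:
  fixes q :: "complex ^ 'n::finite \<Rightarrow> complex"
  assumes "hom_poly n q" "snorm q = 0"
  shows "q = (\<lambda>z. 0)"
proof
  fix z
  obtain K B where "\<And>n q (z :: complex ^ 'n). hom_poly n q \<Longrightarrow> cmod (q z) \<le> K * B ^ n * norm z ^ n * snorm q"
    using hom_poly_snorm_bound by metis
  from this[OF assms(1), of z] show "q z = 0" by (simp add: assms(2))
qed

text \<open>By symmetry, u = |x|^(2k) \<Delta>^k r has squared norm equal to the inner product of r
  with |x|^(2k) \<Delta>^k u. On the sphere the latter is \<Delta>^k u, an admissible test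
  polynomial of degree m - 2k, so u vanishes.\<close>

lemma orthogonal_imp_polyharmonic:
  assumes r: "hom_poly m r" and orth: "\<And>g. hom_poly (m - 2 * k) g \<Longrightarrow> sphere_inner r g = 0"
  shows "(claplacian ^^ k) r = (\<lambda>z. 0)"
proof -
  define u where "u = ssq_lap_pow k r"
  define u' where "u' = (\<lambda>z. cnj (u (vcnj z)))"
  define v where "v = (claplacian ^^ k) u'"
  have u: "hom_poly m u" using r by (auto simp: u_def)
  have u': "hom_poly m u'" unfolding u'_def by (rule hom_poly_cnj[OF u])
  have v: "hom_poly (m - 2 * k) v" unfolding v_def by (rule hom_poly_claplacian_pow[OF u'])
  have "complex_of_real (snorm2 u) = sint (\<lambda>z. u z * u' z)"
    unfolding sphere_inner_self[symmetric] sphere_inner_sint u'_def ..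
  also have "\<dots> = sint (\<lambda>z. r z * ssq_lap_pow k u' z)"
    unfolding u_def by (rule sint_ssq_lap_pow[OF r u'])
  also have "\<dots> = sint (\<lambda>z. r z * v z)"
    by (rule sint_cong) (simp add: ssq_lap_pow_def ssq_cvec v_def)
  also have "\<dots> = sphere_inner r (\<lambda>z. cnj (v (vcnj z)))"
    unfolding sphere_inner_sint by (simp add: vcnj_def)
  also have "\<dots> = 0" by (rule orth[OF hom_poly_cnj[OF v]])
  finally have "snorm u = 0" by (simp add: snorm_def)
  have *: "hom_poly (m - 2 * k) ((claplacian ^^ k) r)" by (rule hom_poly_claplacian_pow[OF r])
  \<comment> \<open>On the sphere \<open>ssq\<close> is 1, so u and \<Delta>^k r have the same
    values there.\<close>
  have "snorm ((claplacian ^^ k) r) \<le> 1 * snorm u"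
    by (rule snorm2_mono) (use * u in \<open>auto simp: u_def ssq_lap_pow_def ssq_cvec\<close>)
  then have "snorm ((claplacian ^^ k) r) = 0"
    using \<open>snorm u = 0\<close> snorm_nonneg[of "(claplacian ^^ k) r"] by linarith
  then show ?thesis by (rule snorm_eq_0_imp_zero[OF *])
qed

subsection \<open>Weak solutions on homogeneous polynomials\<close>

lemma sum_fun_apply: "(\<Sum>i\<in>A. f i) x = (\<Sum>i\<in>A. f i x)" for f :: "'i \<Rightarrow> 'b \<Rightarrow> complex"
  by (induction A rule: infinite_finite_induct) auto

text \<open>An injective endomorphism of a finite-dimensional space is onto. The vectors are
  functions on the whole type \<open>'i\<close>, so the dimension count takes place in the span of
  the unit vectors indexed by \<open>A\<close>.\<close>

lemma square_system_solvable:
  fixes M :: "'i \<Rightarrow> 'i \<Rightarrow> complex"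
  assumes A: "finite A"
    and inj: "\<And>c. (\<And>a. a \<in> A \<Longrightarrow> (\<Sum>b\<in>A. M a b * c b) = 0) \<Longrightarrow> \<forall>b\<in>A. c b = 0"
  shows "\<exists>c. \<forall>a\<in>A. (\<Sum>b\<in>A. M a b * c b) = y a"
proof -
  define scl where "scl = (\<lambda>c (f :: 'i \<Rightarrow> complex) a. c * f a)"
  interpret V: vector_space scl
    by unfold_locales (auto simp: scl_def fun_eq_iff algebra_simps)
  \<comment> \<open>Acting as the identity outside \<open>A\<close> keeps the map injective on the
    full function space.\<close>
  define T where "T = (\<lambda>c a. if a \<in> A then (\<Sum>b\<in>A. M a b * c b) else c a)"
  interpret T: Vector_Spaces.linear scl scl T
    by unfold_locales
       (auto simp: T_def scl_def fun_eq_iff algebra_simps sum.distrib sum_distrib_left)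
  have injT: "inj T"
  proof (subst T.inj_iff_eq_0, intro allI impI)
    fix c assume "T c = 0"
    then have *: "T c a = 0" for a by simp
    have "c a = 0" for a
    proof (cases "a \<in> A")
      case True
      then show ?thesis using inj[of c] * unfolding T_def by (metis (mono_tags, lifting))
    next
      case False
      then show ?thesis using *[of a] by (simp add: T_def)
    qed
    then show "c = 0" by (simp add: fun_eq_iff)
  qed
  define e where "e = (\<lambda>(b :: 'i) a. if a = b then 1 else 0 :: complex)"
  define E where "E = e ` A"
  have inje: "inj e" by (rule injI) (metis e_def zero_neq_one)
  have E: "finite E" "card E = card A"
    using A card_image[OF inj_on_subset[OF inje]] by (auto simp: E_def)
  have expand: "(\<Sum>b\<in>A. scl (g b) (e b)) = (\<lambda>a. if a \<in> A then g a else 0)" for g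
    using A by (auto simp: scl_def e_def fun_eq_iff sum_fun_apply if_distrib cong: if_cong)
  have inspan: "g \<in> V.span E" if "\<And>a. a \<notin> A \<Longrightarrow> g a = 0" for g
  proof -
    have "g = (\<Sum>b\<in>A. scl (g b) (e b))" using that unfolding expand by auto
    also have "\<dots> \<in> V.span E"
      by (intro V.span_sum V.span_scale V.span_base) (auto simp: E_def)
    finally show ?thesis .
  qed
  have indE: "V.independent E"
  proof (rule V.independent_if_scalars_zero[OF E(1)])
    fix u x assume *: "(\<Sum>x\<in>E. scl (u x) x) = 0" and x: "x \<in> E"
    then obtain a where a: "a \<in> A" "x = e a" by (auto simp: E_def)
    have "(\<Sum>x\<in>E. scl (u x) x) = (\<Sum>b\<in>A. scl (u (e b)) (e b))"
      unfolding E_def by (rule sum.reindex[OF inj_on_subset[OF inje], unfolded o_def]) simp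
    then have "(\<Sum>b\<in>A. scl (u (e b)) (e b)) a = 0" using * by simp
    then show "u x = 0" using a by (simp add: expand)
  qed
  have indTE: "V.independent (T ` E)"
    by (rule T.independent_injective_image[OF indE]) (rule inj_on_subset[OF injT], simp)
  have TE: "T ` E \<subseteq> V.span E"
  proof
    fix x assume "x \<in> T ` E"
    then obtain b where b: "b \<in> A" "x = T (e b)" by (auto simp: E_def)
    show "x \<in> V.span E" by (rule inspan) (use b in \<open>auto simp: T_def e_def\<close>)
  qed
  define g where "g = (\<lambda>a. if a \<in> A then y a else 0)"
  have g: "g \<in> V.span E" by (rule inspan) (simp add: g_def)
  have cardT: "card (T ` E) = card E" "finite (T ` E)"
    using E card_image[OF inj_on_subset[OF injT subset_UNIV]] by simp_all
  \<comment> \<open>The images of the unit vectors are card A independent vectors in a span of that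
    dimension; an element outside their span would be one too many.\<close>
  have "g \<in> V.span (T ` E)"
  proof (rule ccontr)
    assume ng: "g \<notin> V.span (T ` E)"
    then have "V.independent (insert g (T ` E))" using indTE by (simp add: V.independent_insert)
    moreover have "insert g (T ` E) \<subseteq> V.span E" using g TE by simp
    ultimately have "finite (insert g (T ` E)) \<and> card (insert g (T ` E)) \<le> card E"
      by (rule V.independent_span_bound[OF E(1)])
    moreover have "g \<notin> T ` E" using ng V.span_base[of g "T ` E"] by argo
    ultimately show False using cardT by simp
  qed
  then obtain c where "g = T c" by (auto simp: T.span_image)
  then show ?thesis by (intro exI[of _ c] ballI) (metis T_def g_def)
qed

lemma integrable_sphere_prod:
  "entire F \<Longrightarrow> entire G \<Longrightarrow> integrable sphere_measure (\<lambda>\<theta>. F (cvec \<theta>) * cnj (G (cvec \<theta>)))"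
  by (intro integrable_sphere continuous_intros continuous_on_entire_cvec)

lemma sphere_inner_diff_left:
  assumes "entire F" "entire G" "entire H"
  shows "sphere_inner (\<lambda>z. F z - G z) H = sphere_inner F H - sphere_inner G H"
  unfolding sphere_inner_def left_diff_distrib
  by (rule Bochner_Integration.integral_diff) (intro integrable_sphere_prod assms)+

lemma sphere_inner_sum_left:
  assumes "\<And>i. i \<in> A \<Longrightarrow> entire (F i)" "entire H"
  shows "sphere_inner (\<lambda>z. \<Sum>i\<in>A. c i * F i z) H = (\<Sum>i\<in>A. c i * sphere_inner (F i) H)"
proof -
  have "sphere_inner (\<lambda>z. \<Sum>i\<in>A. c i * F i z) H
      = (LINT \<theta>|sphere_measure. (\<Sum>i\<in>A. c i * (F i (cvec \<theta>) * cnj (H (cvec \<theta>)))))"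
    unfolding sphere_inner_def by (simp add: sum_distrib_right mult.assoc)
  also have "\<dots> = (\<Sum>i\<in>A. LINT \<theta>|sphere_measure. c i * (F i (cvec \<theta>) * cnj (H (cvec \<theta>))))"
    by (rule Bochner_Integration.integral_sum) (intro integrable_mult_right integrable_sphere_prod assms)
  finally show ?thesis by (simp add: sphere_inner_def)
qed

lemma sphere_inner_sum_right:
  assumes "\<And>i. i \<in> A \<Longrightarrow> entire (F i)" "entire H"
  shows "sphere_inner H (\<lambda>z. \<Sum>i\<in>A. c i * F i z) = (\<Sum>i\<in>A. cnj (c i) * sphere_inner H (F i))"
proof -
  have "sphere_inner H (\<lambda>z. \<Sum>i\<in>A. c i * F i z)
      = (LINT \<theta>|sphere_measure. (\<Sum>i\<in>A. cnj (c i) * (H (cvec \<theta>) * cnj (F i (cvec \<theta>)))))"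
    unfolding sphere_inner_def by (simp add: sum_distrib_left mult_ac)
  also have "\<dots> = (\<Sum>i\<in>A. LINT \<theta>|sphere_measure. cnj (c i) * (H (cvec \<theta>) * cnj (F i (cvec \<theta>))))"
    by (rule Bochner_Integration.integral_sum) (intro integrable_mult_right integrable_sphere_prod assms)
  finally show ?thesis by (simp add: sphere_inner_def)
qed

text \<open>A maximal independent set of homogeneous polynomials gives unique coefficients, which
  the solvability argument needs; it is finite because the finitely many monomials span.\<close>

lemma hom_poly_basis:
  obtains B where "finite B" "\<And>b. b \<in> B \<Longrightarrow> hom_poly n b"
    "\<And>q :: complex ^ 'n \<Rightarrow> complex. hom_poly n q \<Longrightarrow> \<exists>c. q = (\<lambda>z. \<Sum>b\<in>B. c b * b z)"
    "\<And>c. \<forall>z :: complex ^ 'n::finite. (\<Sum>b\<in>B. c b * b z) = 0 \<Longrightarrow> \<forall>b\<in>B. c b = 0"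
proof -
  define scl where "scl = (\<lambda>c (f :: complex ^ 'n \<Rightarrow> complex) z. c * f z)"
  interpret V: vector_space scl
    by unfold_locales (auto simp: scl_def fun_eq_iff algebra_simps)
  let ?H = "{q :: complex ^ 'n \<Rightarrow> complex. hom_poly n q}"
  let ?E = "mon ` {a :: 'n \<Rightarrow> nat. sum a UNIV = n}"
  obtain B where B: "B \<subseteq> ?H" "V.independent B" "?H \<subseteq> V.span B"
    by (rule V.basis_exists[of ?H])
  have "?H \<subseteq> V.span ?E"
  proof
    fix q assume "q \<in> ?H"
    then obtain c where c: "q = (\<lambda>z. \<Sum>a | sum a UNIV = n. c a * mon a z)"
      unfolding hom_poly_iff by blast
    have "q = (\<Sum>a | sum a UNIV = n. scl (c a) (mon a))"
      by (simp add: c scl_def fun_eq_iff sum_fun_apply)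
    also have "\<dots> \<in> V.span ?E"
      by (intro V.span_sum V.span_scale V.span_base) auto
    finally show "q \<in> V.span ?E" .
  qed
  then have "B \<subseteq> V.span ?E" using B(1) by (rule order_trans[rotated])
  then have fin: "finite B"
    using V.independent_span_bound[OF finite_imageI[OF finite_multi_index] B(2)] by blast
  show ?thesis
  proof (rule that)
    show "finite B" by (rule fin)
    show "\<And>b. b \<in> B \<Longrightarrow> hom_poly n b" using B by blast
    fix q :: "complex ^ 'n \<Rightarrow> complex" assume "hom_poly n q"
    then have "q \<in> V.span B" using B by blast
    then obtain c where "q = (\<Sum>b\<in>B. scl (c b) b)" unfolding V.span_finite[OF fin] by blast
    then show "\<exists>c. q = (\<lambda>z. \<Sum>b\<in>B. c b * b z)"
      by (intro exI[of _ c]) (simp add: scl_def fun_eq_iff sum_fun_apply)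
  next
    fix c assume "\<forall>z :: complex ^ 'n. (\<Sum>b\<in>B. c b * b z) = 0"
    then have "(\<Sum>b\<in>B. scl (c b) b) = 0"
      by (simp add: scl_def fun_eq_iff sum_fun_apply)
    then show "\<forall>b\<in>B. c b = 0" using V.independentD[OF B(2) fin order_refl] by blast
  qed
qed

text \<open>Lax-Milgram in finite dimension: in a basis the equation is a square system with matrix
  \<open>?M\<close>, and coercivity forces its kernel to be trivial.\<close>

lemma weak_solution:
  fixes P F :: "complex ^ 'n::finite \<Rightarrow> complex"
  assumes P: "entire P" and F: "entire F" and \<kappa>: "\<kappa> > 0"
    and pos: "\<And>g. hom_poly n g \<Longrightarrow> Re (sphere_inner (\<lambda>z. P z * g z) g) \<ge> \<kappa> * snorm2 g"
  shows "\<exists>q. hom_poly n q \<and> (\<forall>g. hom_poly n g \<longrightarrow> sphere_inner (\<lambda>z. F z - P z * q z) g = 0)"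
proof -
  obtain B where B: "finite B" "\<And>b. b \<in> B \<Longrightarrow> hom_poly n b"
    "\<And>q. hom_poly n q \<Longrightarrow> \<exists>c. q = (\<lambda>z. \<Sum>b\<in>B. c b * b z)"
    "\<And>c. \<forall>z :: complex ^ 'n. (\<Sum>b\<in>B. c b * b z) = 0 \<Longrightarrow> \<forall>b\<in>B. c b = 0"
    using hom_poly_basis[where n = n and thesis = thesis] by blast
  have hq: "hom_poly n (\<lambda>z. \<Sum>b\<in>B. c b * b z)" for c by (intro hom_poly_sum hom_poly_cmult B(2))
  have entB: "entire b" if "b \<in> B" for b using B(2)[OF that] by auto
  let ?M = "\<lambda>a b. sphere_inner (\<lambda>z. P z * b z) a"
  have M: "(\<Sum>b\<in>B. ?M a b * c b) = sphere_inner (\<lambda>z. P z * (\<Sum>b\<in>B. c b * b z)) a" if "a \<in> B" for a c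
  proof -
    have "(\<lambda>z. P z * (\<Sum>b\<in>B. c b * b z)) = (\<lambda>z. \<Sum>b\<in>B. c b * (P z * b z))"
      by (simp add: sum_distrib_left mult_ac)
    then show ?thesis using that P entB
      by (simp add: sphere_inner_sum_left entire_mult mult.commute)
  qed
  have test: "sphere_inner G g = 0" if G: "entire G" "\<And>a. a \<in> B \<Longrightarrow> sphere_inner G a = 0" and g: "hom_poly n g" for G g
  proof -
    obtain c where "g = (\<lambda>z. \<Sum>b\<in>B. c b * b z)" using B(3)[OF g] by blast
    then show ?thesis using G entB by (simp add: sphere_inner_sum_right)
  qed
  have "\<exists>c. \<forall>a\<in>B. (\<Sum>b\<in>B. ?M a b * c b) = sphere_inner F a"
  proof (rule square_system_solvable[OF B(1)])
    fix c assume *: "\<And>a. a \<in> B \<Longrightarrow> (\<Sum>b\<in>B. ?M a b * c b) = 0"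
    define q where "q = (\<lambda>z. \<Sum>b\<in>B. c b * b z)"
    have q: "hom_poly n q" unfolding q_def by (rule hq)
    have "sphere_inner (\<lambda>z. P z * q z) q = 0"
      by (rule test) (use * M P q in \<open>auto simp: q_def\<close>)
    then have "\<kappa> * snorm2 q \<le> 0" using pos[OF q] by simp
    then have "snorm q = 0" using \<kappa> snorm2_nonneg[of q]
      by (simp add: snorm_def mult_le_0_iff)
    then have "q = (\<lambda>z. 0)" by (rule snorm_eq_0_imp_zero[OF q])
    then show "\<forall>b\<in>B. c b = 0" by (intro B(4)) (simp add: q_def fun_eq_iff)
  qed
  then obtain c where c: "\<And>a. a \<in> B \<Longrightarrow> (\<Sum>b\<in>B. ?M a b * c b) = sphere_inner F a" by blast
  define q where "q = (\<lambda>z. \<Sum>b\<in>B. c b * b z)"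
  have q: "hom_poly n q" unfolding q_def by (rule hq)
  have "sphere_inner (\<lambda>z. F z - P z * q z) g = 0" if "hom_poly n g" for g
  proof (rule test[OF _ _ that])
    show "entire (\<lambda>z. F z - P z * q z)" by (intro entire_diff entire_mult F P hom_poly_entire[OF q])
    fix a assume a: "a \<in> B"
    have "sphere_inner (\<lambda>z. F z - P z * q z) a = sphere_inner F a - sphere_inner (\<lambda>z. P z * q z) a"
      by (rule sphere_inner_diff_left) (use F P q entB a in auto)
    also have "\<dots> = 0" using c[OF a] M[OF a] by (simp add: q_def)
    finally show "sphere_inner (\<lambda>z. F z - P z * q z) a = 0" .
  qed
  then show ?thesis using q by blast
qed

lemma fischer_decomposition:
  fixes P f :: "complex ^ 'n::finite \<Rightarrow> complex"
  assumes P: "hom_poly (2 * k) P" and f: "hom_poly m f" and m: "2 * k \<le> m" and \<kappa>: "\<kappa> > 0"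
    and pos: "\<And>g. hom_poly (m - 2 * k) g \<Longrightarrow> Re (sphere_inner (\<lambda>z. P z * g z) g) \<ge> \<kappa> * snorm2 g"
  shows "\<exists>q. hom_poly (m - 2 * k) q \<and> hom_poly m (\<lambda>z. f z - P z * q z) \<and>
     (claplacian ^^ k) (\<lambda>z. f z - P z * q z) = (\<lambda>z. 0) \<and> snorm q \<le> snorm f / \<kappa>"
proof -
  obtain q where q: "hom_poly (m - 2 * k) q"
    and orth: "\<And>g. hom_poly (m - 2 * k) g \<Longrightarrow> sphere_inner (\<lambda>z. f z - P z * q z) g = 0"
    using weak_solution[OF hom_poly_entire[OF P] hom_poly_entire[OF f] \<kappa> pos] by blast
  have r: "hom_poly m (\<lambda>z. f z - P z * q z)"
    using hom_poly_diff[OF f, of "\<lambda>z. P z * q z"] hom_poly_mult[OF P q] m by simp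
  have ent: "entire f" "entire P" "entire q" using f P q by auto
  have "0 = sphere_inner f q - sphere_inner (\<lambda>z. P z * q z) q"
    using orth[OF q] sphere_inner_diff_left[of f "\<lambda>z. P z * q z" q] ent by auto
  then have "Re (sphere_inner (\<lambda>z. P z * q z) q) = Re (sphere_inner f q)" by simp
  \<comment> \<open>With weight \<kappa> in \<open>sphere_inner_le\<close>, half of the left side
    absorbs the last term, leaving
    \<open>snorm2 q \<le> snorm2 f / \<kappa>\<^sup>2\<close>.\<close>
  then have "\<kappa> * snorm2 q \<le> snorm2 f / (2 * \<kappa>) + \<kappa> * snorm2 q / 2"
    using pos[OF q] sphere_inner_le[OF ent(1,3) \<kappa>] by linarith
  then have "snorm2 q \<le> snorm2 f / \<kappa>\<^sup>2"
    using \<kappa> by (simp add: field_simps power2_eq_square)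
  then have "(snorm q)\<^sup>2 \<le> (snorm f / \<kappa>)\<^sup>2" by (simp add: snorm_sq power_divide)
  then have "snorm q \<le> snorm f / \<kappa>"
    by (rule power2_le_imp_le) (use \<kappa> in simp)
  then show ?thesis using q r orthogonal_imp_polyharmonic[OF r orth] by blast
qed

section \<open>Inhomogeneous polynomials and iterated Laplacians\<close>

text \<open>Needed because the lower-order terms mix degrees: the quotient and remainder of a single
  homogeneous component are no longer homogeneous.\<close>

inductive poly_fun :: "(complex ^ 'n::finite \<Rightarrow> complex) \<Rightarrow> bool" where
  hom: "hom_poly m p \<Longrightarrow> poly_fun p"
| add: "poly_fun p \<Longrightarrow> poly_fun q \<Longrightarrow> poly_fun (\<lambda>z. p z + q z)"

lemma poly_fun_sum: "(\<And>i. i \<in> A \<Longrightarrow> poly_fun (p i)) \<Longrightarrow> poly_fun (\<lambda>z. \<Sum>i\<in>A. p i z)"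
  by (induction A rule: infinite_finite_induct)
     (auto intro: poly_fun.add poly_fun.hom[OF hom_poly_zero[of 0]])

lemma poly_fun_entire: "poly_fun p \<Longrightarrow> entire p"
  by (induction rule: poly_fun.induct) auto

lemma poly_fun_cderiv: "poly_fun p \<Longrightarrow> poly_fun (cderiv i p)"
proof (induction rule: poly_fun.induct)
  case (hom m p)
  then show ?case using poly_fun.hom by blast
next
  case (add p q)
  then have "cderiv i (\<lambda>z. p z + q z) = (\<lambda>z. cderiv i p z + cderiv i q z)"
    by (auto simp: cderiv_add poly_fun_entire)
  then show ?case using add poly_fun.add by simp
qed

lemma poly_fun_claplacian: "poly_fun p \<Longrightarrow> poly_fun (claplacian p)"
  unfolding claplacian_def[abs_def] by (intro poly_fun_sum poly_fun_cderiv)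

lemma poly_fun_claplacian_pow: "poly_fun p \<Longrightarrow> poly_fun ((claplacian ^^ k) p)"
  by (induction k) (auto intro: poly_fun_claplacian)

lemma claplacian_add:
  assumes "poly_fun u" "poly_fun v"
  shows "claplacian (\<lambda>z. u z + v z) = (\<lambda>z. claplacian u z + claplacian v z)"
proof -
  have ent: "entire u" "entire v" "\<And>i. entire (cderiv i u)" "\<And>i. entire (cderiv i v)"
    using assms by (auto intro: poly_fun_entire poly_fun_cderiv)
  have "cderiv i (\<lambda>z. u z + v z) = (\<lambda>z. cderiv i u z + cderiv i v z)" for i
    using ent by (intro ext) (simp add: cderiv_add)
  then show ?thesis unfolding claplacian_def
    using ent by (simp add: cderiv_add sum.distrib)
qed

lemma claplacian_pow_add:
  assumes "poly_fun u" "poly_fun v"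
  shows "(claplacian ^^ k) (\<lambda>z. u z + v z) = (\<lambda>z. (claplacian ^^ k) u z + (claplacian ^^ k) v z)"
  by (induction k) (use assms in \<open>auto simp: claplacian_add poly_fun_claplacian_pow\<close>)

lemma claplacian_pow_zero: "(claplacian ^^ k) (\<lambda>z. 0) = (\<lambda>z. 0)"
  by (induction k) (simp_all add: claplacian_low[OF hom_poly_zero[of 0]])

lemma claplacian_pow_sum:
  assumes "finite A" "\<And>i. i \<in> A \<Longrightarrow> poly_fun (p i)"
  shows "(claplacian ^^ k) (\<lambda>z. \<Sum>i\<in>A. p i z) = (\<lambda>z. \<Sum>i\<in>A. (claplacian ^^ k) (p i) z)"
  using assms by (induction A rule: finite_induct) (simp_all add: claplacian_pow_zero claplacian_pow_add poly_fun_sum)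

subsection \<open>Decomposition with lower-order perturbation\<close>

lemma perturbed_decomposition:
  fixes P :: "nat \<Rightarrow> complex ^ 'n::finite \<Rightarrow> complex" and A :: "nat \<Rightarrow> real"
  assumes P2k: "hom_poly (2 * k) (P (2 * k))" and \<beta>: "\<beta> < 2 * k"
    and Pj: "\<And>j. j \<le> \<beta> \<Longrightarrow> hom_poly j (P j)"
    and KB: "K \<ge> 0" "B \<ge> 0" "\<And>n q z. hom_poly n q \<Longrightarrow>
       cmod (q (z :: complex ^ 'n)) \<le> K * B ^ n * norm z ^ n * snorm q"
    and A: "\<And>j. A j \<ge> 0" "\<And>j \<theta>. j \<le> \<beta> \<Longrightarrow> norm \<theta> = 1 \<Longrightarrow> cmod (P j (cvec \<theta>)) \<le> A j"
    and H: "H > 0" "\<And>n g. n \<le> N \<Longrightarrow> hom_poly n g \<Longrightarrow>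
       Re (sphere_inner (\<lambda>z. P (2 * k) z * g z) g) \<ge> 1 / H * snorm2 g"
    and L: "L \<ge> 1" "L ^ (2 * k - \<beta>) \<ge> (1 + (\<Sum>j\<le>\<beta>. A j)) * H"
  shows "hom_poly m f \<Longrightarrow> m \<le> N \<Longrightarrow> \<exists>Q R. poly_fun Q \<and> poly_fun R \<and>
     (\<forall>z. f z = (P (2 * k) z - (\<Sum>j\<le>\<beta>. P j z)) * Q z + R z) \<and> (claplacian ^^ k) R = (\<lambda>z. 0) \<and>
     (\<forall>z. cmod (Q z) \<le> K * snorm f * (\<Sum>n\<le>m. L ^ (m - n) * (B * norm z) ^ n)) \<and> (m < 2 * k \<longrightarrow> Q = (\<lambda>z. 0))"
proof (induction m arbitrary: f rule: less_induct)
  case (less m)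
  note f = less.prems(1)
  show ?case
  proof (cases "m < 2 * k")
    case True
    then show ?thesis
      using KB L f claplacian_pow_low[OF f True]
      by (intro exI[of _ "\<lambda>z. 0"] exI[of _ f])
         (auto intro: poly_fun.hom f hom_poly_zero[of 0] intro!: mult_nonneg_nonneg sum_nonneg)
  next
    case False
    then have m: "2 * k \<le> m" by simp
    have H1: "1 / H > 0" using H(1) by simp
    have "m - 2 * k \<le> N" using less.prems(2) by simp
    note dec = fischer_decomposition[OF P2k f m H1 H(2)[OF this]]
    obtain q where q: "hom_poly (m - 2 * k) q" and r: "hom_poly m (\<lambda>z. f z - P (2 * k) z * q z)"
      and lap: "(claplacian ^^ k) (\<lambda>z. f z - P (2 * k) z * q z) = (\<lambda>z. 0)"
      and nq: "snorm q \<le> snorm f / (1 / H)"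
      using dec by blast
    have nq: "snorm q \<le> H * snorm f" using nq by (simp add: mult.commute)
    define F where "F = (\<lambda>j z. P j z * q z)"
    have F: "hom_poly (j + (m - 2 * k)) (F j)" if "j \<le> \<beta>" for j
      unfolding F_def by (rule hom_poly_mult[OF Pj[OF that] q])
    define good where "good = (\<lambda>j Q R. poly_fun Q \<and> poly_fun R \<and>
      (\<forall>z. F j z = (P (2 * k) z - (\<Sum>j\<le>\<beta>. P j z)) * Q z + R z) \<and> (claplacian ^^ k) R = (\<lambda>z. 0) \<and>
      (\<forall>z. cmod (Q z) \<le> K * snorm (F j) * (\<Sum>n\<le>j + (m - 2 * k). L ^ (j + (m - 2 * k) - n) * (B * norm z) ^ n)))"
    have "\<exists>Q R. good j Q R" if "j \<le> \<beta>" for j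
    proof -
      have "j + (m - 2 * k) < m" "j + (m - 2 * k) \<le> N" using that \<beta> m less.prems(2) by auto
      from less.IH[OF this(1) F[OF that] this(2)] show ?thesis unfolding good_def by blast
    qed
    then obtain Q R where good: "\<And>j. j \<le> \<beta> \<Longrightarrow> good j (Q j) (R j)" by metis
    note QR = good[unfolded good_def, THEN conjunct1] good[unfolded good_def, THEN conjunct2, THEN conjunct1]
      good[unfolded good_def, THEN conjunct2, THEN conjunct2, THEN conjunct1, rule_format]
      good[unfolded good_def, THEN conjunct2, THEN conjunct2, THEN conjunct2, THEN conjunct1]
      good[unfolded good_def, THEN conjunct2, THEN conjunct2, THEN conjunct2, THEN conjunct2, rule_format]
    define Q' where "Q' = (\<lambda>z. q z + (\<Sum>j\<le>\<beta>. Q j z))"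
    define R' where "R' = (\<lambda>z. (f z - P (2 * k) z * q z) + (\<Sum>j\<le>\<beta>. R j z))"
    have "poly_fun Q'" unfolding Q'_def
      by (intro poly_fun.add poly_fun_sum poly_fun.hom[OF q] QR) simp
    moreover have "poly_fun R'" unfolding R'_def
      by (intro poly_fun.add[OF poly_fun.hom[OF r]] poly_fun_sum QR) simp
    moreover have "f z = (P (2 * k) z - (\<Sum>j\<le>\<beta>. P j z)) * Q' z + R' z" for z
    proof -
      \<comment> \<open>What the perturbation takes away from \<open>P (2 * k) * q\<close> is
        restored by the recursive decompositions of the \<open>F j\<close>.\<close>
      have "(\<Sum>j\<le>\<beta>. P j z) * q z = (\<Sum>j\<le>\<beta>. F j z)" by (simp add: F_def sum_distrib_right)
      also have "\<dots> = (P (2 * k) z - (\<Sum>j\<le>\<beta>. P j z)) * (\<Sum>j\<le>\<beta>. Q j z) + (\<Sum>j\<le>\<beta>. R j z)"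
        using QR(3)[of _ z] by (simp add: sum.distrib sum_distrib_left)
      finally show ?thesis by (simp add: Q'_def R'_def algebra_simps)
    qed
    moreover have "(claplacian ^^ k) R' = (\<lambda>z. 0)"
    proof -
      have "(claplacian ^^ k) R' = (\<lambda>z. (claplacian ^^ k) (\<lambda>z. f z - P (2 * k) z * q z) z + (claplacian ^^ k) (\<lambda>z. \<Sum>j\<le>\<beta>. R j z) z)"
        unfolding R'_def by (rule claplacian_pow_add[OF poly_fun.hom[OF r] poly_fun_sum]) (simp add: QR)
      also have "\<dots> = (\<lambda>z. 0)"
      proof -
        have "(claplacian ^^ k) (\<lambda>z. \<Sum>j\<le>\<beta>. R j z) = (\<lambda>z. \<Sum>j\<le>\<beta>. (claplacian ^^ k) (R j) z)"
          by (rule claplacian_pow_sum) (simp_all add: QR(2))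
        then show ?thesis unfolding lap by (simp add: QR(4))
      qed
      finally show ?thesis .
    qed
    moreover have "cmod (Q' z) \<le> K * snorm f * (\<Sum>n\<le>m. L ^ (m - n) * (B * norm z) ^ n)" for z
    proof -
      define \<delta> where "\<delta> = 2 * k - \<beta>"
      define x where "x = B * norm z"
      define T where "T = (\<Sum>n\<le>m. L ^ (m - n) * x ^ n)"
      have x: "x \<ge> 0" using KB by (simp add: x_def)
      have "L > 0" using L by simp
      have T: "T \<ge> 0" unfolding T_def using \<open>L > 0\<close> x by (intro sum_nonneg) simp
      \<comment> \<open>The summand of \<open>T\<close> at n = m - 2k has weight L^(2k), which is at
        least L^\<delta>.\<close>
      have b1: "x ^ (m - 2 * k) * L ^ \<delta> \<le> T"
      proof -
        have "x ^ (m - 2 * k) * L ^ \<delta> \<le> x ^ (m - 2 * k) * L ^ (2 * k)"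
          using L x by (intro mult_left_mono power_increasing) (auto simp: \<delta>_def)
        also have "\<dots> = L ^ (m - (m - 2 * k)) * x ^ (m - 2 * k)" using m by simp
        also have "\<dots> \<le> T" unfolding T_def using \<open>L > 0\<close> x
          by (intro member_le_sum[of "m - 2 * k" "{..m}" "\<lambda>n. L ^ (m - n) * x ^ n"]) auto
        finally show ?thesis .
      qed
      \<comment> \<open>Since j \<le> \<beta>, each exponent j + (m - 2k) - n + \<delta> is at most
        m - n: the saved degrees pay for the factor L^\<delta>.\<close>
      have b2: "(\<Sum>n\<le>j + (m - 2 * k). L ^ (j + (m - 2 * k) - n) * x ^ n) * L ^ \<delta> \<le> T" if j: "j \<le> \<beta>" for j
      proof -
        have "(\<Sum>n\<le>j + (m - 2 * k). L ^ (j + (m - 2 * k) - n) * x ^ n) * L ^ \<delta>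
            = (\<Sum>n\<le>j + (m - 2 * k). L ^ (j + (m - 2 * k) - n + \<delta>) * x ^ n)"
          unfolding sum_distrib_right by (intro sum.cong refl) (simp only: power_add mult_ac)
        also have "\<dots> \<le> (\<Sum>n\<le>j + (m - 2 * k). L ^ (m - n) * x ^ n)"
          using L x j m \<beta> by (intro sum_mono mult_right_mono power_increasing) (auto simp: \<delta>_def)
        also have "\<dots> \<le> T" unfolding T_def
          using \<open>L > 0\<close> x j m \<beta> by (intro sum_mono2) auto
        finally show ?thesis .
      qed
      have c1: "cmod (q z) \<le> K * (H * snorm f) * (T / L ^ \<delta>)"
      proof -
        have "cmod (q z) \<le> K * snorm q * x ^ (m - 2 * k)"
          using KB(3)[OF q, of z] by (simp add: x_def power_mult_distrib mult_ac)
        also have "\<dots> \<le> K * (H * snorm f) * (T / L ^ \<delta>)"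
          using b1 KB nq x T \<open>L > 0\<close> H by (intro mult_mono) (auto simp: field_simps)
        finally show ?thesis .
      qed
      have c2: "cmod (Q j z) \<le> A j * (K * (H * snorm f) * (T / L ^ \<delta>))" if j: "j \<le> \<beta>" for j
      proof -
        have "snorm (F j) \<le> A j * snorm q"
        proof (rule snorm2_mono)
          show "entire (F j)" "entire q" using F[OF j] q by auto
          show "cmod (F j (cvec \<theta>)) \<le> A j * cmod (q (cvec \<theta>))" if "norm \<theta> = 1" for \<theta>
            unfolding F_def norm_mult using A(2)[OF j that] by (intro mult_right_mono) auto
        qed (rule A(1))
        also have "\<dots> \<le> A j * (H * snorm f)" using nq A(1) by (intro mult_left_mono)
        finally have "snorm (F j) \<le> A j * (H * snorm f)" .
        moreover have "(\<Sum>n\<le>j + (m - 2 * k). L ^ (j + (m - 2 * k) - n) * x ^ n) \<le> T / L ^ \<delta>"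
          using b2[OF j] \<open>L > 0\<close> by (simp add: field_simps)
        ultimately have "K * snorm (F j) * (\<Sum>n\<le>j + (m - 2 * k). L ^ (j + (m - 2 * k) - n) * x ^ n)
           \<le> K * (A j * (H * snorm f)) * (T / L ^ \<delta>)"
          using KB(1) A(1) H(1) x \<open>L > 0\<close> by (intro mult_mono mult_left_mono) (auto intro!: sum_nonneg mult_nonneg_nonneg)
        then show ?thesis using QR(5)[OF j, of z] by (simp add: x_def mult_ac)
      qed
      have "cmod (Q' z) \<le> cmod (q z) + (\<Sum>j\<le>\<beta>. cmod (Q j z))"
        unfolding Q'_def by (rule order_trans[OF norm_triangle_ineq add_left_mono[OF norm_sum]])
      also have "\<dots> \<le> K * (H * snorm f) * (T / L ^ \<delta>) + (\<Sum>j\<le>\<beta>. A j * (K * (H * snorm f) * (T / L ^ \<delta>)))"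
        using c1 c2 by (intro add_mono sum_mono) auto
      also have "\<dots> = (1 + (\<Sum>j\<le>\<beta>. A j)) * H / L ^ \<delta> * (K * snorm f * T)"
        unfolding sum_distrib_right[symmetric] by (simp add: algebra_simps add_divide_distrib)
      \<comment> \<open>The assumption on \<open>L\<close> says exactly that the collected constant
        is at most 1, so the bound reproduces itself.\<close>
      also have "\<dots> \<le> 1 * (K * snorm f * T)"
        using L(2) \<open>L > 0\<close> KB(1) T by (intro mult_right_mono) (auto simp: \<delta>_def field_simps)
      finally show ?thesis by (simp add: T_def x_def)
    qed
    ultimately show ?thesis using False by blast
  qed
qed

subsection \<open>Homogeneous expansion of entire functions\<close>

text \<open>The homogeneous component is read off on complex rays, so expansion and Cauchy estimates
  come from one variable. That it is a polynomial in z is proved separately.\<close>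

definition taylor :: "nat \<Rightarrow> (complex ^ 'n::finite \<Rightarrow> complex) \<Rightarrow> complex ^ 'n \<Rightarrow> complex" where
  "taylor n F z = (deriv ^^ n) (\<lambda>t. F (t *s z)) 0 / fact n"

lemma taylor_sums:
  assumes "entire F"
  shows "(\<lambda>n. taylor n F z * t ^ n) sums F (t *s z)"
  using holomorphic_power_series[OF entire_ray_holomorphic[OF assms, of z], of t 0 "cmod t + 1"]
  by (simp add: taylor_def)

lemma taylor_cauchy:
  assumes "entire F" "r > 0" "\<And>t. cmod t = r \<Longrightarrow> cmod (F (t *s z)) \<le> M"
  shows "cmod (taylor n F z) \<le> M / r ^ n"
proof -
  have "cmod ((deriv ^^ n) (\<lambda>t. F (t *s z)) 0) \<le> fact n * M / r ^ n"
    using assms(2,3)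
    by (intro Cauchy_inequality holomorphic_on_imp_continuous_on entire_ray_holomorphic[OF assms(1)]) auto
  then show ?thesis by (simp add: taylor_def norm_divide field_simps)
qed

lemma taylor_scale:
  assumes "entire F"
  shows "taylor n F (t *s z) = t ^ n * taylor n F z"
proof -
  have "(deriv ^^ n) (\<lambda>s. F ((t * s) *s z)) 0 = t ^ n * (deriv ^^ n) (\<lambda>s. F (s *s z)) (t * 0)"
    by (rule higher_deriv_compose_linear[OF entire_ray_holomorphic[OF assms], of UNIV UNIV]) auto
  moreover have "(\<lambda>s. F ((t * s) *s z)) = (\<lambda>s. F (s *s (t *s z)))"
    by (simp add: mult.commute)
  ultimately show ?thesis by (simp add: taylor_def)
qed

lemma entire_bounded_cball:
  assumes "entire F"
  obtains M where "M \<ge> 0" "\<And>z. norm z \<le> R \<Longrightarrow> cmod (F z) \<le> M"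
proof -
  have "bounded (F ` cball 0 R)"
    by (intro compact_imp_bounded compact_continuous_image entire_continuous[OF assms]) auto
  then obtain M where "\<forall>z\<in>cball 0 R. cmod (F z) \<le> M" unfolding bounded_iff by auto
  then have "\<And>z. norm z \<le> R \<Longrightarrow> cmod (F z) \<le> M" by simp
  then show ?thesis using that[of "max M 0"] by (meson max.cobounded2 max.coboundedI1)
qed

text \<open>The \<open>n\<close>-th component is the locally uniform limit, as \<open>t \<rightarrow> 0\<close>, of
  \<open>(F(tz) - \<Sum>j<n. t^j F_j(z)) / t^n\<close>.\<close>

lemma taylor_line_holomorphic:
  assumes F: "entire F"
  shows "(\<lambda>t. taylor n F (z + t *s w)) holomorphic_on UNIV"
proof (induction n rule: less_induct)
  case (less n)
  \<comment> \<open>The offset 2 keeps every \<open>\<tau> N\<close> nonzero and at most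
    1/2.\<close>
  define \<tau> where "\<tau> = (\<lambda>N. complex_of_real (1 / (real N + 2)))"
  have \<tau>: "\<tau> N \<noteq> 0" "cmod (\<tau> N) = 1 / (real N + 2)" for N
    unfolding \<tau>_def of_real_eq_0_iff norm_of_real by simp_all
  define G where "G = (\<lambda>N t. (F (\<tau> N *s (z + t *s w)) - (\<Sum>j<n. taylor j F (z + t *s w) * \<tau> N ^ j)) / \<tau> N ^ n)"
  show ?case
  proof (rule holomorphic_uniform_sequence[where f = G])
    fix N
    have "(\<lambda>t. F (\<tau> N *s (z + t *s w))) = (\<lambda>t. F (\<tau> N *s z + t *s (\<tau> N *s w)))"
      by (simp add: vector_add_ldistrib mult.commute)
    then have "(\<lambda>t. F (\<tau> N *s (z + t *s w))) holomorphic_on UNIV"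
      using entire_line_holomorphic[OF F] by metis
    then show "G N holomorphic_on UNIV"
      unfolding G_def using less \<tau> by (intro holomorphic_intros) auto
  next
    fix t0 :: complex
    define R where "R = norm z + (cmod t0 + 1) * norm w"
    obtain M where M: "M \<ge> 0" "\<And>u. norm u \<le> R \<Longrightarrow> cmod (F u) \<le> M"
      using entire_bounded_cball[OF F, of R] by blast
    \<comment> \<open>The error is the tail beyond degree n divided by \<tau>^n. Each of its terms
      contains a further factor \<tau>, the coefficients are bounded by M, and \<tau> \<le> 1/2
      makes the tail geometric.\<close>
    have est: "cmod (G N t - taylor n F (z + t *s w)) \<le> 2 * M / (real N + 2)" if t: "t \<in> cball t0 1" for N t
    proof -
      define u where "u = z + t *s w"
      have "cmod t \<le> cmod t0 + 1" using t norm_triangle_sub[of t t0] by (simp add: dist_norm norm_minus_commute)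
      then have u: "norm u \<le> R" unfolding u_def R_def
        by (intro order_trans[OF norm_triangle_ineq]) (auto intro!: mult_right_mono)
      have tb: "cmod (taylor j F u) \<le> M" for j
        using taylor_cauchy[OF F, of 1 u M j] M u by simp
      have s: "(\<lambda>j. taylor j F u * \<tau> N ^ j) sums F (\<tau> N *s u)" by (rule taylor_sums[OF F])
      let ?r = "F (\<tau> N *s u) - (\<Sum>j<Suc n. taylor j F u * \<tau> N ^ j)"
      have s2: "(\<lambda>j. taylor (j + Suc n) F u * \<tau> N ^ (j + Suc n)) sums ?r"
        using s sums_iff_shift[of "\<lambda>j. taylor j F u * \<tau> N ^ j" "Suc n"] by simp
      have "(\<lambda>j. taylor (j + Suc n) F u * \<tau> N ^ (j + Suc n) / \<tau> N ^ n) sums (?r / \<tau> N ^ n)"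
        by (rule sums_divide[OF s2])
      moreover have "?r / \<tau> N ^ n = G N t - taylor n F u"
      proof -
        have "G N t = (F (\<tau> N *s u) - (\<Sum>j<n. taylor j F u * \<tau> N ^ j)) / \<tau> N ^ n"
          by (simp only: G_def u_def)
        then show ?thesis using \<tau>(1)[of N] by (simp add: diff_divide_distrib add_divide_distrib)
      qed
      moreover have "taylor (j + Suc n) F u * \<tau> N ^ (j + Suc n) / \<tau> N ^ n = taylor (j + Suc n) F u * \<tau> N ^ Suc j" for j
        using \<tau>(1)[of N] by (simp add: power_add)
      ultimately have s3: "(\<lambda>j. taylor (j + Suc n) F u * \<tau> N ^ Suc j) sums (G N t - taylor n F u)" by simp
      have g: "(\<lambda>j. M / (real N + 2) * (1 / 2) ^ j) sums (M / (real N + 2) * 2)"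
        by (intro sums_mult geometric_sums[of "1 / 2 :: real", simplified])
      have "cmod (G N t - taylor n F u) \<le> M / (real N + 2) * 2"
      proof (rule norm_sums_le[OF s3 g])
        fix j
        have "cmod (taylor (j + Suc n) F u * \<tau> N ^ Suc j) = cmod (taylor (j + Suc n) F u) * (1 / (real N + 2)) * (1 / (real N + 2)) ^ j"
          by (simp add: norm_mult norm_power \<tau>)
        also have "\<dots> \<le> M * (1 / (real N + 2)) * (1 / 2) ^ j"
          using tb M(1) by (intro mult_mono power_mono) (auto simp: frac_le)
        finally show "cmod (taylor (j + Suc n) F u * \<tau> N ^ Suc j) \<le> M / (real N + 2) * (1 / 2) ^ j" by simp
      qed
      then show ?thesis by (simp add: u_def mult.commute)
    qed
    have "uniform_limit (cball t0 1) G (\<lambda>t. taylor n F (z + t *s w)) sequentially"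
    proof (rule uniform_limitI)
      fix e :: real assume e: "e > 0"
      have "(\<lambda>N. 2 * M / (real N + 2)) \<longlonglongrightarrow> 0" by real_asymp
      then have "\<forall>\<^sub>F N in sequentially. 2 * M / (real N + 2) < e"
        using e by (rule order_tendstoD)
      then show "\<forall>\<^sub>F N in sequentially. \<forall>t\<in>cball t0 1. dist (G N t) (taylor n F (z + t *s w)) < e"
        by eventually_elim (unfold dist_norm, use est in \<open>blast intro: le_less_trans\<close>)
    qed
    then show "\<exists>d>0. cball t0 d \<subseteq> UNIV \<and> uniform_limit (cball t0 d) G (\<lambda>t. taylor n F (z + t *s w)) sequentially"
      by (intro exI[of _ 1]) simp
  qed simp
qed

text \<open>Writing z + t w = t (z / t + w), homogeneity gives growth at most |t|^n for |t| \<ge> 1,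
  so Liouville's theorem applies to the entire function of t.\<close>

lemma taylor_line_poly:
  assumes F: "entire F"
  shows "\<exists>p. degree p \<le> n \<and> (\<forall>t. taylor n F (z + t *s w) = poly p t)"
proof -
  obtain M where M: "M \<ge> 0" "\<And>u. norm u \<le> norm z + norm w \<Longrightarrow> cmod (F u) \<le> M"
    using entire_bounded_cball[OF F, of "norm z + norm w"] by blast
  have bound: "cmod (taylor n F (z + t *s w)) \<le> M * cmod t ^ n" if t: "1 \<le> cmod t" for t
  proof -
    have t0: "t \<noteq> 0" using t by auto
    define u where "u = inverse t *s z + w"
    have tu: "z + t *s w = t *s u" using t0 by (simp add: u_def vec_eq_iff field_simps)
    have "inverse (cmod t) \<le> 1" using t by (simp add: inverse_le_1_iff)
    then have "inverse (cmod t) * norm z \<le> norm z" by (simp add: mult_left_le_one_le)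
    then have "norm u \<le> norm z + norm w"
      unfolding u_def by (intro order_trans[OF norm_triangle_ineq]) (simp add: norm_inverse)
    then have "cmod (taylor n F u) \<le> M" using taylor_cauchy[OF F, of 1 u M n] M by simp
    then show ?thesis
      unfolding tu taylor_scale[OF F] norm_mult norm_power 
      by (metis mult.commute mult_left_mono norm_ge_zero zero_le_power)
  qed
  define c where "c = (\<lambda>k. (deriv ^^ k) (\<lambda>t. taylor n F (z + t *s w)) 0 / fact k)"
  define p where "p = (\<Sum>k\<le>n. monom (c k) k)"
  have "degree p \<le> n" unfolding p_def
    by (intro degree_sum_le) (auto intro: order_trans[OF degree_monom_le])
  moreover have "taylor n F (z + t *s w) = poly p t" for t
    using Liouville_polynomial[OF taylor_line_holomorphic[OF F] bound, where \<xi> = t]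
    by (simp add: p_def poly_sum poly_monom c_def)
  ultimately show ?thesis by blast
qed

section \<open>The Taylor components are homogeneous polynomials\<close>

lemma poly_fun_mult:
  assumes "poly_fun p" "poly_fun q"
  shows "poly_fun (\<lambda>z. p z * q z)"
  using assms(1)
proof (induction rule: poly_fun.induct)
  case (hom m p)
  note p = hom
  show ?case using assms(2)
  proof (induction rule: poly_fun.induct)
    case (hom n q)
    then show ?case by (rule poly_fun.hom[OF hom_poly_mult[OF p]])
  next
    case (add q1 q2)
    then show ?case using poly_fun.add[OF add(3,4)] by (simp add: distrib_left)
  qed
next
  case (add p1 p2)
  then show ?case using poly_fun.add[OF add(3,4)] by (simp add: distrib_right)
qed

lemma poly_fun_const: "poly_fun (\<lambda>z. c)"
  by (rule poly_fun.hom[OF hom_poly_const])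

lemma poly_fun_prod: "(\<And>i. i \<in> A \<Longrightarrow> poly_fun (p i)) \<Longrightarrow> poly_fun (\<lambda>z. \<Prod>i\<in>A. p i z)"
  by (induction A rule: infinite_finite_induct) (auto intro: poly_fun_const poly_fun_mult)

lemma poly_fun_affine: "poly_fun (\<lambda>z. a * z $ i + b)"
  by (intro poly_fun.add[OF poly_fun.hom[OF hom_poly_cmult[OF hom_poly_coord]]] poly_fun_const)

text \<open>Interpolation in one variable expresses g through functions of the remaining variables,
  so the induction runs over the set \<open>S\<close> of variables on which g depends. The uniform
  degree bound allows the same nodes for all values of the other variables.\<close>

lemma separately_poly_imp_poly_fun:
  fixes g :: "complex ^ 'n::finite \<Rightarrow> complex"
  assumes "finite S"
    and "\<And>z i. \<exists>p. degree p \<le> N \<and> (\<forall>t. g (z + t *s axis i 1) = poly p t)"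
    and "\<And>z z'. (\<And>i. i \<in> S \<Longrightarrow> z $ i = z' $ i) \<Longrightarrow> g z = g z'"
  shows "poly_fun g"
  using assms
proof (induction S arbitrary: g rule: finite_induct)
  case empty
  have "g = (\<lambda>z. g 0)" using empty(2) by blast
  then show ?case using poly_fun_const by metis
next
  case (insert i S)
  define upd where "upd = (\<lambda>(z :: complex ^ 'n) c. \<chi> l. if l = i then c else z $ l)"
  \<comment> \<open>Freezing the i-th variable at the node j removes i from the relevant variables
    and leaves the degree bound in the others intact.\<close>
  define gj where "gj = (\<lambda>j z. g (upd z (of_nat j)))"
  have gj: "poly_fun (gj j)" for j
  proof (rule insert.IH)
    fix z l
    show "\<exists>p. degree p \<le> N \<and> (\<forall>t. gj j (z + t *s axis l 1) = poly p t)"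
    proof (cases "l = i")
      case True
      have "upd (z + t *s axis l 1) c = upd z c" for t c
        by (simp add: upd_def vec_eq_iff axis_def True)
      then show ?thesis unfolding gj_def
        by (intro exI[of _ "[:g (upd z (of_nat j)):]"]) simp
    next
      case False
      have "upd (z + t *s axis l 1) c = upd z c + t *s axis l 1" for t c
        using False by (simp add: upd_def vec_eq_iff axis_def)
      then show ?thesis unfolding gj_def using insert.prems(1) by simp
    qed
  next
    fix z z' :: "complex ^ 'n" assume "\<And>i. i \<in> S \<Longrightarrow> z $ i = z' $ i"
    then show "gj j z = gj j z'"
      unfolding gj_def by (intro insert.prems(2)) (auto simp: upd_def)
  qed
  let ?w = "\<lambda>(j :: nat) z. \<Prod>l\<in>{..N} - {j}. (1 / (of_nat j - of_nat l)) * z $ i + (- of_nat l / (of_nat j - of_nat l))"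
  have "g z = (\<Sum>j\<le>N. gj j z * ?w j z)" for z
  proof -
    obtain p where p: "degree p \<le> N" "\<And>t. g (upd z 0 + t *s axis i 1) = poly p t"
      using insert.prems(1) by blast
    have u: "upd z 0 + t *s axis i 1 = upd z t" for t
      by (simp add: upd_def vec_eq_iff axis_def)
    have "upd z (z $ i) = z" by (simp add: upd_def vec_eq_iff)
    then have "g z = poly p (z $ i)" using p(2)[of "z $ i"] unfolding u by simp
    also have "\<dots> = (\<Sum>j\<le>N. poly p (of_nat j) * (\<Prod>l\<in>{..N} - {j}. (z $ i - of_nat l) / (of_nat j - of_nat l)))"
      by (rule lagrange_interpolation[OF p(1)])
    also have "\<dots> = (\<Sum>j\<le>N. gj j z * ?w j z)"
      unfolding gj_def p(2)[symmetric] u by (simp add: diff_divide_distrib)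
    finally show ?thesis .
  qed
  then have "g = (\<lambda>z. \<Sum>j\<le>N. gj j z * ?w j z)"
    by blast
  moreover have "poly_fun \<dots>"
    by (intro poly_fun_sum poly_fun_mult gj poly_fun_prod poly_fun_affine)
  ultimately show ?case by simp
qed

lemma poly_fun_components:
  assumes "poly_fun p"
  shows "\<exists>M h. (\<forall>n. hom_poly n (h n)) \<and> (\<forall>z. p z = (\<Sum>n\<le>M. h n z))"
  using assms
proof (induction rule: poly_fun.induct)
  case (hom m p)
  then show ?case
    by (intro exI[of _ m] exI[of _ "\<lambda>n. if n = m then p else (\<lambda>z. 0)"] conjI allI)
      (simp, simp add: if_distribR)
next
  case (add p q)
  then obtain M h M' h' where h: "\<And>n. hom_poly n (h n)" "\<And>z. p z = (\<Sum>n\<le>M. h n z)"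
    "\<And>n. hom_poly n (h' n)" "\<And>z. q z = (\<Sum>n\<le>M'. h' n z)" by blast
  have e: "(\<Sum>n\<le>L. f n) = (\<Sum>n\<le>M + M'. if n \<le> L then f n else 0)" if "L \<le> M + M'" for f :: "nat \<Rightarrow> complex" and L
    using that by (intro sum.mono_neutral_cong_left) auto
  have "p z + q z = (\<Sum>n\<le>M + M'. (if n \<le> M then h n z else 0) + (if n \<le> M' then h' n z else 0))" for z
    unfolding h(2,4) sum.distrib by (subst (1 2) e) auto
  moreover have "hom_poly n (\<lambda>z. (if n \<le> M then h n z else 0) + (if n \<le> M' then h' n z else 0))" for n
    using h(1)[of n] h(3)[of n] by (intro hom_poly_add; cases "n \<le> M"; cases "n \<le> M'") simp_all
  ultimately show ?case
    by (intro exI[of _ "M + M'"] exI[of _ "\<lambda>n z. (if n \<le> M then h n z else 0) + (if n \<le> M' then h' n z else 0)"]) auto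
qed

text \<open>As polynomials in t, g(t z) = t^n g(z) and the sum of the t^m h_m(z) have equal
  coefficients, so g is its own n-th component.\<close>

lemma poly_fun_homogeneous:
  assumes g: "poly_fun g" and hom: "\<And>t z. g (t *s z) = t ^ n * g z"
  shows "hom_poly n g"
proof -
  obtain M h where h: "\<And>n. hom_poly n (h n)" "\<And>z. g z = (\<Sum>n\<le>M. h n z)"
    using poly_fun_components[OF g] by blast
  have "g z = (if n \<le> M then h n z else 0)" for z
  proof -
    define a where "a = (\<lambda>m. if m \<le> M then h m z else 0)"
    define b where "b = (\<lambda>m. if m = n then g z else 0)"
    \<comment> \<open>Both sides are padded to degree M + n because n may exceed M.\<close>
    have "(\<Sum>m\<le>M + n. a m * t ^ m) = (\<Sum>m\<le>M + n. b m * t ^ m)" for t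
    proof -
      have "(\<Sum>m\<le>M + n. a m * t ^ m) = (\<Sum>m\<le>M. t ^ m * h m z)"
        unfolding a_def by (rule sum.mono_neutral_cong_right) auto
      also have "\<dots> = g (t *s z)" unfolding h(2) hom_poly_scale[OF h(1)] ..
      also have "\<dots> = (\<Sum>m\<le>M + n. b m * t ^ m)"
        unfolding hom b_def by (simp add: if_distrib if_distribR mult.commute cong: if_cong)
      finally show ?thesis .
    qed
    then have "a n = b n" using polyfun_eq_coeffs[of a "M + n" b] by auto
    then show ?thesis by (simp add: a_def b_def)
  qed
  then have "g = (if n \<le> M then h n else (\<lambda>z. 0))" by auto
  then show ?thesis using h(1) by (metis hom_poly_zero)
qed

lemma hom_poly_taylor:
  assumes "entire F"
  shows "hom_poly n (taylor n F)"
proof (rule poly_fun_homogeneous)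
  show "poly_fun (taylor n F)"
    by (rule separately_poly_imp_poly_fun[of UNIV n]) (auto intro: taylor_line_poly[OF assms] arg_cong[where f = "taylor n F"] simp: vec_eq_iff)
qed (rule taylor_scale[OF assms])

subsection \<open>Normally convergent series\<close>

text \<open>A summable majorant on each ball is stable under sums, multiplication by an entire
  function and, by Cauchy's inequality, differentiation; this permits termwise Laplacians of any
  order.\<close>

definition normal_series :: "(nat \<Rightarrow> complex ^ 'n::finite \<Rightarrow> complex) \<Rightarrow> bool" where
  "normal_series Q \<longleftrightarrow> (\<forall>R. \<exists>b. summable b \<and> (\<forall>m z. norm z \<le> R \<longrightarrow> cmod (Q m z) \<le> b m))"

lemma normal_seriesE:
  assumes "normal_series Q"
  obtains b where "summable b" "\<forall>m z. norm z \<le> R \<longrightarrow> cmod (Q m z) \<le> b m"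
proof -
  have "\<exists>b. summable b \<and> (\<forall>m z. norm z \<le> R \<longrightarrow> cmod (Q m z) \<le> b m)"
    using assms unfolding normal_series_def by (rule spec)
  then show ?thesis using that by (elim exE conjE)
qed

lemma normal_series_summable:
  assumes "normal_series Q"
  shows "summable (\<lambda>m. Q m z)"
proof -
  obtain b where "summable b" "\<forall>m u. norm u \<le> norm z \<longrightarrow> cmod (Q m u) \<le> b m"
    by (rule normal_seriesE[OF assms])
  then have "summable b" "\<And>m. m \<ge> 0 \<Longrightarrow> norm (Q m z) \<le> b m" by simp_all
  then show ?thesis by (rule summable_comparison_test')
qed

lemma normal_series_add:
  assumes "normal_series Q" "normal_series Q'"
  shows "normal_series (\<lambda>m z. Q m z + Q' m z)"
  unfolding normal_series_def
proof
  fix R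
  obtain b where "summable b" "\<forall>m z. norm z \<le> R \<longrightarrow> cmod (Q m z) \<le> b m"
    by (rule normal_seriesE[OF assms(1)])
  moreover obtain b' where "summable b'" "\<forall>m z. norm z \<le> R \<longrightarrow> cmod (Q' m z) \<le> b' m"
    by (rule normal_seriesE[OF assms(2)])
  ultimately show "\<exists>b. summable b \<and> (\<forall>m z. norm z \<le> R \<longrightarrow> cmod (Q m z + Q' m z) \<le> b m)"
    by (intro exI[of _ "\<lambda>m. b m + b' m"]) (auto intro!: summable_add order_trans[OF norm_triangle_ineq] add_mono)
qed

lemma normal_series_zero: "normal_series (\<lambda>m z. 0)"
  unfolding normal_series_def by (auto intro: exI[of _ "\<lambda>_. 0"])

lemma normal_series_sum:
  "(\<And>i. i \<in> A \<Longrightarrow> normal_series (Q i)) \<Longrightarrow> normal_series (\<lambda>m z. \<Sum>i\<in>A. Q i m z)"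
  by (induction A rule: infinite_finite_induct) (auto intro: normal_series_zero normal_series_add)

lemma normal_series_mult:
  assumes "entire F" "normal_series Q"
  shows "normal_series (\<lambda>m z. F z * Q m z)"
  unfolding normal_series_def
proof
  fix R
  obtain b where b: "summable b" "\<forall>m z. norm z \<le> R \<longrightarrow> cmod (Q m z) \<le> b m"
    by (rule normal_seriesE[OF assms(2)])
  obtain M where M: "M \<ge> 0" "\<And>z. norm z \<le> R \<Longrightarrow> cmod (F z) \<le> M"
    using entire_bounded_cball[OF assms(1)] by blast
  show "\<exists>b. summable b \<and> (\<forall>m z. norm z \<le> R \<longrightarrow> cmod (F z * Q m z) \<le> b m)"
    using b M by (intro exI[of _ "\<lambda>m. M * b m"]) (auto simp: norm_mult intro!: summable_mult mult_mono)
qed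

lemma cderiv_bound:
  assumes F: "entire F" and M: "\<And>u. norm u \<le> norm z + 1 \<Longrightarrow> cmod (F u) \<le> M"
  shows "cmod (cderiv i F z) \<le> M"
proof -
  have "cmod ((deriv ^^ 1) (\<lambda>t. F (z + t *s axis i 1)) 0) \<le> fact 1 * M / 1 ^ 1"
  proof (rule Cauchy_inequality)
    fix t :: complex assume "cmod (0 - t) = 1"
    then have "norm (z + t *s axis i 1) \<le> norm z + 1"
      by (intro order_trans[OF norm_triangle_ineq]) simp
    then show "cmod (F (z + t *s axis i 1)) \<le> M" by (rule M)
  qed (auto intro: entire_line_holomorphic[OF F] holomorphic_on_imp_continuous_on)
  then show ?thesis by (simp add: cderiv_def)
qed

text \<open>A majorant for the radius R + 1 bounds the derivatives for the radius R.\<close>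

lemma normal_series_cderiv:
  assumes "\<And>m. entire (Q m)" "normal_series Q"
  shows "normal_series (\<lambda>m. cderiv i (Q m))"
  unfolding normal_series_def
proof
  fix R
  obtain b where b: "summable b" "\<forall>m z. norm z \<le> R + 1 \<longrightarrow> cmod (Q m z) \<le> b m"
    by (rule normal_seriesE[OF assms(2)])
  show "\<exists>b. summable b \<and> (\<forall>m z. norm z \<le> R \<longrightarrow> cmod (cderiv i (Q m) z) \<le> b m)"
    using b by (intro exI[of _ b] conjI allI impI cderiv_bound assms(1)) auto
qed

text \<open>The derivatives must converge uniformly as linear maps. The Weierstrass test gives this
  for each partial derivative, and the admissible error is split equally among the d
  coordinates.\<close>

lemma normal_series_has_derivative:
  assumes Q: "\<And>m. entire (Q m)" "normal_series Q"
  shows "((\<lambda>z. \<Sum>m. Q m z) has_derivative (\<lambda>h. \<Sum>i\<in>UNIV. h $ i * (\<Sum>m. cderiv i (Q m) z))) (at (z :: complex ^ 'n::finite))"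
proof -
  define S where "S = ball (0 :: complex ^ 'n) (norm z + 1)"
  define f' where "f' = (\<lambda>m x (h :: complex ^ 'n). \<Sum>i\<in>UNIV. h $ i * cderiv i (Q m) x)"
  define g' where "g' = (\<lambda>x (h :: complex ^ 'n). \<Sum>i\<in>UNIV. h $ i * (\<Sum>m. cderiv i (Q m) x))"
  have z: "z \<in> S" and opn: "open S" by (auto simp: S_def)
  have ul: "uniform_limit S (\<lambda>n x. \<Sum>m<n. cderiv i (Q m) x) (\<lambda>x. \<Sum>m. cderiv i (Q m) x) sequentially" for i
  proof -
    obtain b where "summable b" "\<forall>m u. norm u \<le> norm z + 1 \<longrightarrow> cmod (cderiv i (Q m) u) \<le> b m"
      by (rule normal_seriesE[OF normal_series_cderiv[OF Q]])
    then show ?thesis by (intro Weierstrass_m_test[of S _ b]) (auto simp: S_def)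
  qed
  have "\<exists>g. \<forall>x\<in>S. (\<lambda>m. Q m x) sums (g x) \<and> (g has_derivative g' x) (at x within S)"
  proof (rule has_derivative_series[where f' = f' and x = z])
    show "convex S" by (simp add: S_def)
    show "(Q n has_derivative f' n x) (at x within S)" for n x
      unfolding f'_def by (rule has_derivative_at_withinI[OF entire_has_derivative[OF Q(1)]])
    show "(\<lambda>n. Q n z) sums (\<Sum>m. Q m z)" by (rule summable_sums[OF normal_series_summable[OF Q(2)]])
    fix e :: real assume e: "e > 0"
    define e' where "e' = e / CARD('n)"
    have e': "e' > 0" using e by (simp add: e'_def)
    have "\<forall>\<^sub>F n in sequentially. \<forall>i. \<forall>x\<in>S. dist (\<Sum>m<n. cderiv i (Q m) x) (\<Sum>m. cderiv i (Q m) x) < e'"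
      by (rule eventually_all_finite) (rule uniform_limitD[OF ul e'])
    then show "\<forall>\<^sub>F n in sequentially. \<forall>x\<in>S. \<forall>h. norm (sum (\<lambda>i. f' i x h) {..<n} - g' x h) \<le> e * norm h"
    proof eventually_elim
      case (elim n)
      show ?case
      proof (intro ballI allI)
        fix x h assume x: "x \<in> S"
        have "(\<Sum>m<n. f' m x h) = (\<Sum>i\<in>UNIV. h $ i * (\<Sum>m<n. cderiv i (Q m) x))"
          unfolding f'_def by (subst sum.swap) (simp add: sum_distrib_left)
        then have "(\<Sum>m<n. f' m x h) - g' x h = (\<Sum>i\<in>UNIV. h $ i * ((\<Sum>m<n. cderiv i (Q m) x) - (\<Sum>m. cderiv i (Q m) x)))"
          by (simp add: g'_def right_diff_distrib sum_subtractf)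
        also have "norm \<dots> \<le> (\<Sum>i\<in>(UNIV :: 'n set). norm h * e')"
        proof (rule sum_norm_le)
          fix i
          show "norm (h $ i * ((\<Sum>m<n. cderiv i (Q m) x) - (\<Sum>m. cderiv i (Q m) x))) \<le> norm h * e'"
            unfolding norm_mult
          proof (rule mult_mono)
            show "cmod (h $ i) \<le> norm h" by (rule Finite_Cartesian_Product.norm_nth_le)
            show "cmod ((\<Sum>m<n. cderiv i (Q m) x) - (\<Sum>m. cderiv i (Q m) x)) \<le> e'"
              using elim x by (auto simp: dist_norm intro: less_imp_le)
          qed auto
        qed
        also have "\<dots> = e * norm h" by (simp add: e'_def)
        finally show "norm ((\<Sum>m<n. f' m x h) - g' x h) \<le> e * norm h" .
      qed
    qed
  qed (rule z)
  then obtain g where "\<forall>x\<in>S. (\<lambda>m. Q m x) sums (g x) \<and> (g has_derivative g' x) (at x within S)"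
    by (rule exE)
  then have g: "\<And>x. x \<in> S \<Longrightarrow> (\<lambda>m. Q m x) sums (g x)" "\<And>x. x \<in> S \<Longrightarrow> (g has_derivative g' x) (at x within S)"
    by simp_all
  have "(g has_derivative g' z) (at z)" using g(2)[OF z] at_within_open[OF z opn] by simp
  moreover have "g x = (\<Sum>m. Q m x)" if "x \<in> S" for x using g(1)[OF that] by (simp add: sums_iff)
  ultimately have "((\<lambda>z. \<Sum>m. Q m z) has_derivative g' z) (at z)"
    by (rule has_derivative_transform_within_open[OF _ opn z])
  then show ?thesis by (simp add: g'_def)
qed

lemma normal_series_entire:
  assumes "\<And>m. entire (Q m)" "normal_series Q"
  shows "entire (\<lambda>z. \<Sum>m. Q m z)"
  by (rule entireI, rule normal_series_has_derivative[OF assms])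

lemma cderiv_normal_series:
  assumes "\<And>m. entire (Q m)" "normal_series Q"
  shows "cderiv i (\<lambda>z. \<Sum>m. Q m z) = (\<lambda>z. \<Sum>m. cderiv i (Q m) z)"
  by (rule ext, rule has_derivative_combination(2)[OF normal_series_has_derivative[OF assms]])

section \<open>Real Laplacians of normally convergent series\<close>

lemma partial_deriv_cvec:
  assumes "entire F"
  shows "partial_deriv i (\<lambda>y. F (cvec y)) = (\<lambda>x. cderiv i F (cvec x))"
proof
  fix x
  have "((\<lambda>t. F (cvec x + of_real t *s axis i 1)) has_vector_derivative cderiv i F (cvec x)) (at 0)"
    using has_vector_derivative_real_field[of "\<lambda>t. F (cvec x + t *s axis i 1)" "cderiv i F (cvec x)" 0 UNIV]
      entire_line_has_deriv[OF assms] by simp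
  moreover have "cvec (x + t *\<^sub>R axis i 1) = cvec x + of_real t *s axis i 1" for t
    by (simp add: cvec_def vec_eq_iff axis_def)
  ultimately show "partial_deriv i (\<lambda>y. F (cvec y)) x = cderiv i F (cvec x)"
    unfolding partial_deriv_def by (simp add: vector_derivative_at)
qed

text \<open>The second conclusion allows the first to be iterated.\<close>

lemma laplacian_normal_series:
  assumes Q: "\<And>m. poly_fun (Q m)" "normal_series Q"
  shows "laplacian (\<lambda>y. \<Sum>m. Q m (cvec y)) = (\<lambda>x. \<Sum>m. claplacian (Q m) (cvec x))"
    and "normal_series (\<lambda>m. claplacian (Q m))"
proof -
  note e = poly_fun_entire[OF Q(1)]
  note e' = poly_fun_entire[OF poly_fun_cderiv[OF Q(1)]]
  note n' = normal_series_cderiv[OF e Q(2)]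
  note n'' = normal_series_cderiv[OF e' n']
  show "normal_series (\<lambda>m. claplacian (Q m))"
    unfolding claplacian_def[abs_def] by (intro normal_series_sum n'')
  show "laplacian (\<lambda>y. \<Sum>m. Q m (cvec y)) = (\<lambda>x. \<Sum>m. claplacian (Q m) (cvec x))"
  proof
    fix x
    have "laplacian (\<lambda>y. \<Sum>m. Q m (cvec y)) x = (\<Sum>i\<in>UNIV. \<Sum>m. cderiv i (cderiv i (Q m)) (cvec x))"
      unfolding laplacian_def partial_deriv_cvec[OF normal_series_entire[OF e Q(2)]]
        cderiv_normal_series[OF e Q(2)] partial_deriv_cvec[OF normal_series_entire[OF e' n']]
        cderiv_normal_series[OF e' n'] ..
    also have "\<dots> = (\<Sum>m. claplacian (Q m) (cvec x))"
      unfolding claplacian_def by (rule suminf_sum[symmetric]) (rule normal_series_summable[OF n''])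
    finally show "laplacian (\<lambda>y. \<Sum>m. Q m (cvec y)) x = (\<Sum>m. claplacian (Q m) (cvec x))" .
  qed
qed

lemma laplacian_pow_normal_series:
  assumes "\<And>m. poly_fun (Q m)" "normal_series Q"
  shows "(laplacian ^^ k) (\<lambda>y. \<Sum>m. Q m (cvec y)) = (\<lambda>x. \<Sum>m. (claplacian ^^ k) (Q m) (cvec x))"
  using assms
proof (induction k arbitrary: Q)
  case (Suc k)
  have "(laplacian ^^ Suc k) (\<lambda>y. \<Sum>m. Q m (cvec y)) = (laplacian ^^ k) (\<lambda>y. \<Sum>m. claplacian (Q m) (cvec y))"
    unfolding funpow_Suc_right o_def laplacian_normal_series(1)[OF Suc.prems] ..
  also have "\<dots> = (\<lambda>x. \<Sum>m. (claplacian ^^ k) (claplacian (Q m)) (cvec x))"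
    by (rule Suc.IH[OF poly_fun_claplacian[OF Suc.prems(1)] laplacian_normal_series(2)[OF Suc.prems]])
  finally show ?case by (simp add: funpow_swap1)
qed simp

lemma normal_series_taylor:
  assumes "entire F"
  shows "normal_series (\<lambda>m. taylor m F)"
  unfolding normal_series_def
proof
  fix R
  obtain M where M: "M \<ge> 0" "\<And>u. norm u \<le> 2 * R \<Longrightarrow> cmod (F u) \<le> M"
    using entire_bounded_cball[OF assms] by blast
  have "cmod (taylor m F z) \<le> M * (1 / 2) ^ m" if "norm z \<le> R" for m z
    using taylor_cauchy[OF assms, of 2 z M m] M(2) that by (simp add: power_divide)
  moreover have "summable (\<lambda>m. M * (1 / 2) ^ m)" by (intro summable_mult summable_geometric) simp
  ultimately show "\<exists>b. summable b \<and> (\<forall>m z. norm z \<le> R \<longrightarrow> cmod (taylor m F z) \<le> b m)" by blast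
qed

lemma suminf_taylor:
  assumes "entire F"
  shows "(\<Sum>m. taylor m F z) = F z"
  using taylor_sums[OF assms, of z 1] by (simp add: sums_iff)

subsection \<open>Growth\<close>

lemma max_modulus_ge:
  assumes "entire F" "norm \<theta> = 1"
  shows "cmod (F (\<zeta> *s cvec \<theta>)) \<le> max_modulus F (cmod \<zeta>)"
proof -
  obtain M where "\<And>z. norm z \<le> cmod \<zeta> \<Longrightarrow> cmod (F z) \<le> M"
    using entire_bounded_cball[OF assms(1)] by blast
  then have "bdd_above {cmod (F (\<xi> *s cvec \<theta>)) |\<xi> \<theta>. cmod \<xi> = cmod \<zeta> \<and> norm \<theta> = 1}"
    by (intro bdd_aboveI[of _ M]) auto
  then show ?thesis unfolding max_modulus_def using assms(2) by (intro cSup_upper) auto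
qed

lemma max_modulus_le:
  fixes F :: "complex ^ 'n::finite \<Rightarrow> complex"
  assumes "r \<ge> 0" "\<And>\<zeta> \<theta>. cmod \<zeta> = r \<Longrightarrow> norm \<theta> = 1 \<Longrightarrow> cmod (F (\<zeta> *s cvec \<theta>)) \<le> M"
  shows "max_modulus F r \<le> M"
proof -
  obtain i :: 'n where True by blast
  have "cmod (F (of_real r *s cvec (axis i 1))) \<in> {cmod (F (\<zeta> *s cvec \<theta>)) |\<zeta> \<theta>. cmod \<zeta> = r \<and> norm \<theta> = 1}"
    using assms(1) by (intro CollectI exI[of _ "of_real r"] exI[of _ "axis i 1"]) simp
  then show ?thesis unfolding max_modulus_def using assms(2) by (intro cSup_least) auto
qed

text \<open>If all components of positive degree vanished on the real sphere, their L^2 norms and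
  hence the components themselves would be zero, leaving a constant.\<close>

lemma nonconstant_taylor:
  fixes F :: "complex ^ 'n::finite \<Rightarrow> complex"
  assumes F: "entire F" and nc: "\<nexists>c. \<forall>z. F z = c"
  obtains (witness) n \<theta> where "n \<ge> 1" "norm \<theta> = 1" "taylor n F (cvec \<theta>) \<noteq> 0"
proof (rule ccontr)
  assume neg: "\<not> thesis"
  have 0: "taylor n F (cvec \<theta>) = 0" if n: "n \<ge> 1" "norm \<theta> = 1" for n \<theta>
  proof (rule ccontr)
    assume "taylor n F (cvec \<theta>) \<noteq> 0"
    then show False using neg witness n by blast
  qed
  have "taylor n F z = 0" if n: "n \<ge> 1" for n z
  proof -
    have "snorm (taylor n F) \<le> 0 * snorm (\<lambda>_ :: complex ^ 'n. 1)"
      by (rule snorm_le_sup) (use 0[OF n] hom_poly_entire[OF hom_poly_taylor[OF F]] in auto)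
    then have "snorm (taylor n F) = 0" using snorm_nonneg[of "taylor n F"] by simp
    then show ?thesis using snorm_eq_0_imp_zero[OF hom_poly_taylor[OF F]] by (simp add: fun_eq_iff)
  qed
  then have "F z = taylor 0 F 0" for z
    using suminf_taylor[OF F, of z] suminf_finite[of "{0}" "\<lambda>n. taylor n F z"]
      hom_poly_0_const[OF hom_poly_taylor[OF F], of z] by simp
  then show False using nc by blast
qed

text \<open>Cauchy's estimate for a nonzero component of degree n, read backwards, bounds the
  maximum modulus from below by a r^n.\<close>

lemma max_modulus_at_top:
  assumes F: "entire F" and nc: "\<nexists>c. \<forall>z. F z = c"
  shows "filterlim (max_modulus F) at_top at_top"
proof -
  obtain n \<theta> where n: "n \<ge> 1" "norm \<theta> = 1" "taylor n F (cvec \<theta>) \<noteq> 0"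
    using nonconstant_taylor[OF assms] by blast
  define a where "a = cmod (taylor n F (cvec \<theta>))"
  have a: "a > 0" using n by (simp add: a_def)
  have "filterlim (\<lambda>r. a * r ^ n) at_top at_top"
    using n a by (intro filterlim_tendsto_pos_mult_at_top[OF tendsto_const] filterlim_pow_at_top filterlim_ident) auto
  moreover have "\<forall>\<^sub>F r in at_top. a * r ^ n \<le> max_modulus F r"
    using eventually_gt_at_top[of 0]
  proof eventually_elim
    case (elim r)
    have "a \<le> max_modulus F r / r ^ n"
      unfolding a_def using max_modulus_ge[OF F n(2)] by (intro taylor_cauchy[OF F elim]) auto
    then show ?case using elim by (simp add: field_simps)
  qed
  ultimately show ?thesis by (rule filterlim_at_top_mono)
qed

lemma growth_order_nonneg:
  assumes F: "entire F"
  shows "growth_order F \<ge> 0"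
proof (cases "\<exists>c. \<forall>z. F z = c")
  case False
  have "\<forall>\<^sub>F r in at_top. exp 1 \<le> max_modulus F r"
    using max_modulus_at_top[OF F False] unfolding filterlim_at_top by blast
  then have "\<forall>\<^sub>F r in at_top. 0 \<le> ereal (ln (ln (max_modulus F r)) / ln r)"
    using eventually_gt_at_top[of 1]
  proof eventually_elim
    case (elim r)
    have "1 \<le> ln (max_modulus F r)" using elim by (subst ln_ge_iff) (auto intro: less_le_trans[OF exp_gt_zero])
    then show ?case using elim by simp
  qed
  then show ?thesis using False by (simp add: growth_order_def le_Limsup)
qed (simp add: growth_order_def)

text \<open>Explicit bounds combine under products and differences more easily than a limit
  superior. Only real directions occur, as in \<open>max_modulus\<close>, and |\<zeta>| \<ge> 1
  makes the bound monotone in the exponent.\<close>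

definition growth_bound :: "real \<Rightarrow> real \<Rightarrow> (complex ^ 'n::finite \<Rightarrow> complex) \<Rightarrow> real \<Rightarrow> bool" where
  "growth_bound K c F \<tau> \<longleftrightarrow> K \<ge> 0 \<and> c \<ge> 0 \<and> (\<forall>\<zeta> \<theta>. cmod \<zeta> \<ge> 1 \<longrightarrow> norm \<theta> = 1 \<longrightarrow>
     cmod (F (\<zeta> *s cvec \<theta>)) \<le> K * exp (c * cmod \<zeta> powr \<tau>))"

definition growth_le :: "(complex ^ 'n::finite \<Rightarrow> complex) \<Rightarrow> real \<Rightarrow> bool" where
  "growth_le F \<tau> \<longleftrightarrow> (\<exists>K c. growth_bound K c F \<tau>)"

lemma growth_boundD:
  assumes "growth_bound K c F \<tau>"
  shows "K \<ge> 0" "c \<ge> 0" "cmod \<zeta> \<ge> 1 \<Longrightarrow> norm \<theta> = 1 \<Longrightarrow>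
     cmod (F (\<zeta> *s cvec \<theta>)) \<le> K * exp (c * cmod \<zeta> powr \<tau>)"
  using assms by (simp_all add: growth_bound_def)

lemma growth_leE:
  assumes "growth_le F \<tau>"
  obtains K c where "growth_bound K c F \<tau>"
  using assms unfolding growth_le_def by blast

lemma growth_le_mono:
  assumes "growth_le F \<tau>" "\<tau> \<le> \<tau>'"
  shows "growth_le F \<tau>'"
proof -
  obtain K c where "growth_bound K c F \<tau>" using growth_leE[OF assms(1)] .
  note K = growth_boundD[OF this]
  have "K * exp (c * cmod \<zeta> powr \<tau>) \<le> K * exp (c * cmod \<zeta> powr \<tau>')" if "cmod \<zeta> \<ge> 1" for \<zeta>
    using K that assms(2) by (intro mult_left_mono) (auto intro: mult_left_mono powr_mono)
  then show ?thesis unfolding growth_le_def growth_bound_def using K by (meson order_trans)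
qed

lemma growth_le_mult:
  assumes "growth_le F \<tau>" "growth_le G \<tau>"
  shows "growth_le (\<lambda>z. F z * G z) \<tau>"
proof -
  obtain K c where "growth_bound K c F \<tau>" using growth_leE[OF assms(1)] .
  note K = growth_boundD[OF this]
  obtain K' c' where "growth_bound K' c' G \<tau>" using growth_leE[OF assms(2)] .
  note K' = growth_boundD[OF this]
  have "cmod (F (\<zeta> *s cvec \<theta>) * G (\<zeta> *s cvec \<theta>)) \<le> (K * K') * exp ((c + c') * cmod \<zeta> powr \<tau>)"
    if "cmod \<zeta> \<ge> 1" "norm \<theta> = 1" for \<zeta> \<theta>
  proof -
    have "cmod (F (\<zeta> *s cvec \<theta>) * G (\<zeta> *s cvec \<theta>)) \<le> (K * exp (c * cmod \<zeta> powr \<tau>)) * (K' * exp (c' * cmod \<zeta> powr \<tau>))"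
      unfolding norm_mult using K K' that by (intro mult_mono) auto
    then show ?thesis by (simp add: distrib_right exp_add mult_ac)
  qed
  then show ?thesis unfolding growth_le_def growth_bound_def using K K'
    by (intro exI[of _ "K * K'"] exI[of _ "c + c'"]) auto
qed

lemma growth_le_diff:
  assumes "growth_le F \<tau>" "growth_le G \<tau>"
  shows "growth_le (\<lambda>z. F z - G z) \<tau>"
proof -
  obtain K c where "growth_bound K c F \<tau>" using growth_leE[OF assms(1)] .
  note K = growth_boundD[OF this]
  obtain K' c' where "growth_bound K' c' G \<tau>" using growth_leE[OF assms(2)] .
  note K' = growth_boundD[OF this]
  have "cmod (F (\<zeta> *s cvec \<theta>) - G (\<zeta> *s cvec \<theta>)) \<le> (K + K') * exp ((c + c') * cmod \<zeta> powr \<tau>)"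
    if "cmod \<zeta> \<ge> 1" "norm \<theta> = 1" for \<zeta> \<theta>
  proof -
    have "cmod (F (\<zeta> *s cvec \<theta>) - G (\<zeta> *s cvec \<theta>)) \<le> K * exp (c * cmod \<zeta> powr \<tau>) + K' * exp (c' * cmod \<zeta> powr \<tau>)"
      using K(3)[OF that] K'(3)[OF that] by (intro order_trans[OF norm_triangle_ineq4] add_mono)
    also have "\<dots> \<le> K * exp ((c + c') * cmod \<zeta> powr \<tau>) + K' * exp ((c + c') * cmod \<zeta> powr \<tau>)"
      using K K' by (intro add_mono mult_left_mono) (auto simp: distrib_right)
    finally show ?thesis by (simp add: distrib_right)
  qed
  then show ?thesis unfolding growth_le_def growth_bound_def using K K'
    by (intro exI[of _ "K + K'"] exI[of _ "c + c'"]) auto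
qed

text \<open>Powers are absorbed by every positive exponent: r^n = exp (n ln r), and ln r is at most
  r^\<tau> / \<tau>.\<close>

lemma growth_le_hom_poly:
  assumes p: "hom_poly n p" and \<tau>: "\<tau> > 0"
  shows "growth_le p \<tau>"
proof -
  obtain M where M: "M \<ge> 0" "\<And>z. norm z \<le> 1 \<Longrightarrow> cmod (p z) \<le> M"
    using entire_bounded_cball[OF hom_poly_entire[OF p]] by blast
  have "cmod (p (\<zeta> *s cvec \<theta>)) \<le> M * exp (real n / \<tau> * cmod \<zeta> powr \<tau>)"
    if z: "cmod \<zeta> \<ge> 1" "norm \<theta> = 1" for \<zeta> \<theta>
  proof -
    have "\<zeta> \<noteq> 0" using z by auto
    then have "cmod \<zeta> ^ n = exp (real n * ln (cmod \<zeta>))"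
      by (simp add: exp_of_nat_mult)
    also have "\<dots> \<le> exp (real n * (cmod \<zeta> powr \<tau> / \<tau>))"
      using mult_left_mono[OF ln_powr_bound[OF z(1) \<tau>], of "real n"] by simp
    finally have "cmod \<zeta> ^ n \<le> exp (real n / \<tau> * cmod \<zeta> powr \<tau>)" by simp
    then have "cmod \<zeta> ^ n * cmod (p (cvec \<theta>)) \<le> exp (real n / \<tau> * cmod \<zeta> powr \<tau>) * M"
      using M(2)[of "cvec \<theta>"] z by (intro mult_mono) auto
    then show ?thesis by (simp add: hom_poly_scale[OF p] norm_mult norm_power mult.commute)
  qed
  then show ?thesis unfolding growth_le_def growth_bound_def using M \<tau>
    by (intro exI[of _ M] exI[of _ "real n / \<tau>"]) auto
qed

lemma growth_le_sum:
  assumes "\<And>i. i \<in> A \<Longrightarrow> growth_le (F i) \<tau>" "\<tau> > 0"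
  shows "growth_le (\<lambda>z. \<Sum>i\<in>A. F i z) \<tau>"
  using assms(1)
proof (induction A rule: infinite_finite_induct)
  case (insert i A)
  \<comment> \<open>The sum is written as a double difference, so closure under differences
    suffices.\<close>
  have "growth_le (\<lambda>z. F i z - (0 - (\<Sum>i\<in>A. F i z))) \<tau>"
    using insert assms(2) by (intro growth_le_diff growth_le_hom_poly[OF hom_poly_zero[of 0]]) auto
  then show ?case using insert by simp
qed (auto intro: growth_le_hom_poly[OF hom_poly_zero[of 0] assms(2)])

text \<open>A limit superior below \<tau> bounds the maximum modulus by exp (r^\<tau>) for large r;
  a compactness bound for the remaining radii goes into the constant.\<close>

lemma growth_order_imp_growth_le:
  assumes F: "entire F" and ord: "growth_order F < ereal \<tau>" and \<tau>: "\<tau> > 0"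
  shows "growth_le F \<tau>"
proof (cases "\<exists>c. \<forall>z. F z = c")
  case True
  then obtain c where "F = (\<lambda>z. c)" by blast
  then show ?thesis using growth_le_hom_poly[OF hom_poly_const \<tau>] by simp
next
  case False
  have "\<forall>\<^sub>F r in at_top. ereal (ln (ln (max_modulus F r)) / ln r) < ereal \<tau>"
    using ord False by (intro Limsup_lessD) (simp add: growth_order_def)
  then have "\<forall>\<^sub>F r in at_top. max_modulus F r \<le> exp (r powr \<tau>)"
    using eventually_gt_at_top[of 1]
  proof eventually_elim
    case (elim r)
    have l: "ln (ln (max_modulus F r)) < \<tau> * ln r" using elim by (simp add: divide_less_eq)
    have "ln (max_modulus F r) \<le> r powr \<tau>"
    \<comment> \<open>When the inner logarithm is not positive, the outer one carries no
      information, but then the bound is trivial.\<close>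
    proof (cases "ln (max_modulus F r) > 0")
      case True
      then have "ln (max_modulus F r) < exp (\<tau> * ln r)" using l by (metis exp_less_cancel_iff exp_ln)
      then show ?thesis using elim by (simp add: powr_def)
    next
      case False
      then show ?thesis using powr_ge_zero[of r \<tau>] by linarith
    qed
    show ?case
    proof (cases "max_modulus F r > 0")
      case True
      then have "max_modulus F r = exp (ln (max_modulus F r))" by simp
      also have "\<dots> \<le> exp (r powr \<tau>)" using \<open>ln (max_modulus F r) \<le> r powr \<tau>\<close> by simp
      finally show ?thesis .
    next
      case False
      then show ?thesis using exp_gt_zero[of "r powr \<tau>"] by linarith
    qed
  qed
  then obtain R where R: "\<And>r. r \<ge> R \<Longrightarrow> max_modulus F r \<le> exp (r powr \<tau>)"
    by (auto simp: eventually_at_top_linorder)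
  obtain M where M: "M \<ge> 0" "\<And>z. norm z \<le> R \<Longrightarrow> cmod (F z) \<le> M"
    using entire_bounded_cball[OF F] by blast
  have "cmod (F (\<zeta> *s cvec \<theta>)) \<le> (M + 1) * exp (1 * cmod \<zeta> powr \<tau>)" if "norm \<theta> = 1" for \<zeta> \<theta>
  proof (cases "cmod \<zeta> \<le> R")
    case True
    then have "cmod (F (\<zeta> *s cvec \<theta>)) \<le> M * 1" using M(2)[of "\<zeta> *s cvec \<theta>"] that by simp
    also have "\<dots> \<le> (M + 1) * exp (1 * cmod \<zeta> powr \<tau>)" using M(1) by (intro mult_mono) auto
    finally show ?thesis .
  next
    case False
    then have "cmod (F (\<zeta> *s cvec \<theta>)) \<le> 1 * exp (1 * cmod \<zeta> powr \<tau>)"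
      using R[of "cmod \<zeta>"] max_modulus_ge[OF F that, of \<zeta>] by simp
    also have "\<dots> \<le> (M + 1) * exp (1 * cmod \<zeta> powr \<tau>)" using M(1) by (intro mult_right_mono) auto
    finally show ?thesis .
  qed
  then show ?thesis unfolding growth_le_def growth_bound_def using M(1)
    by (intro exI[of _ "M + 1"] exI[of _ 1]) auto
qed

text \<open>The strict gap absorbs both constants, since r^(\<tau> - \<tau>') eventually exceeds K +
  c. Nonconstancy makes the maximum modulus at least e, so the iterated logarithm is well
  behaved.\<close>

lemma growth_le_imp_growth_order:
  assumes F: "entire F" and g: "growth_le F \<tau>'" and \<tau>: "0 < \<tau>'" "\<tau>' < \<tau>"
  shows "growth_order F \<le> ereal \<tau>"
proof (cases "\<exists>c. \<forall>z. F z = c")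
  case True
  then show ?thesis using \<tau> by (simp add: growth_order_def)
next
  case False
  obtain K c where "growth_bound K c F \<tau>'" using growth_leE[OF g] .
  note K = growth_boundD[OF this]
  have "filterlim (\<lambda>r :: real. r powr (\<tau> - \<tau>')) at_top at_top"
  proof -
    have "\<tau> - \<tau>' > 0" using \<tau> by simp
    then show ?thesis by real_asymp
  qed
  then have ev: "\<forall>\<^sub>F r in at_top. K + c \<le> r powr (\<tau> - \<tau>')"
    unfolding filterlim_at_top by blast
  have "\<forall>\<^sub>F r in at_top. exp 1 \<le> max_modulus F r"
    using max_modulus_at_top[OF F False] unfolding filterlim_at_top by blast
  then have "\<forall>\<^sub>F r in at_top. ereal (ln (ln (max_modulus F r)) / ln r) \<le> ereal \<tau>"
    using eventually_gt_at_top[of 1] ev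
  proof eventually_elim
    case (elim r)
    have r1: "1 \<le> r powr \<tau>'" using elim \<tau> by (intro ge_one_powr_ge_zero) auto
    have "max_modulus F r \<le> K * exp (c * r powr \<tau>')"
      by (rule max_modulus_le) (use K elim in auto)
    also have "\<dots> \<le> exp K * exp (c * r powr \<tau>')"
    proof (rule mult_right_mono)
      show "K \<le> exp K" using exp_ge_add_one_self[of K] by linarith
    qed simp
    also have "\<dots> = exp (K * 1 + c * r powr \<tau>')" by (simp add: exp_add)
    also have "\<dots> \<le> exp (K * r powr \<tau>' + c * r powr \<tau>')"
      using r1 K(1) by (intro exp_mono add_right_mono mult_left_mono)
    also have "\<dots> = exp ((K + c) * r powr \<tau>')" by (simp add: distrib_right)
    also have "\<dots> \<le> exp (r powr (\<tau> - \<tau>') * r powr \<tau>')"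
      using elim by (intro exp_mono mult_right_mono) auto
    also have "\<dots> = exp (r powr \<tau>)" by (simp add: powr_add[symmetric])
    finally have M: "max_modulus F r \<le> exp (r powr \<tau>)" .
    have pos: "max_modulus F r > 0" using elim(1) by (rule less_le_trans[OF exp_gt_zero])
    have ge1: "1 \<le> ln (max_modulus F r)" using elim(1) pos by (simp add: ln_ge_iff)
    have "ln (max_modulus F r) \<le> r powr \<tau>" using M pos by (metis ln_exp ln_le_cancel_iff exp_gt_zero)
    then have "ln (ln (max_modulus F r)) \<le> ln (r powr \<tau>)"
      using ge1 by (intro ln_mono) auto
    also have "\<dots> = \<tau> * ln r" using elim by (simp add: ln_powr)
    finally show ?case using elim by (simp add: divide_le_eq)
  qed
  then show ?thesis unfolding growth_order_def if_not_P[OF False] by (rule Limsup_bounded)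
qed

text \<open>The radius r = m^(1/\<rho>) balances Cauchy's estimate: exp (c r^\<rho>) is merely
  geometric in m, while r^m = m^(m/\<rho>).\<close>

lemma growth_le_taylor:
  assumes F: "entire F" and g: "growth_le F \<rho>" and \<rho>: "\<rho> > 0"
  shows "\<exists>K E. K \<ge> 0 \<and> E \<ge> 1 \<and> (\<forall>m\<ge>1. \<forall>\<theta>. norm \<theta> = 1 \<longrightarrow>
     cmod (taylor m F (cvec \<theta>)) \<le> K * E ^ m * real m powr (- (real m / \<rho>)))"
proof -
  obtain K c where "growth_bound K c F \<rho>" using growth_leE[OF g] .
  note K = growth_boundD[OF this]
  have "cmod (taylor m F (cvec \<theta>)) \<le> K * exp c ^ m * real m powr (- (real m / \<rho>))"
    if m: "m \<ge> 1" and \<theta>: "norm \<theta> = 1" for m \<theta>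
  proof -
    define r where "r = real m powr (1 / \<rho>)"
    have r: "r \<ge> 1" unfolding r_def using m \<rho> by (intro ge_one_powr_ge_zero) auto
    have r\<rho>: "r powr \<rho> = real m" using m \<rho> by (simp add: r_def powr_powr)
    have rm: "r ^ m = real m powr (real m / \<rho>)"
      using m by (simp add: r_def powr_powr flip: powr_realpow)
    have "cmod (taylor m F (cvec \<theta>)) \<le> K * exp (c * real m) / r ^ m"
    proof (rule taylor_cauchy[OF F])
      show "r > 0" using r by simp
      show "cmod (F (t *s cvec \<theta>)) \<le> K * exp (c * real m)" if "cmod t = r" for t
        using K(3)[of t \<theta>] that r \<theta> r\<rho> by simp
    qed
    then show ?thesis unfolding rm
      by (simp add: powr_minus divide_inverse exp_of_nat_mult[symmetric] mult.commute)
  qed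
  then show ?thesis using K by (intro exI[of _ K] exI[of _ "exp c"]) auto
qed

text \<open>After taking logarithms and bounding n ln R, the exponent is affine in n. The two
  conditions on \<tau> settle its endpoints n = 0 and n = m, that is, the cost of full descent and
  the growth in the top degree.\<close>

lemma growth_term_bound:
  assumes m: "m \<ge> 1" and n: "n \<le> m" and R: "R > 0"
    and \<rho>: "0 < \<rho>" "0 < \<rho>'" and \<tau>: "\<tau> \<le> 1 / \<rho> - \<gamma>" "\<tau> \<le> 1 / \<rho> - 1 / \<rho>'"
  shows "real m powr (- (real m / \<rho>)) * (real m powr \<gamma>) ^ (m - n) * R ^ n
     \<le> real m powr (- (\<tau> * real m)) * exp (R powr \<rho>' / \<rho>')"
proof -
  define l where "l = ln (real m)"
  define x where "x = ln R"
  define N where "N = real n"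
  have mp: "real m > 0" using m by simp
  have l: "l \<ge> 0" using m by (simp add: l_def)
  have N: "0 \<le> N" "N \<le> real m" using n by (auto simp: N_def)
  have e1: "real m powr a = exp (a * l)" for a using m by (simp add: powr_def l_def)
  have "(real m powr \<gamma>) ^ (m - n) = exp ((real m - N) * (\<gamma> * l))"
    unfolding e1 using n by (simp add: N_def of_nat_diff exp_of_nat_mult[symmetric])
  moreover have "R ^ n = exp (N * x)"
    using R by (simp add: N_def x_def exp_of_nat_mult)
  ultimately have lhs: "real m powr (- (real m / \<rho>)) * (real m powr \<gamma>) ^ (m - n) * R ^ n
     = exp (- (real m / \<rho>) * l + (real m - N) * (\<gamma> * l) + N * x)"
    by (simp add: e1 mult_exp_exp algebra_simps)
  \<comment> \<open>The elementary y \<le> exp y at y = \<rho>' ln R - ln m, multiplied by n /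
    \<rho>', trades R^n for a power of m and a factor exp (R^\<rho>' / \<rho>') that is independent
    of n and m.\<close>
  have "\<rho>' * x - l \<le> exp (\<rho>' * x - l)" using exp_ge_add_one_self[of "\<rho>' * x - l"] by linarith
  also have "\<dots> = R powr \<rho>' / real m"
    using R mp by (simp add: exp_diff x_def l_def powr_def)
  finally have "(N / \<rho>') * (\<rho>' * x - l) \<le> (N / \<rho>') * (R powr \<rho>' / real m)"
    using N \<rho> by (intro mult_left_mono) auto
  also have "\<dots> = (N / real m) * (R powr \<rho>' / \<rho>')" by simp
  also have "\<dots> \<le> 1 * (R powr \<rho>' / \<rho>')"
    using N mp \<rho> by (intro mult_right_mono) auto
  finally have "(N / \<rho>') * (\<rho>' * x - l) \<le> R powr \<rho>' / \<rho>'" by simp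
  moreover have "(N / \<rho>') * (\<rho>' * x - l) = N * x - N * l / \<rho>'"
    using \<rho> by (simp add: right_diff_distrib)
  ultimately have A: "N * x \<le> N * l / \<rho>' + R powr \<rho>' / \<rho>'" by linarith
  have B1: "(real m - N) * l * (\<tau> + \<gamma> - 1 / \<rho>) \<le> 0"
    using N l \<tau> by (intro mult_nonneg_nonpos) auto
  have B2: "N * l * (\<tau> + 1 / \<rho>' - 1 / \<rho>) \<le> 0"
    using N l \<tau> by (intro mult_nonneg_nonpos) auto
  have "- (real m / \<rho>) * l + (real m - N) * (\<gamma> * l) + N * l / \<rho>'
     = - (\<tau> * real m) * l + (real m - N) * l * (\<tau> + \<gamma> - 1 / \<rho>) + N * l * (\<tau> + 1 / \<rho>' - 1 / \<rho>)"
    by (simp add: algebra_simps)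
  then have "- (real m / \<rho>) * l + (real m - N) * (\<gamma> * l) + N * x \<le> - (\<tau> * real m) * l + R powr \<rho>' / \<rho>'"
    using A B1 B2 by linarith
  moreover have "real m powr (- (\<tau> * real m)) * exp (R powr \<rho>' / \<rho>') = exp (- (\<tau> * real m) * l + R powr \<rho>' / \<rho>')"
    by (simp add: e1 mult_exp_exp)
  ultimately show ?thesis by (simp only: lhs exp_le_cancel_iff)
qed

text \<open>Eventually G m^(-\<tau>) is below 1/4, and m + 1 \<le> 2^m, so the terms are at most
  (1/2)^m.\<close>

lemma growth_coefficients_summable:
  assumes "G \<ge> 0" "\<tau> > 0"
  shows "summable (\<lambda>m. (real m + 1) * G ^ m * real m powr (- (\<tau> * real m)))"
proof (rule summable_comparison_test_ev)
  have "(\<lambda>m. G * real m powr (- \<tau>)) \<longlonglongrightarrow> G * 0"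
    using assms(2) by (intro tendsto_mult tendsto_const tendsto_neg_powr filterlim_real_sequentially) auto
  then have "\<forall>\<^sub>F m in sequentially. G * real m powr (- \<tau>) < 1 / 4"
    by (rule order_tendstoD) simp
  then show "\<forall>\<^sub>F m in sequentially. norm ((real m + 1) * G ^ m * real m powr (- (\<tau> * real m))) \<le> (1 / 2) ^ m"
    using eventually_ge_at_top[of 1]
  proof eventually_elim
    case (elim m)
    have "real m powr (- (\<tau> * real m)) = (real m powr (- \<tau>)) ^ m"
      using elim by (simp add: powr_powr flip: powr_realpow)
    then have "norm ((real m + 1) * G ^ m * real m powr (- (\<tau> * real m))) = (real m + 1) * (G * real m powr (- \<tau>)) ^ m"
      using assms(1) by (simp add: power_mult_distrib)
    also have "\<dots> \<le> 2 ^ m * (1 / 4) ^ m"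
    proof (intro mult_mono power_mono)
      have "Suc m \<le> 2 ^ m" by (rule Suc_leI[OF less_exp])
      then show "real m + 1 \<le> 2 ^ m" by (metis of_nat_Suc of_nat_le_iff of_nat_numeral of_nat_power add.commute)
    qed (use elim assms in auto)
    also have "\<dots> = (1 / 2) ^ m" by (simp flip: power_mult_distrib)
    finally show ?case .
  qed
qed (simp add: summable_geometric)

text \<open>Separating the dependence on m from that on the radius gives normal convergence and
  growth from one majorant. The factor m + 1 in \<open>b\<close> counts the summands n = 0, ...,
  m.\<close>

lemma growth_series_bound:
  fixes Q :: "nat \<Rightarrow> complex ^ 'n::finite \<Rightarrow> complex"
  assumes \<rho>: "0 < \<rho>" "\<rho> < \<rho>'" and \<gamma>: "\<gamma> < 1 / \<rho>" and K: "K \<ge> 0" "G \<ge> 0"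
    and Q0: "\<And>z. Q 0 z = 0"
    and Q: "\<And>m z. m \<ge> 1 \<Longrightarrow> cmod (Q m z) \<le> K * G ^ m * real m powr (- (real m / \<rho>)) *
       (\<Sum>n\<le>m. (real m powr \<gamma>) ^ (m - n) * norm z ^ n)"
  shows "\<exists>b. summable b \<and> (\<forall>m. b m \<ge> 0) \<and>
     (\<forall>m R z. R > 0 \<longrightarrow> norm z \<le> R \<longrightarrow> cmod (Q m z) \<le> b m * exp (R powr \<rho>' / \<rho>'))"
proof -
  \<comment> \<open>The two slacks: the first is positive because \<gamma> < 1 / \<rho>, the second
    because \<rho> < \<rho>'.\<close>
  define \<tau> where "\<tau> = min (1 / \<rho> - \<gamma>) (1 / \<rho> - 1 / \<rho>')"
  have \<tau>: "\<tau> > 0" "\<tau> \<le> 1 / \<rho> - \<gamma>" "\<tau> \<le> 1 / \<rho> - 1 / \<rho>'"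
    using \<rho> \<gamma> by (auto simp: \<tau>_def field_simps)
  define b where "b = (\<lambda>m. K * ((real m + 1) * G ^ m * real m powr (- (\<tau> * real m))))"
  have "summable b" unfolding b_def
    by (intro summable_mult growth_coefficients_summable K \<tau>)
  moreover have "b m \<ge> 0" for m unfolding b_def using K by simp
  moreover have "cmod (Q m z) \<le> b m * exp (R powr \<rho>' / \<rho>')" if R: "R > 0" "norm z \<le> R" for m R z
  proof (cases "m = 0")
    case True
    then show ?thesis using \<open>b m \<ge> 0\<close> Q0 by simp
  next
    case False
    then have m: "m \<ge> 1" by simp
    let ?X = "real m powr (- (\<tau> * real m)) * exp (R powr \<rho>' / \<rho>')"
    have "cmod (Q m z) \<le> K * G ^ m * (real m powr (- (real m / \<rho>)) * (\<Sum>n\<le>m. (real m powr \<gamma>) ^ (m - n) * norm z ^ n))"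
      using Q[OF m, of z] by (simp add: mult.assoc)
    also have "\<dots> = K * G ^ m * (\<Sum>n\<le>m. real m powr (- (real m / \<rho>)) * (real m powr \<gamma>) ^ (m - n) * norm z ^ n)"
      by (simp add: sum_distrib_left mult.assoc)
    also have "\<dots> \<le> K * G ^ m * (\<Sum>n\<le>m. ?X)"
    proof (intro mult_left_mono sum_mono)
      fix n assume "n \<in> {..m}"
      have "real m powr (- (real m / \<rho>)) * (real m powr \<gamma>) ^ (m - n) * norm z ^ n
         \<le> real m powr (- (real m / \<rho>)) * (real m powr \<gamma>) ^ (m - n) * R ^ n"
        using R by (intro mult_left_mono power_mono) auto
      also have "\<dots> \<le> ?X"
        by (rule growth_term_bound) (use m R \<rho> \<tau> \<open>n \<in> {..m}\<close> in auto)
      finally show "real m powr (- (real m / \<rho>)) * (real m powr \<gamma>) ^ (m - n) * norm z ^ n \<le> ?X" .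
    qed (use K in auto)
    also have "\<dots> = b m * exp (R powr \<rho>' / \<rho>')" by (simp add: b_def algebra_simps)
    finally show ?thesis .
  qed
  ultimately show ?thesis by blast
qed

lemma growth_series:
  fixes Q :: "nat \<Rightarrow> complex ^ 'n::finite \<Rightarrow> complex"
  assumes \<rho>: "0 < \<rho>'"
    and b: "summable b" "\<And>m. b m \<ge> 0"
      "\<And>m R z. R > 0 \<Longrightarrow> norm z \<le> R \<Longrightarrow> cmod (Q m z) \<le> b m * exp (R powr \<rho>' / \<rho>')"
  shows "normal_series Q" "growth_le (\<lambda>z. \<Sum>m. Q m z) \<rho>'"
proof -
  show "normal_series Q" unfolding normal_series_def
  proof
    fix R :: real
    \<comment> \<open>The majorant is available for positive radii only, whereas normal convergence
      is stated for all R.\<close>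
    define R' where "R' = max R 1"
    have "cmod (Q m z) \<le> b m * exp (R' powr \<rho>' / \<rho>')" if "norm z \<le> R" for m z
      using that by (intro b(3)) (auto simp: R'_def)
    then show "\<exists>b. summable b \<and> (\<forall>m z. norm z \<le> R \<longrightarrow> cmod (Q m z) \<le> b m)"
      using b(1) by (intro exI[of _ "\<lambda>m. b m * exp (R' powr \<rho>' / \<rho>')"]) (auto intro: summable_mult2)
  qed
  have "cmod (\<Sum>m. Q m (\<zeta> *s cvec \<theta>)) \<le> suminf b * exp (1 / \<rho>' * cmod \<zeta> powr \<rho>')"
    if "cmod \<zeta> \<ge> 1" "norm \<theta> = 1" for \<zeta> \<theta>
  proof -
    have "cmod (\<Sum>m. Q m (\<zeta> *s cvec \<theta>)) \<le> (\<Sum>m. b m * exp (cmod \<zeta> powr \<rho>' / \<rho>'))"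
      using that b by (intro norm_suminf_le summable_mult2 b(3)) auto
    then show ?thesis using b(1) by (simp add: suminf_mult2[symmetric])
  qed
  then show "growth_le (\<lambda>z. \<Sum>m. Q m z) \<rho>'"
    unfolding growth_le_def growth_bound_def using b \<rho> by (intro exI[of _ "suminf b"] exI[of _ "1 / \<rho>'"]) (auto intro: suminf_nonneg)
qed

section \<open>Assembly of q and r from the homogeneous components of f\<close>

theorem theorem1:
  fixes k \<beta> :: nat
    and P :: "nat \<Rightarrow> complex ^ 'n::finite \<Rightarrow> complex"
    and C D \<alpha> :: real
    and f :: "complex ^ 'n \<Rightarrow> complex"
  assumes "k \<ge> 1"
    and "hom_poly (2 * k) (P (2 * k))"
    and "C > 0" and "D > 0" and "\<alpha> \<ge> 0"
    and "\<And>m g. hom_poly m g \<Longrightarrow>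
           sphere_inner (\<lambda>z. P (2 * k) z * g z) g \<in> \<real> \<and>
           Re (sphere_inner (\<lambda>z. P (2 * k) z * g z) g)
             \<ge> 1 / (C * (real m + D) powr \<alpha>) * Re (sphere_inner g g)"
    and "\<beta> < 2 * k"
    and "\<And>j. j \<le> \<beta> \<Longrightarrow> hom_poly j (P j)"
    and "entire f"
    and "growth_order f < (if \<alpha> = 0 then \<infinity> else ereal (real (2 * k - \<beta>) / \<alpha>))"
  shows "\<exists>q r. entire q \<and> entire r \<and>
           growth_order q \<le> growth_order f \<and> growth_order r \<le> growth_order f \<and>
           (\<forall>z. f z = (P (2 * k) z - (\<Sum>j\<le>\<beta>. P j z)) * q z + r z) \<and>
           (\<forall>x. (laplacian ^^ k) (\<lambda>y. r (cvec y)) x = 0)"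
proof -
  note k = assms(1) and P2k = assms(2) and CD = assms(3,4,5) and pos = assms(6)
    and \<beta> = assms(7) and Pj = assms(8) and f = assms(9) and ord = assms(10)
  define \<delta> where "\<delta> = 2 * k - \<beta>"
  define \<gamma> where "\<gamma> = \<alpha> / \<delta>"
  have \<delta>: "\<delta> > 0" using \<beta> by (simp add: \<delta>_def)
  define PP where "PP = (\<lambda>z. P (2 * k) z - (\<Sum>j\<le>\<beta>. P j z))"
  have entPP: "entire PP" unfolding PP_def
    by (intro entire_diff entire_sum hom_poly_entire[OF P2k] hom_poly_entire[OF Pj]) simp
  obtain K0 B where KB: "K0 \<ge> 1" "B \<ge> 1" "\<forall>n q z. hom_poly n q \<longrightarrow>
     cmod (q (z :: complex ^ 'n)) \<le> K0 * B ^ n * norm z ^ n * snorm q"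
    using hom_poly_snorm_bound[where 'n = 'n] by (elim exE conjE)
  \<comment> \<open>The bound is asked for every j, trivially beyond \<beta>, so that the choice
    gives a nonnegative function on all naturals.\<close>
  have "\<exists>M\<ge>0. j \<le> \<beta> \<longrightarrow> (\<forall>\<theta>. norm \<theta> = 1 \<longrightarrow> cmod (P j (cvec \<theta>)) \<le> M)" for j
  proof (cases "j \<le> \<beta>")
    case True
    obtain M where "M \<ge> 0" "\<And>z. norm z \<le> 1 \<Longrightarrow> cmod (P j z) \<le> M"
      using entire_bounded_cball[OF hom_poly_entire[OF Pj[OF True]]] by blast
    then show ?thesis by (intro exI[of _ M]) auto
  qed auto
  then obtain A where A: "\<And>j. A j \<ge> 0" "\<And>j \<theta>. j \<le> \<beta> \<Longrightarrow> norm \<theta> = 1 \<Longrightarrow> cmod (P j (cvec \<theta>)) \<le> A j"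
    by metis
  define S where "S = (\<Sum>j\<le>\<beta>. A j)"
  have S: "S \<ge> 0" unfolding S_def using A(1) by (intro sum_nonneg) auto
  \<comment> \<open>The reciprocal coercivity constant. It increases with the degree since \<alpha>
    \<ge> 0, so its value at N serves all degrees up to N.\<close>
  define H where "H = (\<lambda>N :: nat. C * (real N + D) powr \<alpha>)"
  have H0: "H N > 0" for N using CD by (simp add: H_def)
  have H: "Re (sphere_inner (\<lambda>z. P (2 * k) z * g z) g) \<ge> 1 / H N * snorm2 g"
    if "n \<le> N" "hom_poly n g" for n N g
  proof -
    have "H n \<le> H N" unfolding H_def
      using CD that(1) by (intro mult_left_mono powr_mono2) auto
    then have "1 / H N * snorm2 g \<le> 1 / H n * snorm2 g"
      using H0[of n] snorm2_nonneg by (intro mult_right_mono frac_le) auto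
    also have "\<dots> \<le> Re (sphere_inner (\<lambda>z. P (2 * k) z * g z) g)"
      using pos[OF that(2)] by (simp add: H_def sphere_inner_self)
    finally show ?thesis .
  qed
  \<comment> \<open>The \<delta>-th root makes the cost of one division equal to that of \<delta>
    degrees; the maximum with 1 ensures \<open>L N \<ge> 1\<close>.\<close>
  define L where "L = (\<lambda>N. (max 1 ((1 + S) * H N)) powr (1 / \<delta>))"
  have L1: "L N \<ge> 1" for N unfolding L_def by (intro ge_one_powr_ge_zero) auto
  have L2: "L N ^ \<delta> \<ge> (1 + S) * H N" for N
  proof -
    have "L N ^ \<delta> = max 1 ((1 + S) * H N) powr (1 / \<delta> * \<delta>)"
      unfolding L_def powr_powr[symmetric] by (rule powr_realpow[symmetric]) (simp add: less_max_iff_disj)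
    also have "\<dots> = max 1 ((1 + S) * H N)" using \<delta> by simp
    finally show ?thesis by simp
  qed
  define good where "good = (\<lambda>m Q R. poly_fun Q \<and> poly_fun R \<and> (\<forall>z. taylor m f z = PP z * Q z + R z) \<and>
     (claplacian ^^ k) R = (\<lambda>z. 0) \<and>
     (\<forall>z. cmod (Q z) \<le> K0 * snorm (taylor m f) * (\<Sum>n\<le>m. L m ^ (m - n) * (B * norm z) ^ n)) \<and>
     (m < 2 * k \<longrightarrow> Q = (\<lambda>z. 0)))"
  have "\<exists>Q R. good m Q R" for m
    unfolding good_def PP_def
  proof (rule perturbed_decomposition[where A = A and H = "H m" and N = m, OF P2k \<beta> Pj _ _ _ A H0 H L1 _ hom_poly_taylor[OF f]])
    show "(1 + sum A {..\<beta>}) * H m \<le> L m ^ (2 * k - \<beta>)" using L2[of m] by (simp add: S_def \<delta>_def)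
  qed (use KB in auto)
  then obtain Q R where "\<And>m. good m (Q m) (R m)" by metis
  note QR = this[unfolded good_def]
  have Qp: "poly_fun (Q m)" and Rp: "poly_fun (R m)" and dec: "taylor m f z = PP z * Q m z + R m z"
    and lapR: "(claplacian ^^ k) (R m) = (\<lambda>z. 0)"
    and Qb: "cmod (Q m z) \<le> K0 * snorm (taylor m f) * (\<Sum>n\<le>m. L m ^ (m - n) * (B * norm z) ^ n)"
    and Q0: "Q 0 = (\<lambda>z. 0)" for m z
    using QR k by (blast, blast, blast, blast, blast, simp)
  \<comment> \<open>Two exponents above the order of f are used: \<rho> for the decay of its
    components, \<rho>' for the growth of the resulting series.\<close>
  have series: "normal_series Q \<and> growth_le (\<lambda>z. \<Sum>m. Q m z) \<rho>'"
    if \<rho>: "growth_order f < ereal \<rho>" "0 < \<rho>" "\<gamma> < 1 / \<rho>" "\<rho> < \<rho>'" for \<rho> \<rho>'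
  proof -
    obtain K E where KE: "K \<ge> 0" "E \<ge> 1" "\<And>m \<theta>. m \<ge> 1 \<Longrightarrow> norm \<theta> = 1 \<Longrightarrow>
       cmod (taylor m f (cvec \<theta>)) \<le> K * E ^ m * real m powr (- (real m / \<rho>))"
      using growth_le_taylor[OF f growth_order_imp_growth_le[OF f \<rho>(1,2)] \<rho>(2)] by blast
    define s1 where "s1 = snorm (\<lambda>_ :: complex ^ 'n. 1)"
    have s1: "s1 \<ge> 0" by (simp add: s1_def)
    \<comment> \<open>From m + D \<le> (1 + D) m for m \<ge> 1, G0 m^\<alpha> dominates the maximum
      inside \<open>L m\<close>; hence L m is at most E1 m^\<gamma>.\<close>
    define G0 where "G0 = max 1 ((1 + S) * (C * (1 + D) powr \<alpha>))"
    define E1 where "E1 = G0 powr (1 / \<delta>)"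
    have E1: "E1 \<ge> 1" unfolding E1_def G0_def by (intro ge_one_powr_ge_zero) auto
    have Lm: "L m \<le> E1 * real m powr \<gamma>" if m: "m \<ge> 1" for m
    proof -
      have "D \<le> D * real m" using m CD by simp
      then have "real m + D \<le> (1 + D) * real m" by (simp add: distrib_right)
      then have "H m \<le> C * (((1 + D) * real m) powr \<alpha>)"
        unfolding H_def using CD by (intro mult_left_mono powr_mono2) auto
      also have "\<dots> = (C * (1 + D) powr \<alpha>) * real m powr \<alpha>"
        using CD by (simp add: powr_mult)
      finally have "(1 + S) * H m \<le> ((1 + S) * (C * (1 + D) powr \<alpha>)) * real m powr \<alpha>"
        using S by (simp add: mult_left_mono mult.assoc)
      also have "\<dots> \<le> G0 * real m powr \<alpha>" by (intro mult_right_mono) (auto simp: G0_def)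
      finally have 1: "(1 + S) * H m \<le> G0 * real m powr \<alpha>" .
      have "1 * 1 \<le> G0 * real m powr \<alpha>"
        using m CD by (intro mult_mono ge_one_powr_ge_zero) (auto simp: G0_def)
      with 1 have "L m \<le> (G0 * real m powr \<alpha>) powr (1 / \<delta>)"
        unfolding L_def by (intro powr_mono2) auto
      also have "\<dots> = E1 * real m powr \<gamma>"
        by (simp add: powr_mult powr_powr E1_def \<gamma>_def G0_def)
      finally show ?thesis .
    qed
    have "\<exists>b. summable b \<and> (\<forall>m. b m \<ge> 0) \<and>
     (\<forall>m R z. R > 0 \<longrightarrow> norm z \<le> R \<longrightarrow> cmod (Q m z) \<le> b m * exp (R powr \<rho>' / \<rho>'))"
    proof (rule growth_series_bound[OF \<rho>(2,4,3)])
      show "K0 * (K * s1) \<ge> 0" "E * (E1 * B) \<ge> 0" using KB KE s1 E1 by auto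
      show "Q 0 z = 0" for z by (simp add: Q0)
      fix m :: nat and z :: "complex ^ 'n" assume m: "m \<ge> 1"
      let ?w = "real m powr (- (real m / \<rho>))"
      have "snorm (taylor m f) \<le> (K * E ^ m * ?w) * s1"
        unfolding s1_def using KE m
        by (intro snorm_le_sup hom_poly_entire[OF hom_poly_taylor[OF f]]) auto
      moreover have "(\<Sum>n\<le>m. L m ^ (m - n) * (B * norm z) ^ n) \<le> (E1 * B) ^ m * (\<Sum>n\<le>m. (real m powr \<gamma>) ^ (m - n) * norm z ^ n)"
        unfolding sum_distrib_left
      proof (rule sum_mono)
        fix n assume n: "n \<in> {..m}"
        have "L m ^ (m - n) * (B * norm z) ^ n \<le> (E1 * real m powr \<gamma>) ^ (m - n) * (B * norm z) ^ n"
          using Lm[OF m] L1[of m] KB by (intro mult_right_mono power_mono) auto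
        also have "\<dots> = (E1 ^ (m - n) * B ^ n) * ((real m powr \<gamma>) ^ (m - n) * norm z ^ n)"
          by (simp add: power_mult_distrib)
        also have "\<dots> \<le> (E1 ^ m * B ^ m) * ((real m powr \<gamma>) ^ (m - n) * norm z ^ n)"
          using n E1 KB by (intro mult_right_mono mult_mono power_increasing) auto
        finally show "L m ^ (m - n) * (B * norm z) ^ n \<le> (E1 * B) ^ m * ((real m powr \<gamma>) ^ (m - n) * norm z ^ n)"
          by (simp add: power_mult_distrib)
      qed
      ultimately have "K0 * snorm (taylor m f) * (\<Sum>n\<le>m. L m ^ (m - n) * (B * norm z) ^ n)
         \<le> K0 * ((K * E ^ m * ?w) * s1) * ((E1 * B) ^ m * (\<Sum>n\<le>m. (real m powr \<gamma>) ^ (m - n) * norm z ^ n))"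
        using KB KE s1 L1[of m]
        by (intro mult_mono mult_left_mono) (auto intro!: sum_nonneg mult_nonneg_nonneg intro: order_trans[OF zero_le_one])
      also have "\<dots> = K0 * (K * s1) * (E * (E1 * B)) ^ m * ?w * (\<Sum>n\<le>m. (real m powr \<gamma>) ^ (m - n) * norm z ^ n)"
        by (simp add: power_mult_distrib mult_ac)
      finally show "cmod (Q m z) \<le> K0 * (K * s1) * (E * (E1 * B)) ^ m * ?w * (\<Sum>n\<le>m. (real m powr \<gamma>) ^ (m - n) * norm z ^ n)"
        using Qb[of m z] by linarith
    qed
    then obtain b where b: "summable b" "\<And>m. b m \<ge> 0"
      "\<And>m R z. R > 0 \<Longrightarrow> norm z \<le> R \<Longrightarrow> cmod (Q m z) \<le> b m * exp (R powr \<rho>' / \<rho>')" by blast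
    have "\<rho>' > 0" using \<rho> by simp
    then show ?thesis using growth_series[where Q = Q and b = b] b by blast
  qed
  \<comment> \<open>The hypothesis on the order leaves room for an exponent that also satisfies
    \<gamma> < 1 / \<rho>; for \<alpha> = 0 this holds because \<gamma> = 0.\<close>
  have between: "\<exists>\<rho>. growth_order f < ereal \<rho> \<and> 0 < \<rho> \<and> \<gamma> < 1 / \<rho> \<and> \<rho> < \<tau>" if "growth_order f < ereal \<tau>" for \<tau>
  proof -
    have "growth_order f < min (ereal \<tau>) (if \<alpha> = 0 then \<infinity> else ereal (real \<delta> / \<alpha>))"
      unfolding \<delta>_def min_less_iff_conj using that ord by blast
    then obtain \<rho> where \<rho>: "growth_order f < ereal \<rho>" "ereal \<rho> < min (ereal \<tau>) (if \<alpha> = 0 then \<infinity> else ereal (real \<delta> / \<alpha>))"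
      using ereal_dense2 by blast
    have "0 < \<rho>" using growth_order_nonneg[OF f] \<rho>(1) by (metis ereal_less(2) le_less_trans)
    moreover have "\<gamma> < 1 / \<rho>"
      using \<rho>(2) CD \<delta> \<open>0 < \<rho>\<close> by (auto simp: \<gamma>_def field_simps split: if_splits)
    ultimately show ?thesis using \<rho> by (intro exI[of _ \<rho>]) auto
  qed
  \<comment> \<open>The series involves no exponent \<rho>, so the growth bounds for all \<tau>
    above the order of f concern the same q.\<close>
  define q where "q = (\<lambda>z. \<Sum>m. Q m z)"
  define r where "r = (\<lambda>z. f z - PP z * q z)"
  have "\<exists>\<tau>. growth_order f < ereal \<tau>" using ord ereal_dense2 by blast
  then obtain \<tau>0 where "growth_order f < ereal \<tau>0" by blast
  then have nQ: "normal_series Q" using between series by blast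
  have entQ: "entire (Q m)" and entR: "entire (R m)" for m using Qp Rp poly_fun_entire by auto
  have entq: "entire q" unfolding q_def by (rule normal_series_entire[OF entQ nQ])
  have entr: "entire r" unfolding r_def by (intro entire_diff entire_mult f entPP entq)
  have growth: "growth_order q \<le> ereal \<tau> \<and> growth_order r \<le> ereal \<tau>" if \<tau>: "growth_order f < ereal \<tau>" for \<tau>
  proof -
    obtain \<rho> where \<rho>: "growth_order f < ereal \<rho>" "0 < \<rho>" "\<gamma> < 1 / \<rho>" "\<rho> < \<tau>" using between[OF \<tau>] by blast
    define \<rho>' where "\<rho>' = (\<rho> + \<tau>) / 2"
    have \<rho>': "\<rho> < \<rho>'" "\<rho>' < \<tau>" "0 < \<rho>'" using \<rho> by (auto simp: \<rho>'_def)
    have gq: "growth_le q \<rho>'" using series[OF \<rho>(1,2,3) \<rho>'(1)] by (simp add: q_def)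
    have gf: "growth_le f \<rho>'"
      using growth_le_mono[OF growth_order_imp_growth_le[OF f \<rho>(1,2)]] \<rho>'(1) by simp
    have gP: "growth_le PP \<rho>'" unfolding PP_def
      by (intro growth_le_diff growth_le_sum growth_le_hom_poly[OF P2k] growth_le_hom_poly[OF Pj] \<rho>') auto
    have gr: "growth_le r \<rho>'" unfolding r_def by (intro growth_le_diff growth_le_mult gf gP gq)
    show ?thesis
      using growth_le_imp_growth_order[OF entq gq \<rho>'(3,2)] growth_le_imp_growth_order[OF entr gr \<rho>'(3,2)] by blast
  qed
  have "growth_order q \<le> growth_order f" "growth_order r \<le> growth_order f"
  proof -
    \<comment> \<open>A value below every real number above the order of f is at most that
      order.\<close>
    have "x \<le> growth_order f" if "\<And>\<tau>. growth_order f < ereal \<tau> \<Longrightarrow> x \<le> ereal \<tau>" for x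
    proof (rule ccontr)
      assume "\<not> x \<le> growth_order f"
      then obtain \<tau> where "growth_order f < ereal \<tau>" "ereal \<tau> < x" using ereal_dense2 not_le by metis
      then show False using that[of \<tau>] by simp
    qed
    then show "growth_order q \<le> growth_order f" "growth_order r \<le> growth_order f" using growth by blast+
  qed
  moreover have "(laplacian ^^ k) (\<lambda>y. r (cvec y)) x = 0" for x
  proof -
    \<comment> \<open>Normal convergence of the remainders follows from that of the Taylor series
      and of the quotients.\<close>
    have Req: "R m z = taylor m f z + (- PP z) * Q m z" for m z using dec[of m z] by simp
    have "normal_series (\<lambda>m z. taylor m f z + (- PP z) * Q m z)"
      using entire_diff[OF entire_const entPP, of 0]
      by (intro normal_series_add normal_series_taylor[OF f] normal_series_mult nQ) simp
    then have nR: "normal_series R" unfolding Req[symmetric] .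
    have "r z = (\<Sum>m. R m z)" for z
    proof -
      have "(\<lambda>m. taylor m f z) sums f z" using taylor_sums[OF f, of z 1] by simp
      moreover have "(\<lambda>m. PP z * Q m z) sums (PP z * q z)"
        unfolding q_def by (intro sums_mult summable_sums normal_series_summable nQ)
      ultimately have "(\<lambda>m. taylor m f z - PP z * Q m z) sums r z" unfolding r_def by (rule sums_diff)
      then show ?thesis by (simp add: Req sums_iff)
    qed
    then have "(laplacian ^^ k) (\<lambda>y. r (cvec y)) = (\<lambda>x. \<Sum>m. (claplacian ^^ k) (R m) (cvec x))"
      using laplacian_pow_normal_series[OF Rp nR, of k] by simp
    then show ?thesis by (simp add: lapR)
  qed
  moreover have "f z = (P (2 * k) z - (\<Sum>j\<le>\<beta>. P j z)) * q z + r z" for z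
    by (simp add: r_def PP_def)
  ultimately show ?thesis using entq entr by blast
qed

end
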